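(* Let $l\ge 2$ and $d_1,\ldots,d_l\ge 2$ be integers. The map $$l_{\otimes}:\mathcal{B}_{\otimes}(\otimes_{i=1}^{l}\mathbb{R}^{d_{i}})\rightarrow\mathscr{E}_{\otimes}(\otimes_{i=1}^{l}\mathbb{R}^{d_{i}}),\qquad Q\mapsto L\ddot{o}w(Q^{1}\otimes_{\pi}\cdots\otimes_{\pi}Q^{l}),$$ is a $GL_{\otimes}(\otimes_{i=1}^{l}\mathbb{R}^{d_{i}})$-equivariant retraction from $\mathcal{B}_{\otimes}(\otimes_{i=1}^{l}\mathbb{R}^{d_{i}})$ onto $\mathscr{E}_{\otimes}(\otimes_{i=1}^{l}\mathbb{R}^{d_{i}})$.
   Context: $\otimes_{i=1}^l\mathbb{R}^{d_i}$ is a Euclidean space with the scalar product $\langle\cdot,\cdot\rangle_H$ determined by $\langle x^1\otimes\cdots\otimes x^l,y^1\otimes\cdots\otimes y^l\rangle_H=\prod_{i=1}^l\langle x^i,y^i\rangle$; its closed unit ball is $B_2^{d_1,\ldots,d_l}$. A $0$-symmetric convex body in a finite-dimensional Euclidean space $\mathbb{E}$ is a compact convex set $Q\subset\mathbb{E}$ with nonempty interior and $Q=-Q$. Its polar is $Q^\circ=\{y\in\mathbb{E}:\sup_{x\in Q}|\langle x,y\rangle|\le 1\}$ and its Minkowski functional is $g_Q(x)=\inf\{\lambda>0:\lambda^{-1}x\in Q\}$. For $0$-symmetric convex bodies $Q_i\subset\mathbb{R}^{d_i}$: $Q_1\otimes_\pi\cdots\otimes_\pi Q_l:=\mathrm{conv}\{x^1\otimes\cdots\otimes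 x^l: x^i\in Q_i\}$ and $Q_1\otimes_\epsilon\cdots\otimes_\epsilon Q_l:=(Q_1^\circ\otimes_\pi\cdots\otimes_\pi Q_l^\circ)^\circ$. A $0$-symmetric convex body $Q\subset\otimes_{i=1}^l\mathbb{R}^{d_i}$ is a tensorial body if there exist $0$-symmetric convex bodies $Q_i\subset\mathbb{R}^{d_i}$ with $Q_1\otimes_\pi\cdots\otimes_\pi Q_l\subseteq Q\subseteq Q_1\otimes_\epsilon\cdots\otimes_\epsilon Q_l$. The set of tensorial bodies is $\mathcal{B}_\otimes(\otimes_{i=1}^l\mathbb{R}^{d_i})$, with the topology of the Hausdorff distance induced by the norm of $\langle\cdot,\cdot\rangle_H$. For a $0$-symmetric convex body $Q\subset\otimes_{i=1}^l\mathbb{R}^{d_i}$, put $a^j=e_1^{d_j}$ (first canonical basis vector of $\mathbb{R}^{d_j}$) for $j<l$, and $a^l=\lambda e_1^{d_l}$ with $\lambda=1/g_Q(e_1^{d_1}\otimes\cdots\otimes e_1^{d_l})$. Then $Q^i:=\{x\in\mathbb{R}^{d_i}: a^1\otimes\cdots\otimes a^{i-1}\otimes x\otimes a^{i+1}\otimes\cdots\otimes a^l\in Q\}$, $i=1,\ldots,l$; these are $0$-symmetric convex bodies. An ellipsoid in $\otimes_{i=1}^l\mathbb{R}^{d_i}$ is a set $T(B_2^{d_1,\ldots,d_l})$ with $T$ a linear isomorphism of $\otimes_{i=1}^l\mathbb{R}^{d_i}$. $\mathscr{E}_\otimes(\otimes_{i=1}^l\mathbb{R}^{d_i})\subset\mathcal{B}_\otimes(\otimes_{i=1}^l\mathbb{R}^{d_i})$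 is the set of ellipsoids in $\otimes_{i=1}^l\mathbb{R}^{d_i}$ that are tensorial bodies (tensorial ellipsoids). For a $0$-symmetric convex body $Q$, $L\ddot{o}w(Q)$ is its L\"owner ellipsoid, the unique ellipsoid of minimal volume containing $Q$; it is known that the L\"owner ellipsoid of a projective tensor product $Q_1\otimes_\pi\cdots\otimes_\pi Q_l$ is a tensorial ellipsoid. A decomposable vector is one of the form $x^1\otimes\cdots\otimes x^l$. $GL_\otimes(\otimes_{i=1}^l\mathbb{R}^{d_i})$ is the group of linear isomorphisms of $\otimes_{i=1}^l\mathbb{R}^{d_i}$ mapping decomposable vectors to decomposable vectors; it acts on $\mathcal{B}_\otimes(\otimes_{i=1}^l\mathbb{R}^{d_i})$ and on $\mathscr{E}_\otimes(\otimes_{i=1}^l\mathbb{R}^{d_i})$ by $TQ=\{Tu:u\in Q\}$. A $G$-equivariant retraction is a continuous retraction $f$ with $f(gx)=gf(x)$ for all $g\in G$. *)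

theory Defs
  imports "HOL-Analysis.Analysis"
begin

text \<open>
  Carriers.  The tensor product \<open>\<real>\<^bsup>d 0\<^esup> \<otimes> \<dots> \<otimes> \<real>\<^bsup>d (l-1)\<^esup>\<close> is the type \<open>real ^ 'm\<close>
  with \<open>CARD('m) = (\<Prod>i<l. d i)\<close>, the elements of \<open>'m\<close> standing for the multi-indices.  The factors,
  whose dimensions vary with \<open>i\<close>, cannot be types of their own.  They are the coordinate subspaces
  \<open>Rsp d\<close> of \<open>real ^ 'm\<close>, that is, vectors with \<open>d\<close> entries padded by zeros; there is always enough
  room, since each \<open>d i\<close> is at most \<open>CARD('m)\<close> when all \<open>d i\<close> are positive.
  Factors are numbered \<open>0, \<dots>, l-1\<close> and coordinates \<open>0, \<dots>, d i - 1\<close>.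
\<close>

definition coord :: "nat \<Rightarrow> 'm::finite"
  where "coord k = from_nat_into UNIV k"

definition Rsp :: "nat \<Rightarrow> (real ^ 'm::finite) set"
  where "Rsp n = {x. \<forall>j. j \<notin> coord ` {..<n} \<longrightarrow> x $ j = 0}"

definition e1 :: "real ^ 'm::finite"
  where "e1 = axis (coord 0) 1"

text \<open>
  A fixed bijection between \<open>'m\<close> and the set of multi-indices; it exists iff the cardinalities agree.
\<close>

definition multi_index :: "nat \<Rightarrow> (nat \<Rightarrow> nat) \<Rightarrow> 'm::finite \<Rightarrow> nat \<Rightarrow> nat"
  where "multi_index l d = (SOME f. bij_betw f UNIV (PiE {..<l} (\<lambda>i. {..<d i})))"

definition tensor :: "nat \<Rightarrow> (nat \<Rightarrow> nat) \<Rightarrow> (nat \<Rightarrow> real ^ 'm::finite) \<Rightarrow> real ^ 'm"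
  where "tensor l d x = (\<chi> m. \<Prod>i<l. x i $ coord (multi_index l d m i))"

lemma bij_coord: "bij_betw (coord :: nat \<Rightarrow> 'm::finite) {..<CARD('m)} UNIV"
  unfolding coord_def by (rule bij_betw_from_nat_into_finite) simp

lemma bij_multi_index:
  assumes "CARD('m::finite) = (\<Prod>i<l. d i)"
  shows "bij_betw (multi_index l d :: 'm \<Rightarrow> nat \<Rightarrow> nat) UNIV (PiE {..<l} (\<lambda>i. {..<d i}))"
proof -
  have "card (PiE {..<l} (\<lambda>i. {..<d i})) = CARD('m)"
    using assms by (simp add: card_PiE)
  moreover have "finite (PiE {..<l} (\<lambda>i. {..<d i}))"
    by (intro finite_PiE) auto
  ultimately have "\<exists>f. bij_betw f (UNIV :: 'm set) (PiE {..<l} (\<lambda>i. {..<d i}))"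
    by (intro finite_same_card_bij) auto
  then show ?thesis
    unfolding multi_index_def by (rule someI_ex)
qed

lemma inj_on_coord:
  assumes "n \<le> CARD('m::finite)"
  shows "inj_on (coord :: nat \<Rightarrow> 'm) {..<n}"
  using bij_coord[where 'm='m] assms
  by (auto simp: bij_betw_def intro: inj_on_subset)

lemma dim_le_card:
  fixes l :: nat and d :: "nat \<Rightarrow> nat"
  assumes card: "CARD('m::finite) = (\<Prod>i<l. d i)" and i: "i < l"
  shows "d i \<le> CARD('m)"
proof (rule dvd_imp_le)
  show "d i dvd CARD('m)"
    unfolding card using i by (intro dvd_prodI finite_lessThan) simp
qed simp

text \<open>
  The two properties that identify \<open>real ^ 'm\<close> with its standard inner product as the Euclidean tensor
  product.
\<close>

lemma inner_tensor:
  fixes x y :: "nat \<Rightarrow> real ^ 'm::finite"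
  assumes card: "CARD('m) = (\<Prod>i<l. d i)"
    and x: "\<And>i. i < l \<Longrightarrow> x i \<in> Rsp (d i)"
  shows "tensor l d x \<bullet> tensor l d y = (\<Prod>i<l. x i \<bullet> y i)"
proof -
  have fac: "x i \<bullet> y i = (\<Sum>k<d i. x i $ coord k * y i $ coord k)" if "i < l" for i
  proof -
    have inj: "inj_on (coord :: nat \<Rightarrow> 'm) {..<d i}"
      using dim_le_card[OF card that] by (rule inj_on_coord)
    have "x i \<bullet> y i = (\<Sum>j\<in>UNIV. x i $ j * y i $ j)"
      by (simp add: inner_vec_def)
    also have "\<dots> = (\<Sum>j\<in>coord ` {..<d i}. x i $ j * y i $ j)"
      using x[OF that] by (intro sum.mono_neutral_right) (auto simp: Rsp_def)
    also have "\<dots> = (\<Sum>k<d i. x i $ coord k * y i $ coord k)"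
      using inj by (subst sum.reindex) (auto simp: o_def)
    finally show ?thesis .
  qed
  have "tensor l d x \<bullet> tensor l d y
      = (\<Sum>m\<in>(UNIV :: 'm set). \<Prod>i<l. x i $ coord (multi_index l d m i) * y i $ coord (multi_index l d m i))"
    unfolding inner_vec_def tensor_def prod.distrib by simp
  also have "\<dots> = (\<Sum>f\<in>PiE {..<l} (\<lambda>i. {..<d i}). \<Prod>i<l. x i $ coord (f i) * y i $ coord (f i))"
    by (rule sum.reindex_bij_betw[OF bij_multi_index[OF card]])
  also have "\<dots> = (\<Prod>i<l. \<Sum>k<d i. x i $ coord k * y i $ coord k)"
    by (rule prod_sum_PiE[symmetric]) auto
  also have "\<dots> = (\<Prod>i<l. x i \<bullet> y i)"
    by (intro prod.cong) (auto simp: fac)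
  finally show ?thesis .
qed

lemma span_tensor:
  assumes card: "CARD('m::finite) = (\<Prod>i<l. d i)"
  shows "span {tensor l d x | x. \<forall>i<l. x i \<in> Rsp (d i)} = (UNIV :: (real ^ 'm) set)"
proof -
  have "axis m 1 \<in> {tensor l d x | x. \<forall>i<l. x i \<in> Rsp (d i)}" for m :: 'm
  proof -
    define x :: "nat \<Rightarrow> real ^ 'm" where "x = (\<lambda>i. axis (coord (multi_index l d m i)) 1)"
    note bij = bij_multi_index[OF card]
    have mem: "multi_index l d m' \<in> PiE {..<l} (\<lambda>i. {..<d i})" for m' :: 'm
      using bij by (auto simp: bij_betw_def)
    have "tensor l d x $ m' = axis m 1 $ m'" for m'
    proof (cases "m' = m")
      case True
      then show ?thesis by (simp add: tensor_def x_def axis_def)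
    next
      case False
      then have "multi_index l d m' \<noteq> multi_index l d m"
        using bij by (auto simp: bij_betw_def inj_on_def)
      then obtain i where i: "i < l" "multi_index l d m' i \<noteq> multi_index l d m i"
        using PiE_ext[OF mem mem] by blast
      have "inj_on (coord :: nat \<Rightarrow> 'm) {..<d i}"
        using dim_le_card[OF card i(1)] by (rule inj_on_coord)
      then have "(coord (multi_index l d m' i) :: 'm) \<noteq> coord (multi_index l d m i)"
        using mem[of m] mem[of m'] i unfolding inj_on_def by (auto simp: PiE_iff)
      then have "x i $ coord (multi_index l d m' i) = 0"
        by (simp add: x_def axis_def)
      then show ?thesis
        using i(1) False by (auto simp: tensor_def axis_def)
    qed
    then have "axis m 1 = tensor l d x"
      by (simp add: vec_eq_iff)
    moreover have "x i \<in> Rsp (d i)" if "i < l" for i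
      using mem[of m] that by (auto simp: x_def Rsp_def axis_def PiE_iff)
    ultimately show ?thesis by blast
  qed
  moreover have "(Basis :: (real ^ 'm) set) = range (\<lambda>m. axis m 1)"
    by (auto simp: Basis_vec_def)
  ultimately have "(Basis :: (real ^ 'm) set) \<subseteq> {tensor l d x | x. \<forall>i<l. x i \<in> Rsp (d i)}" (is "_ \<subseteq> ?D")
    by (metis (no_types, lifting) image_subset_iff)
  from span_mono[OF this] have "span (Basis :: (real ^ 'm) set) \<subseteq> span ?D" .
  then show ?thesis
    by (simp add: top.extremum_unique)
qed

text \<open>
  Convex bodies and polars are taken relative to a linear subspace \<open>E\<close>, viewed as a Euclidean space of
  its own: \<open>Rsp n\<close> for the factors, \<open>UNIV\<close> for the tensor product.
\<close>

definition sym_convex_body :: "'a::euclidean_space set \<Rightarrow> 'a set \<Rightarrow> bool"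
  where "sym_convex_body E Q \<longleftrightarrow>
    Q \<subseteq> E \<and> compact Q \<and> convex Q \<and> top_of_set E interior_of Q \<noteq> {} \<and> Q = uminus ` Q"

definition polar :: "'a::euclidean_space set \<Rightarrow> 'a set \<Rightarrow> 'a set"
  where "polar E Q = {y \<in> E. \<forall>x\<in>Q. \<bar>x \<bullet> y\<bar> \<le> 1}"

definition minkowski_functional :: "'a::real_vector set \<Rightarrow> 'a \<Rightarrow> real"
  where "minkowski_functional Q x = Inf {r. r > 0 \<and> inverse r *\<^sub>R x \<in> Q}"

definition proj_tensor ::
  "nat \<Rightarrow> (nat \<Rightarrow> nat) \<Rightarrow> (nat \<Rightarrow> (real ^ 'm::finite) set) \<Rightarrow> (real ^ 'm) set"
  where "proj_tensor l d Q = convex hull {tensor l d x | x. \<forall>i<l. x i \<in> Q i}"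

definition inj_tensor ::
  "nat \<Rightarrow> (nat \<Rightarrow> nat) \<Rightarrow> (nat \<Rightarrow> (real ^ 'm::finite) set) \<Rightarrow> (real ^ 'm) set"
  where "inj_tensor l d Q = polar UNIV (proj_tensor l d (\<lambda>i. polar (Rsp (d i)) (Q i)))"

definition tensorial_bodies :: "nat \<Rightarrow> (nat \<Rightarrow> nat) \<Rightarrow> (real ^ 'm::finite) set set"
  where "tensorial_bodies l d =
    {Q. sym_convex_body UNIV Q \<and>
        (\<exists>P. (\<forall>i<l. sym_convex_body (Rsp (d i)) (P i)) \<and>
             proj_tensor l d P \<subseteq> Q \<and> Q \<subseteq> inj_tensor l d P)}"

definition ellipsoid :: "'a::euclidean_space set \<Rightarrow> bool"
  where "ellipsoid S \<longleftrightarrow> (\<exists>T :: 'a \<Rightarrow> 'a. linear T \<and> bij T \<and> S = T ` cball 0 1)"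

definition tensorial_ellipsoids :: "nat \<Rightarrow> (nat \<Rightarrow> nat) \<Rightarrow> (real ^ 'm::finite) set set"
  where "tensorial_ellipsoids l d = {S \<in> tensorial_bodies l d. ellipsoid S}"

definition Loewner :: "'a::euclidean_space set \<Rightarrow> 'a set"
  where "Loewner Q = (THE S. ellipsoid S \<and> Q \<subseteq> S \<and>
    (\<forall>S'. ellipsoid S' \<and> Q \<subseteq> S' \<longrightarrow> measure lebesgue S \<le> measure lebesgue S'))"

definition anchor :: "nat \<Rightarrow> (nat \<Rightarrow> nat) \<Rightarrow> (real ^ 'm::finite) set \<Rightarrow> nat \<Rightarrow> real ^ 'm"
  where "anchor l d Q j =
    (if j = l - 1 then (1 / minkowski_functional Q (tensor l d (\<lambda>_. e1))) *\<^sub>R e1 else e1)"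

definition body_section ::
  "nat \<Rightarrow> (nat \<Rightarrow> nat) \<Rightarrow> (real ^ 'm::finite) set \<Rightarrow> nat \<Rightarrow> (real ^ 'm) set"
  where "body_section l d Q i = {x \<in> Rsp (d i). tensor l d ((anchor l d Q)(i := x)) \<in> Q}"

definition l_tensor :: "nat \<Rightarrow> (nat \<Rightarrow> nat) \<Rightarrow> (real ^ 'm::finite) set \<Rightarrow> (real ^ 'm) set"
  where "l_tensor l d Q = Loewner (proj_tensor l d (body_section l d Q))"

definition decomposable :: "nat \<Rightarrow> (nat \<Rightarrow> nat) \<Rightarrow> real ^ 'm::finite \<Rightarrow> bool"
  where "decomposable l d u \<longleftrightarrow> (\<exists>x. (\<forall>i<l. x i \<in> Rsp (d i)) \<and> u = tensor l d x)"

definition GL_tensor :: "nat \<Rightarrow> (nat \<Rightarrow> nat) \<Rightarrow> (real ^ 'm::finite \<Rightarrow> real ^ 'm) set"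
  where "GL_tensor l d =
    {T. linear T \<and> bij T \<and> (\<forall>u. decomposable l d u \<longrightarrow> decomposable l d (T u))}"

text \<open>
  The value \<open>0\<close> outside nonempty compact sets only serves to meet the requirement of \<open>Metric_space\<close>
  that distances be nonnegative on the whole type.
\<close>

definition hausdorff_dist :: "'a::metric_space set \<Rightarrow> 'a set \<Rightarrow> real"
  where "hausdorff_dist A B =
    (if A \<noteq> {} \<and> compact A \<and> B \<noteq> {} \<and> compact B
     then max (SUP a\<in>A. infdist a B) (SUP b\<in>B. infdist b A) else 0)"

lemma Metric_space_hausdorff_dist:
  "Metric_space {A :: 'a::metric_space set. A \<noteq> {} \<and> compact A} hausdorff_dist"
proof -
  have bdd: "bdd_above ((\<lambda>a. infdist a B) ` A)" if "compact A" for A B :: "'a set"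
    by (intro bounded_imp_bdd_above compact_imp_bounded compact_continuous_image that)
      (intro continuous_intros)
  have le: "infdist a B \<le> (SUP a\<in>A. infdist a B)" if "compact A" "a \<in> A" for a and A B :: "'a set"
    using bdd[OF that(1)] that(2) by (rule cSUP_upper2) simp
  have nn: "0 \<le> (SUP a\<in>A. infdist a B)" if "compact A" "A \<noteq> {}" for A B :: "'a set"
    using le[OF that(1)] that(2) infdist_nonneg by (meson ex_in_conv order_trans)
  have sub: "A \<subseteq> B"
    if "compact A" "compact B" "B \<noteq> {}" "(SUP a\<in>A. infdist a B) \<le> 0" for A B :: "'a set"
  proof
    fix a assume "a \<in> A"
    then have "infdist a B = 0"
      using le[OF that(1), of a B] that(4) infdist_nonneg[of a B] by linarith
    then show "a \<in> B"
      using that(2,3) by (simp add: in_closed_iff_infdist_zero compact_imp_closed)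
  qed
  have tri: "(SUP a\<in>A. infdist a C) \<le> (SUP a\<in>A. infdist a B) + (SUP b\<in>B. infdist b C)"
    if "compact A" "A \<noteq> {}" "compact B" "B \<noteq> {}" "C \<noteq> {}" for A B C :: "'a set"
  proof (rule cSUP_least[OF that(2)])
    fix a assume a: "a \<in> A"
    let ?H = "SUP b\<in>B. infdist b C"
    have "infdist a C - ?H \<le> dist a b" if "b \<in> B" for b
      using infdist_triangle[of a C b] le[OF \<open>compact B\<close> that, of C] by linarith
    then have "infdist a C - ?H \<le> infdist a B"
      unfolding infdist_notempty[OF \<open>B \<noteq> {}\<close>] by (intro cINF_greatest \<open>B \<noteq> {}\<close>)
    then show "infdist a C \<le> (SUP a\<in>A. infdist a B) + ?H"
      using le[OF that(1) a, of B] by linarith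
  qed
  show ?thesis
  proof
    fix A B C :: "'a set"
    show "0 \<le> hausdorff_dist A B"
      using nn[of A B] by (simp add: hausdorff_dist_def le_max_iff_disj)
    show "hausdorff_dist A B = hausdorff_dist B A"
      by (simp add: hausdorff_dist_def max.commute)
    assume "A \<in> {A. A \<noteq> {} \<and> compact A}" "B \<in> {A. A \<noteq> {} \<and> compact A}"
    then have AB: "A \<noteq> {}" "compact A" "B \<noteq> {}" "compact B"
      by auto
    show "hausdorff_dist A B = 0 \<longleftrightarrow> A = B"
    proof
      assume "hausdorff_dist A B = 0"
      then have "(SUP a\<in>A. infdist a B) \<le> 0" "(SUP b\<in>B. infdist b A) \<le> 0"
        using AB by (auto simp: hausdorff_dist_def max_def split: if_splits)
      then show "A = B"
        using sub[of A B] sub[of B A] AB by blast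
    next
      assume "A = B"
      then show "hausdorff_dist A B = 0"
        using AB by (simp add: hausdorff_dist_def)
    qed
    assume "C \<in> {A. A \<noteq> {} \<and> compact A}"
    then have C: "C \<noteq> {}" "compact C"
      by auto
    show "hausdorff_dist A C \<le> hausdorff_dist A B + hausdorff_dist B C"
      using tri[of A B C] tri[of C B A] AB C by (simp add: hausdorff_dist_def max_def)
  qed
qed

lemma Metric_space_tensorial_bodies: "Metric_space (tensorial_bodies l d) hausdorff_dist"
proof (rule Metric_space.subspace[OF Metric_space_hausdorff_dist])
  show "tensorial_bodies l d \<subseteq> {A. A \<noteq> {} \<and> compact A}"
    by (auto simp: tensorial_bodies_def sym_convex_body_def interior_of_def)
qed

definition tensorial_body_topology :: "nat \<Rightarrow> (nat \<Rightarrow> nat) \<Rightarrow> (real ^ 'm::finite) set topology"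
  where "tensorial_body_topology l d = Metric_space.mtopology (tensorial_bodies l d) hausdorff_dist"

end

theory Submission
  imports Defs
begin

text \<open>
  If \<open>Q\<close> lies between the projective and the injective tensor product of bodies \<open>P\<^sub>i\<close>, its gauge on
  decomposable vectors is the product of the gauges of the \<open>P\<^sub>i\<close>.  Hence the sections \<open>Q\<^sup>i\<close> are
  multiples of the \<open>P\<^sub>i\<close> with factors of product one, and \<open>l\<^sub>\<otimes> Q\<close> is the Loewner ellipsoid of
  \<open>conv (Q \<inter> Dec)\<close>, where \<open>Dec\<close> is the cone of decomposable vectors.

  A position \<open>A\<close> of a body \<open>P\<close> of dimension \<open>n\<close> is optimal when every quadratic form that is at most
  \<open>c\<close> on \<open>A P\<close> has trace at most \<open>n c\<close>; this is the first-order condition for a maximal determinant, and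
  by the inequality of arithmetic and geometric means it is also sufficient.  The condition is stable
  under projective tensor products, so the Loewner ellipsoid of such a product is tensorial.
  Conversely, an ellipsoid between the two tensor products of ellipsoids agrees with the Hilbertian
  tensor product on \<open>Dec\<close>, and so does its polar; the equality case of the Cauchy-Schwarz inequality
  then identifies them.  Continuity follows because a matrix of Frobenius norm at most \<open>\<surd>n\<close> and
  determinant close to one in absolute value is almost orthogonal.  Equivariance rests on the fact
  that a linear isomorphism preserving \<open>Dec\<close> is a tensor product of linear maps up to a permutation of
  the factors.
\<close>

section \<open>Determinants and optimal positions\<close>

text \<open>Several objects are available only up to a choice. The factors \<open>P i\<close> of a
  tensorial body can be rescaled against each other, the matrix \<open>A\<close> of an ellipsoid is
  determined only up to an orthogonal matrix on the left, and the sections are taken at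
  \<open>e1\<close>, which the group does not fix. Comparisons are therefore made on
  \<open>norm (A *v x)\<close> and on the set \<open>proj_tensor l d P\<close>, which are free of
  these choices.

  Hausdorff closeness of two bodies does not pass directly to their intersections with the cone of
  decomposable vectors. Inclusions between dilates do restrict to a cone and pass to convex hulls,
  so closeness is first converted into dilation factors.

  If \<open>A\<close> is optimal for \<open>Q\<close> and \<open>M\<close> maps \<open>A Q\<close>
  into the unit ball, the form \<open>transpose M ** M\<close> is at most one on \<open>A Q\<close>,
  so its trace, the squared Frobenius norm of \<open>M\<close>, is at most the dimension. This case
  of the trace inequality gives minimality, uniqueness and stability of the ellipsoid.

  The factors have different dimensions but share one vector type; a linear map of a factor is
  extended by the identity on the remaining coordinates.\<close>

lemma has_real_derivative_det_line:
  fixes S :: "real^'n^'n"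
  shows "((\<lambda>t. det (mat 1 + t *\<^sub>R S)) has_real_derivative trace S) (at 0)"
proof -
  let ?P = "{p. p permutes (UNIV :: 'n set)}"
  have entry: "((\<lambda>t. (mat 1 + t *\<^sub>R S) $ i $ j) has_real_derivative S $ i $ j) (at 0)" for i j
    by (auto intro!: derivative_eq_intros)
  have "((\<lambda>t. \<Sum>p\<in>?P. of_int (sign p) * (\<Prod>i\<in>UNIV. (mat 1 + t *\<^sub>R S) $ i $ p i)) has_real_derivative
     (\<Sum>p\<in>?P. of_int (sign p) * (\<Sum>i\<in>UNIV. S $ i $ p i * (\<Prod>j\<in>UNIV - {i}. (mat 1 + 0 *\<^sub>R S) $ j $ p j)))) (at 0)"
    by (intro DERIV_sum DERIV_cmult has_field_derivative_prod entry)
  also have "(\<Sum>p\<in>?P. of_int (sign p) * (\<Sum>i\<in>UNIV. S $ i $ p i * (\<Prod>j\<in>UNIV - {i}. (mat 1 + 0 *\<^sub>R S) $ j $ p j)))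
      = (\<Sum>p\<in>{id}. of_int (sign p) * (\<Sum>i\<in>UNIV. S $ i $ p i * (\<Prod>j\<in>UNIV - {i}. (mat 1 + 0 *\<^sub>R S) $ j $ p j)))"
  proof (rule sum.mono_neutral_right)
    show "{id} \<subseteq> ?P" by (auto simp: permutes_id)
    show "\<forall>p\<in>?P - {id}. of_int (sign p) * (\<Sum>i\<in>UNIV. S $ i $ p i * (\<Prod>j\<in>UNIV - {i}. (mat 1 + 0 *\<^sub>R S) $ j $ p j)) = 0"
    proof
      fix p assume p: "p \<in> ?P - {id}"
      then have inj: "inj p" by (auto intro: permutes_inj)
      \<comment> \<open>A permutation other than the identity moves both \<open>k\<close> and
        \<open>p k\<close>; whichever index is deleted from the product, an off-diagonal entry of
        the identity matrix remains.\<close>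
      obtain k where k: "p k \<noteq> k" using p by (auto simp: fun_eq_iff)
      have kk: "p (p k) \<noteq> p k" using inj k by (simp add: inj_eq)
      have z: "(\<Prod>j\<in>UNIV - {i}. (mat 1 + 0 *\<^sub>R S) $ j $ p j) = 0" for i
      proof (rule prod_zero)
        show "\<exists>j\<in>UNIV - {i}. (mat 1 + 0 *\<^sub>R S) $ j $ p j = 0"
        proof (cases "i = k")
          case True
          then show ?thesis using k kk by (intro bexI[of _ "p k"]) (auto simp: mat_def)
        next
          case False
          then show ?thesis using k by (intro bexI[of _ k]) (auto simp: mat_def)
        qed
      qed simp
      then show "of_int (sign p) * (\<Sum>i\<in>UNIV. S $ i $ p i * (\<Prod>j\<in>UNIV - {i}. (mat 1 + 0 *\<^sub>R S) $ j $ p j)) = 0"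
        by (simp only: z) simp
    qed
  qed (simp add: finite_permutations)
  also have "\<dots> = trace S"
    by (simp add: sign_id trace_def mat_def)
  finally show ?thesis by (simp add: det_def)
qed

lemma continuous_on_det [continuous_intros]:
  fixes f :: "'a::topological_space \<Rightarrow> real^'n^'n"
  assumes "continuous_on S f"
  shows "continuous_on S (\<lambda>x. det (f x))"
  unfolding det_def by (intro continuous_intros assms)

lemma det_scaleR:
  fixes A :: "real^'n^'n"
  shows "det (c *\<^sub>R A) = c ^ CARD('n) * det A"
  unfolding det_def by (simp add: prod.distrib sum_distrib_left algebra_simps)

lemma matrix_mult_scaleR_right:
  fixes A :: "real^'n^'m" and B :: "real^'k^'n"
  shows "A ** (c *\<^sub>R B) = c *\<^sub>R (A ** B)"
  by (simp add: vec_eq_iff matrix_matrix_mult_def sum_distrib_left algebra_simps)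

lemma inner_matrix_vector_right:
  fixes A :: "real^'n^'m"
  shows "x \<bullet> (A *v y) = (transpose A *v x) \<bullet> y"
  by (simp add: dot_lmul_matrix)

lemma matrix_diff_rdistrib:
  fixes A :: "real^'n^'m" and C :: "real^'k^'n"
  shows "(A - B) ** C = A ** C - B ** C"
  by (simp add: vec_eq_iff matrix_matrix_mult_def left_diff_distrib sum_subtractf)

lemma inner_matrix_eq_trace:
  fixes M N :: "real^'n^'n"
  shows "M \<bullet> N = trace (transpose M ** N)"
  unfolding inner_vec_def trace_def matrix_matrix_mult_def transpose_def
  by (simp, subst sum.swap, simp)

lemma norm_matrix_power2_columns:
  fixes M :: "real^'n^'m"
  shows "(norm M)\<^sup>2 = (\<Sum>k\<in>UNIV. (norm (M *v axis k 1))\<^sup>2)"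
proof -
  have "(norm M)\<^sup>2 = (\<Sum>i\<in>UNIV. \<Sum>k\<in>UNIV. M $ i $ k * M $ i $ k)"
    by (simp add: power2_norm_eq_inner inner_vec_def)
  also have "\<dots> = (\<Sum>k\<in>UNIV. \<Sum>i\<in>UNIV. M $ i $ k * M $ i $ k)"
    by (rule sum.swap)
  also have "\<dots> = (\<Sum>k\<in>UNIV. (norm (M *v axis k 1))\<^sup>2)"
    by (simp add: power2_norm_eq_inner inner_vec_def matrix_vector_mult_basis column_def)
  finally show ?thesis .
qed

lemma norm_matrix_vector_le:
  fixes M :: "real^'n^'m"
  shows "norm (M *v x) \<le> norm M * norm x"
proof -
  have "(norm (M *v x))\<^sup>2 = (\<Sum>i\<in>UNIV. (M $ i \<bullet> x)\<^sup>2)"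
    unfolding power2_norm_eq_inner inner_vec_def[of "M *v x"]
    by (simp add: matrix_vector_mul_component power2_eq_square)
  also have "\<dots> \<le> (\<Sum>i\<in>UNIV. (norm (M $ i))\<^sup>2 * (norm x)\<^sup>2)"
    by (intro sum_mono) (metis Cauchy_Schwarz_ineq power2_norm_eq_inner)
  also have "\<dots> = (norm M * norm x)\<^sup>2"
    by (simp add: power_mult_distrib power2_norm_eq_inner inner_vec_def sum_distrib_right)
  finally show ?thesis by (rule power2_le_imp_le) simp
qed

lemma norm_mat_1: "(norm (mat 1 :: real^'n^'n))\<^sup>2 = CARD('n)"
  by (simp add: inner_matrix_eq_trace power2_norm_eq_inner trace_I transpose_mat)

text \<open>
  The arithmetic-geometric mean inequality for the squared singular values, including its equality
  case, is the Lagrange condition at a maximiser of the determinant on a Frobenius ball; no singular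
  value decomposition is needed.
\<close>

lemma det_maximiser_orthogonal:
  fixes M0 :: "real^'n^'n"
  assumes nM: "(norm M0)\<^sup>2 \<le> CARD('n)" and ge: "\<bar>det M0\<bar> \<ge> 1"
    and max: "\<And>M :: real^'n^'n. (norm M)\<^sup>2 \<le> CARD('n) \<Longrightarrow> \<bar>det M\<bar> \<le> \<bar>det M0\<bar>"
  shows "orthogonal_matrix M0"
proof -
  let ?n = "CARD('n)"
  have n0: "real ?n > 0" by simp
  \<comment> \<open>By homogeneity, maximality on the ball becomes an inequality valid for every
    matrix, so perturbations may leave the ball.\<close>
  have hom: "(det M)\<^sup>2 \<le> (det M0)\<^sup>2 * ((norm M)\<^sup>2 / ?n) ^ ?n" for M :: "real^'n^'n"
  proof (cases "M = 0")
    case True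
    then show ?thesis using det_0[where 'n='n and 'a=real] by (simp add: mat_0[symmetric] del: mat_0)
  next
    case False
    define c where "c = sqrt ?n / norm M"
    have c: "c > 0" using False n0 by (simp add: c_def)
    have "(norm (c *\<^sub>R M))\<^sup>2 = ?n"
      using False n0 by (simp add: c_def power_divide)
    then have "\<bar>det (c *\<^sub>R M)\<bar> \<le> \<bar>det M0\<bar>" by (intro max) simp
    then have "c ^ ?n * \<bar>det M\<bar> \<le> \<bar>det M0\<bar>"
      using c by (simp add: det_scaleR abs_mult)
    then have "(c ^ ?n * \<bar>det M\<bar>)\<^sup>2 \<le> (det M0)\<^sup>2"
      by (metis abs_ge_zero c mult_nonneg_nonneg less_imp_le power2_abs power_mono zero_le_power)
    then have "(c\<^sup>2) ^ ?n * (det M)\<^sup>2 \<le> (det M0)\<^sup>2"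
      by (simp add: power_mult_distrib power_mult[symmetric] mult.commute)
    moreover have "c\<^sup>2 = inverse ((norm M)\<^sup>2 / ?n)"
      using n0 by (simp add: c_def power_divide)
    moreover have "((norm M)\<^sup>2 / ?n) > 0" using False n0 by simp
    ultimately show ?thesis
      by (simp add: power_inverse field_simps power_divide)
  qed
  have d0: "(det M0)\<^sup>2 > 0" using ge by auto
  have pert: "(det (mat 1 + t *\<^sub>R N))\<^sup>2 \<le> ((norm (M0 + t *\<^sub>R (M0 ** N)))\<^sup>2 / ?n) ^ ?n" for t and N :: "real^'n^'n"
  proof -
    have eq: "M0 ** (mat 1 + t *\<^sub>R N) = M0 + t *\<^sub>R (M0 ** N)"
      by (simp add: matrix_add_ldistrib matrix_mult_scaleR_right)
    have "(det M0)\<^sup>2 * (det (mat 1 + t *\<^sub>R N))\<^sup>2 \<le> (det M0)\<^sup>2 * ((norm (M0 + t *\<^sub>R (M0 ** N)))\<^sup>2 / ?n) ^ ?n"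
      using hom[of "M0 ** (mat 1 + t *\<^sub>R N)"] by (simp add: eq[symmetric] det_mul power_mult_distrib)
    then show ?thesis using d0 by simp
  qed
  have nM0: "(norm M0)\<^sup>2 = ?n"
  proof (rule ccontr)
    assume "(norm M0)\<^sup>2 \<noteq> ?n"
    with nM have "(norm M0)\<^sup>2 / ?n < 1" by simp
    then have "((norm M0)\<^sup>2 / ?n) ^ ?n < 1"
      by (intro power_less_one_iff[THEN iffD2]) auto
    with pert[of 0 0] show False by simp
  qed
  have tr: "trace N = trace (transpose M0 ** M0 ** N)" for N :: "real^'n^'n"
  proof -
    \<comment> \<open>This function is nonnegative and vanishes at t = 0, so its derivative there is
      zero, for every direction \<open>N\<close>.\<close>
    define h where "h t = ((norm (M0 + t *\<^sub>R (M0 ** N)))\<^sup>2 / ?n) ^ ?n - (det (mat 1 + t *\<^sub>R N))\<^sup>2" for t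
    have q: "(norm (M0 + t *\<^sub>R (M0 ** N)))\<^sup>2 = (norm M0)\<^sup>2 + t * (2 * (M0 \<bullet> (M0 ** N))) + t\<^sup>2 * (norm (M0 ** N))\<^sup>2" for t
      unfolding power2_norm_eq_inner
      by (simp add: inner_add_left inner_add_right inner_commute algebra_simps power2_eq_square)
    have "((\<lambda>t. ((norm M0)\<^sup>2 + t * (2 * (M0 \<bullet> (M0 ** N))) + t\<^sup>2 * (norm (M0 ** N))\<^sup>2) / ?n) has_real_derivative (2 * (M0 \<bullet> (M0 ** N))) / ?n) (at 0)"
      by (auto intro!: derivative_eq_intros)
    then have d1: "((\<lambda>t. (norm (M0 + t *\<^sub>R (M0 ** N)))\<^sup>2 / ?n) has_real_derivative (2 * (M0 \<bullet> (M0 ** N))) / ?n) (at 0)"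
      unfolding q .
    have "(h has_real_derivative (?n * ((2 * (M0 \<bullet> (M0 ** N))) / ?n) - 2 * trace N)) (at 0)"
      unfolding h_def
      by (rule derivative_eq_intros d1 has_real_derivative_det_line refl)+ (use nM0 in simp)
    moreover have "\<forall>t. \<bar>0 - t\<bar> < 1 \<longrightarrow> h 0 \<le> h t"
      using pert nM0 by (auto simp: h_def)
    ultimately have "?n * ((2 * (M0 \<bullet> (M0 ** N))) / ?n) - 2 * trace N = 0"
      by (meson DERIV_local_min zero_less_one)
    then show ?thesis using n0 by (simp add: inner_matrix_eq_trace matrix_mul_assoc)
  qed
  \<comment> \<open>The trace identity says that \<open>D ** N\<close> has trace zero for all
    \<open>N\<close>; the symmetric matrix \<open>D\<close> is tested against itself.\<close>
  define D where "D = transpose M0 ** M0 - mat 1"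
  have "D \<bullet> D = trace (D ** D)"
    by (simp add: inner_matrix_eq_trace D_def matrix_transpose_mul transpose_mat transpose_def
        vec_eq_iff mat_def matrix_matrix_mult_def mult.commute cong: if_cong) (simp add: eq_commute)
  also have "\<dots> = 0"
    using tr[of D] by (simp add: D_def matrix_diff_rdistrib trace_sub)
  finally show ?thesis
    by (simp add: D_def orthogonal_matrix)
qed

lemma norm_le_sqrt_iff: "norm M \<le> sqrt c \<longleftrightarrow> (norm M)\<^sup>2 \<le> c"
  by (metis norm_ge_zero real_sqrt_le_iff real_sqrt_unique)

text \<open>A determinant maximiser on the compact Frobenius ball is orthogonal, so the maximum is
  one; any matrix of the ball that attains it is again a maximiser.\<close>

proposition
  fixes M :: "real^'n^'n"
  assumes "(norm M)\<^sup>2 \<le> CARD('n)"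
  shows abs_det_le_1: "\<bar>det M\<bar> \<le> 1"
    and orthogonal_matrix_if_abs_det_1: "\<bar>det M\<bar> = 1 \<Longrightarrow> orthogonal_matrix M"
proof -
  let ?K = "cball 0 (sqrt CARD('n)) :: (real^'n^'n) set"
  have K: "N \<in> ?K \<longleftrightarrow> (norm N)\<^sup>2 \<le> CARD('n)" for N
    by (simp add: norm_le_sqrt_iff)
  have one: "(mat 1 :: real^'n^'n) \<in> ?K"
    unfolding K by (simp add: norm_mat_1)
  obtain M0 where M0: "M0 \<in> ?K" "\<And>N. N \<in> ?K \<Longrightarrow> \<bar>det N\<bar> \<le> \<bar>det M0\<bar>"
  proof -
    have "continuous_on ?K (\<lambda>N. \<bar>det N\<bar>)" by (intro continuous_intros)
    then show ?thesis using continuous_attains_sup[OF compact_cball, of 0 "sqrt CARD('n)" "\<lambda>N :: real^'n^'n. \<bar>det N\<bar>"] one that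
      by blast
  qed
  have "1 \<le> \<bar>det M0\<bar>" using M0(2)[OF one] by simp
  then have "orthogonal_matrix M0"
    using M0 unfolding K by (intro det_maximiser_orthogonal) auto
  then have d: "\<bar>det M0\<bar> = 1" using det_orthogonal_matrix by fastforce
  then show "\<bar>det M\<bar> \<le> 1" using M0(2)[of M] assms K by auto
  assume "\<bar>det M\<bar> = 1"
  then show "orthogonal_matrix M"
    using M0(2) d assms unfolding K by (intro det_maximiser_orthogonal) auto
qed

lemma orthogonal_matrix_norm:
  fixes M :: "real^'n^'n"
  assumes "orthogonal_matrix M"
  shows "norm (M *v x) = norm x"
  using assms unfolding norm_eq inner_matrix_vector_right
  by (simp add: orthogonal_matrix matrix_vector_mul_assoc)

text \<open>The equality case made quantitative by compactness: on the compact set of pairs of a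
  matrix and a unit vector with deviation at least \<open>e\<close>, the absolute determinant has a
  maximum, and the equality case excludes the value one there.\<close>

lemma near_maximal_det_near_isometry:
  fixes e :: real
  assumes "e > 0"
  obtains s where "s < 1"
    "\<And>(M :: real^'n^'n) x. \<lbrakk>(norm M)\<^sup>2 \<le> CARD('n); \<bar>det M\<bar> > s\<rbrakk> \<Longrightarrow> \<bar>norm (M *v x) - norm x\<bar> \<le> e * norm x"
proof -
  let ?B = "cball 0 (sqrt CARD('n)) \<times> sphere 0 1 \<inter> {(M, x). e \<le> \<bar>norm (M *v x) - 1\<bar>} :: ((real^'n^'n) \<times> (real^'n)) set"
  have cont: "continuous_on UNIV (\<lambda>p :: (real^'n^'n) \<times> (real^'n). \<bar>norm (fst p *v snd p) - 1\<bar>)"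
    unfolding matrix_vector_mult_def by (intro continuous_intros)
  have "closed {p :: (real^'n^'n) \<times> (real^'n). e \<le> \<bar>norm (fst p *v snd p) - 1\<bar>}"
    by (intro closed_Collect_le cont continuous_intros)
  then have "compact ?B"
    by (intro compact_Int_closed compact_Times compact_cball compact_sphere) (simp add: case_prod_unfold)
  have *: "\<exists>s<1. \<forall>p\<in>?B. \<bar>det (fst p)\<bar> \<le> s"
  proof (cases "?B = {}")
    case True
    then show ?thesis by (intro exI[of _ 0]) auto
  next
    case False
    obtain p where p: "p \<in> ?B" "\<And>q. q \<in> ?B \<Longrightarrow> \<bar>det (fst q)\<bar> \<le> \<bar>det (fst p)\<bar>"
    proof -
      have "continuous_on ?B (\<lambda>p. \<bar>det (fst p)\<bar>)" by (intro continuous_intros)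
      then show ?thesis
        using continuous_attains_sup[OF \<open>compact ?B\<close> False, of "\<lambda>p. \<bar>det (fst p)\<bar>"] that by blast
    qed
    have le: "(norm (fst p))\<^sup>2 \<le> CARD('n)" using p(1) by (auto simp: norm_le_sqrt_iff)
    have "\<bar>det (fst p)\<bar> \<noteq> 1"
    proof
      assume "\<bar>det (fst p)\<bar> = 1"
      then have "norm (fst p *v snd p) = norm (snd p)"
        using orthogonal_matrix_if_abs_det_1[OF le] orthogonal_matrix_norm by blast
      then show False using p(1) assms by auto
    qed
    with abs_det_le_1[OF le] have "\<bar>det (fst p)\<bar> < 1" by simp
    then show ?thesis using p(2) by blast
  qed
  then obtain s where s: "s < 1" "\<And>p. p \<in> ?B \<Longrightarrow> \<bar>det (fst p)\<bar> \<le> s" by blast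
  show ?thesis
  proof (rule that[OF s(1)])
    fix M :: "real^'n^'n" and x :: "real^'n"
    assume M: "(norm M)\<^sup>2 \<le> CARD('n)" "\<bar>det M\<bar> > s"
    show "\<bar>norm (M *v x) - norm x\<bar> \<le> e * norm x"
    proof (cases "x = 0")
      case False
      define y where "y = x /\<^sub>R norm x"
      have y: "norm y = 1" and x: "x = norm x *\<^sub>R y" using False by (auto simp: y_def)
      have "(M, y) \<notin> ?B" using s(2)[of "(M, y)"] M by auto
      then have "\<bar>norm (M *v y) - 1\<bar> \<le> e" using M y by (auto simp: norm_le_sqrt_iff)
      then have le: "norm x * \<bar>norm (M *v y) - 1\<bar> \<le> norm x * e" by (intro mult_left_mono) auto
      have "M *v x = norm x *\<^sub>R (M *v y)"
        by (metis x matrix_vector_mult_scaleR)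
      then have "norm (M *v x) - norm x = norm x * (norm (M *v y) - 1)"
        by (simp add: right_diff_distrib)
      then show ?thesis using le by (simp add: abs_mult mult.commute)
    qed simp
  qed
qed

section \<open>Block matrices and John's first-order condition\<close>

definition coord_subspace :: "'n set \<Rightarrow> (real^'n) set"
  where "coord_subspace I = {x. \<forall>j. j \<notin> I \<longrightarrow> x $ j = 0}"

text \<open>Endomorphisms of a coordinate subspace, extended by the identity. Products, transposes
  and inverses keep this form, and the determinant is that of the block on \<open>I\<close>.\<close>

definition block :: "'n set \<Rightarrow> real^'n^'n \<Rightarrow> bool"
  where "block I A \<longleftrightarrow> (\<forall>i j. i \<notin> I \<or> j \<notin> I \<longrightarrow> A $ i $ j = (if i = j then 1 else 0))"

lemma block_mult_row:
  assumes "block I A" "i \<notin> I"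
  shows "(A ** B) $ i $ j = B $ i $ j"
proof -
  have "(A ** B) $ i $ j = (\<Sum>k\<in>UNIV. if i = k then B $ k $ j else 0)"
    using assms unfolding matrix_matrix_mult_def vec_lambda_beta
    by (intro sum.cong) (auto simp: block_def)
  then show ?thesis by simp
qed

lemma block_mult_column:
  assumes "block I A" "j \<notin> I"
  shows "(B ** A) $ i $ j = B $ i $ j"
proof -
  have "(B ** A) $ i $ j = (\<Sum>k\<in>UNIV. if k = j then B $ i $ k else 0)"
    using assms unfolding matrix_matrix_mult_def vec_lambda_beta
    by (intro sum.cong) (auto simp: block_def)
  then show ?thesis by simp
qed

lemma block_mult: "block I A \<Longrightarrow> block I B \<Longrightarrow> block I (A ** B)"
  unfolding block_def[of I "A ** B"]
  using block_mult_row[of I A _ B] block_mult_column[of I B _ A] by (auto simp: block_def)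

lemma block_transpose: "block I A \<Longrightarrow> block I (transpose A)"
  by (auto simp: block_def transpose_def)

lemma closed_block: "closed {A. block I A}"
  unfolding block_def
  by (intro closed_Collect_all closed_Collect_imp open_Collect_const closed_Collect_eq continuous_intros)

lemma block_coord_subspace:
  assumes "block I A" "x \<in> coord_subspace I"
  shows "A *v x \<in> coord_subspace I"
proof -
  have "(A *v x) $ i = 0" if "i \<notin> I" for i
  proof -
    have "(A *v x) $ i = (\<Sum>k\<in>UNIV. if i = k then x $ k else 0)"
      using assms that unfolding matrix_vector_mult_def vec_lambda_beta
      by (intro sum.cong) (auto simp: block_def)
    then show ?thesis using assms that by (auto simp: coord_subspace_def)
  qed
  then show ?thesis by (auto simp: coord_subspace_def)
qed

text \<open>
  The trace inequality is the dual of John's decomposition of the identity by contact points.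
\<close>

definition optimal_position :: "'n set \<Rightarrow> (real^'n) set \<Rightarrow> real^'n^'n \<Rightarrow> bool"
  where "optimal_position I P A \<longleftrightarrow> block I A \<and> invertible A \<and> (\<forall>x\<in>P. norm (A *v x) \<le> 1) \<and>
    (\<forall>S (c :: real). (\<forall>x\<in>P. (A *v x) \<bullet> (S *v (A *v x)) \<le> c) \<longrightarrow> (\<Sum>k\<in>I. S $ k $ k) \<le> card I * c)"

text \<open>\<open>A\<close> maximises the absolute determinant among the block matrices taking
  \<open>P\<close> into the unit ball. The ball inside \<open>P\<close> bounds these matrices, and
  the boundedness of \<open>P\<close> supplies an invertible one. A form violating the trace
  inequality would give a direction in which the determinant increases while the matrix stays
  admissible.\<close>

proposition optimal_position_exists:
  fixes P :: "(real^'n) set"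
  assumes P: "P \<subseteq> coord_subspace I" and bP: "bounded P" and r: "r > 0"
    and ball: "\<And>x. x \<in> coord_subspace I \<Longrightarrow> norm x \<le> r \<Longrightarrow> x \<in> P"
  obtains A where "optimal_position I P A"
proof -
  define K where "K = {A :: real^'n^'n. block I A \<and> (\<forall>x\<in>P. norm (A *v x) \<le> 1)}"
  have "0 \<in> P" using r by (intro ball) (auto simp: coord_subspace_def)
  have "closed K"
  proof -
    have "continuous_on UNIV (\<lambda>A :: real^'n^'n. norm (A *v x))" for x
      unfolding matrix_vector_mult_def by (intro continuous_intros)
    then have "closed (\<Inter>x\<in>P. {A :: real^'n^'n. norm (A *v x) \<le> 1})"
      by (intro closed_INT ballI closed_Collect_le continuous_on_const)
    moreover have "K = {A. block I A} \<inter> (\<Inter>x\<in>P. {A. norm (A *v x) \<le> 1})" by (auto simp: K_def)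
    ultimately show ?thesis using closed_block by (metis closed_Int)
  qed
  moreover have "bounded K"
  proof -
    have "(norm A)\<^sup>2 \<le> CARD('n) * (max 1 (1/r))\<^sup>2" if A: "A \<in> K" for A
    proof -
      have "norm (A *v axis k 1) \<le> max 1 (1/r)" for k
      proof (cases "k \<in> I")
        case True
        have "norm (A *v (r *\<^sub>R axis k 1)) \<le> 1"
        proof -
          have "r *\<^sub>R axis k 1 \<in> P"
          proof (rule ball)
            show "r *\<^sub>R axis k 1 \<in> coord_subspace I" using True by (auto simp: coord_subspace_def axis_def)
            show "norm (r *\<^sub>R axis k 1 :: real^'n) \<le> r" using r by simp
          qed
          then show ?thesis using A unfolding K_def by blast
        qed
        then have "norm (A *v axis k 1) \<le> 1/r"
          using r by (simp add: matrix_vector_mult_scaleR field_simps)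
        then show ?thesis by simp
      next
        case False
        have "A *v axis k 1 = axis k 1"
          using A False unfolding matrix_vector_mult_basis vec_eq_iff K_def block_def
          by (simp add: column_def axis_def)
        then show ?thesis by simp
      qed
      then have "(norm A)\<^sup>2 \<le> (\<Sum>k\<in>(UNIV::'n set). (max 1 (1/r))\<^sup>2)"
        unfolding norm_matrix_power2_columns by (intro sum_mono power_mono) auto
      then show ?thesis by simp
    qed
    then have "\<forall>A\<in>K. norm A \<le> sqrt (CARD('n) * (max 1 (1/r))\<^sup>2)"
      unfolding norm_le_sqrt_iff by blast
    then show ?thesis unfolding bounded_iff by blast
  qed
  ultimately have "compact K" by (simp add: compact_eq_bounded_closed)
  obtain b where b: "b > 0" "\<And>x. x \<in> P \<Longrightarrow> norm x \<le> b" using bP by (auto simp: bounded_pos)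
  define A0 where "A0 = (\<chi> i j. if i = j then if i \<in> I then 1/b else 1 else 0 :: real^'n^'n)"
  have A0x: "A0 *v x = (1/b) *\<^sub>R x" if "x \<in> coord_subspace I" for x
  proof -
    have "(A0 *v x) $ i = (\<Sum>j\<in>UNIV. if i = j then (1/b) * x $ j else 0)" for i
      unfolding A0_def matrix_vector_mult_def vec_lambda_beta
      using that by (intro sum.cong) (auto simp: coord_subspace_def)
    then show ?thesis by (simp add: vec_eq_iff)
  qed
  have A0K: "A0 \<in> K"
  proof -
    have "norm (A0 *v x) \<le> 1" if "x \<in> P" for x
      using A0x[of x] P that b by auto
    moreover have "block I A0" by (auto simp: A0_def block_def)
    ultimately show ?thesis by (simp add: K_def)
  qed
  have detA0: "det A0 \<noteq> 0"
    by (subst det_diagonal) (use b in \<open>auto simp: A0_def\<close>)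
  obtain A where A: "A \<in> K" "\<And>B. B \<in> K \<Longrightarrow> \<bar>det B\<bar> \<le> \<bar>det A\<bar>"
  proof -
    have "continuous_on K (\<lambda>A. \<bar>det A\<bar>)" by (intro continuous_intros)
    then show ?thesis
      using continuous_attains_sup[OF \<open>compact K\<close>, of "\<lambda>A. \<bar>det A\<bar>"] A0K that by blast
  qed
  have detA: "det A \<noteq> 0" using A(2)[OF A0K] detA0 by auto
  have AK: "block I A" "\<And>x. x \<in> P \<Longrightarrow> norm (A *v x) \<le> 1" using A(1) by (auto simp: K_def)
  have "(\<Sum>k\<in>I. S $ k $ k) \<le> card I * c" if S: "\<And>x. x \<in> P \<Longrightarrow> (A *v x) \<bullet> (S *v (A *v x)) \<le> c" for S and c :: real
  proof (rule ccontr)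
    assume "\<not> (\<Sum>k\<in>I. S $ k $ k) \<le> card I * c"
    then have gap: "(\<Sum>k\<in>I. S $ k $ k) - card I * c > 0" (is "?g > 0") by simp
    \<comment> \<open>The slack \<open>h\<close> is small enough that subtracting
      \<open>c + h\<close> on the diagonal leaves a positive trace, and it will absorb the quadratic
      term of the perturbation. The added one in the denominator makes
      \<open>card I * h < ?g\<close> strict and covers an empty \<open>I\<close>.\<close>
    define h where "h = ?g / (card I + 1)"
    have h: "h > 0" and hg: "card I * h < ?g"
      using gap by (auto simp: h_def field_simps)
    have c: "c \<ge> 0" using S[OF \<open>0 \<in> P\<close>] by simp
    define c' where "c' = c + h"
    define S0 where "S0 = (\<chi> i j. if i \<in> I \<and> j \<in> I then S $ i $ j - (if i = j then c' else 0) else 0 :: real^'n^'n)"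
    have trS0: "trace S0 > 0"
    proof -
      have "trace S0 = (\<Sum>k\<in>I. S $ k $ k - c')"
        unfolding trace_def S0_def by (rule sum.mono_neutral_cong_right) auto
      also have "\<dots> = ?g - card I * h" by (simp add: sum_subtractf c'_def algebra_simps)
      finally show ?thesis using hg by simp
    qed
    \<comment> \<open>The factor 1/2 makes the first-order change of
      \<open>(norm (R t *v y))\<^sup>2\<close> equal to
      \<open>t * (y \<bullet> (S0 *v y))\<close>.\<close>
    define R where "R t = mat 1 + t *\<^sub>R ((1/2) *\<^sub>R S0)" for t
    have Rblock: "block I (R t)" for t by (auto simp: R_def block_def S0_def mat_def)
    have "((\<lambda>t. det (R t)) has_real_derivative trace ((1/2) *\<^sub>R S0)) (at 0)"
      unfolding R_def by (rule has_real_derivative_det_line)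
    moreover have "trace ((1/2) *\<^sub>R S0) > 0"
      using trS0 by (simp add: trace_def sum_distrib_left[symmetric] sum_divide_distrib[symmetric])
    ultimately obtain e where e: "e > 0" "\<And>t. 0 < t \<Longrightarrow> t < e \<Longrightarrow> det (R 0) < det (R t)"
      using DERIV_pos_inc_right[of "\<lambda>t. det (R t)" _ 0] by auto
    define k where "k = (norm S0)\<^sup>2 + 1"
    have k: "k > 0" by (simp add: k_def add_nonneg_pos)
    \<comment> \<open>\<open>e/2\<close> keeps \<open>t\<close> in the range where the determinant
      grows, \<open>1/c'\<close> keeps \<open>1 - t * c'\<close> nonnegative, and
      \<open>4 * h / k\<close> lets the slack \<open>t * h\<close> dominate the quadratic term
      \<open>t\<^sup>2/4 * k\<close>.\<close>
    define t where "t = min (e/2) (min (1/c') (4 * h / k))"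
    have c': "c' > 0" using c h by (simp add: c'_def)
    have t: "t > 0" "t < e" "t * c' \<le> 1" "t * k \<le> 4 * h"
    proof -
      have "t \<le> e/2" "t \<le> 1/c'" "t \<le> 4 * h / k" by (simp_all add: t_def)
      then show "t < e" "t * c' \<le> 1" "t * k \<le> 4 * h"
        using e(1) c' k by (simp_all add: pos_le_divide_eq)
      show "t > 0" using e(1) c' h k by (simp add: t_def)
    qed
    have "R t ** A \<in> K"
    proof -
      have "norm (R t *v y) \<le> 1" if x: "x \<in> P" and y: "y = A *v x" for x y
      proof -
        have yI: "y \<in> coord_subspace I" unfolding y using P x by (intro block_coord_subspace[OF AK(1)]) blast
        have ny: "(norm y)\<^sup>2 \<le> 1" using AK(2)[OF x] unfolding y by (simp only: power_le_one norm_ge_zero)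
        have q: "y \<bullet> (S0 *v y) = y \<bullet> (S *v y) - c' * (norm y)\<^sup>2"
        proof -
          have "y \<bullet> (S0 *v y) = (\<Sum>i\<in>UNIV. \<Sum>j\<in>UNIV. y $ i * (S0 $ i $ j * y $ j))"
            by (simp add: inner_vec_def matrix_vector_mult_def sum_distrib_left)
          also have "\<dots> = (\<Sum>i\<in>UNIV. \<Sum>j\<in>UNIV. y $ i * (S $ i $ j * y $ j) - (if i = j then c' * (y $ i * y $ j) else 0))"
            using yI by (intro sum.cong refl) (auto simp: S0_def coord_subspace_def algebra_simps)
          also have "\<dots> = y \<bullet> (S *v y) - c' * (norm y)\<^sup>2"
            by (simp add: sum_subtractf inner_vec_def[of y] matrix_vector_mult_def sum_distrib_left power2_norm_eq_inner)
          finally show ?thesis .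
        qed
        have S0y: "(norm (S0 *v y))\<^sup>2 \<le> k"
        proof -
          have "(norm (S0 *v y))\<^sup>2 \<le> (norm S0)\<^sup>2 * (norm y)\<^sup>2"
            using norm_matrix_vector_le[of S0 y] by (metis norm_ge_zero power_mono power_mult_distrib)
          also have "\<dots> \<le> (norm S0)\<^sup>2 * 1" using ny by (intro mult_left_mono) auto
          also have "\<dots> \<le> k" by (simp add: k_def)
          finally show ?thesis .
        qed
        have "R t *v y = y + (t/2) *\<^sub>R (S0 *v y)"
          unfolding R_def matrix_vector_mult_add_rdistrib scaleR_matrix_vector_assoc[symmetric] by simp
        then have "(norm (R t *v y))\<^sup>2 = (norm y)\<^sup>2 + t * (y \<bullet> (S0 *v y)) + t\<^sup>2/4 * (norm (S0 *v y))\<^sup>2"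
          unfolding power2_norm_eq_inner
          by (simp add: inner_add_left inner_add_right inner_commute[of "S0 *v y" y] power2_eq_square field_simps)
        also have "\<dots> = (1 - t * c') * (norm y)\<^sup>2 + t * (y \<bullet> (S *v y)) + t\<^sup>2/4 * (norm (S0 *v y))\<^sup>2"
          by (simp add: q algebra_simps)
        also have "\<dots> \<le> (1 - t * c') * 1 + t * c + t\<^sup>2/4 * k"
          using t ny S[OF x, folded y] S0y by (intro add_mono mult_left_mono) auto
        also have "\<dots> = 1 - t * h + t * (t * k) / 4"
          by (simp add: c'_def algebra_simps power2_eq_square)
        also have "\<dots> \<le> 1 - t * h + t * (4 * h) / 4"
          using t by (intro add_left_mono divide_right_mono mult_left_mono) auto
        finally have "(norm (R t *v y))\<^sup>2 \<le> 1\<^sup>2" by simp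
        then show ?thesis by (rule power2_le_imp_le) simp
      qed
      then show ?thesis
        using block_mult[OF Rblock AK(1)] by (simp add: K_def matrix_vector_mul_assoc[symmetric])
    qed
    then have "\<bar>det (R t)\<bar> * \<bar>det A\<bar> \<le> 1 * \<bar>det A\<bar>"
      using A(2)[of "R t ** A"] by (simp add: det_mul abs_mult)
    then have "\<bar>det (R t)\<bar> \<le> 1" using detA by (subst (asm) mult_le_cancel_right) auto
    then show False using e(2)[of t] t by (simp add: R_def)
  qed
  then show ?thesis
    using AK detA by (intro that[of A]) (auto simp: optimal_position_def invertible_det_nz)
qed

section \<open>Loewner ellipsoids\<close>

text \<open>A preimage of the unit ball and not an image: containment of \<open>Q\<close> is a norm
  bound on \<open>A Q\<close>, the gauge is \<open>norm (A *v x)\<close>, and small volume means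
  large determinant.\<close>

definition ell :: "real^'n^'n \<Rightarrow> (real^'n) set"
  where "ell A = {x. norm (A *v x) \<le> 1}"

lemma invertible_matrix_linear_bij:
  fixes T :: "real^'n \<Rightarrow> real^'n"
  assumes "linear T" "bij T"
  shows "invertible (matrix T)"
  using assms by (simp add: invertible_eq_bij matrix_works)

lemma matrix_inv: "invertible A \<Longrightarrow> A ** matrix_inv A = mat 1 \<and> matrix_inv A ** A = mat 1"
  for A :: "real^'n^'n"
  unfolding matrix_inv_def invertible_def by (rule someI_ex)

lemma image_ell:
  fixes B :: "real^'n^'n"
  assumes "invertible B"
  shows "(*v) B ` ell A = ell (A ** matrix_inv B)"
proof -
  have "B *v (matrix_inv B *v x) = x" "matrix_inv B *v (B *v x) = x" for x
    using assms by (simp_all add: matrix_vector_mul_assoc matrix_inv)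
  then show ?thesis
    by (auto simp: ell_def matrix_vector_mul_assoc[symmetric] image_iff) metis
qed

lemma ell_mat_1: "ell (mat 1) = cball 0 1"
  by (auto simp: ell_def)

lemma ell_eq_image_cball:
  fixes A :: "real^'n^'n"
  assumes "invertible A"
  shows "ell A = (*v) (matrix_inv A) ` cball 0 1"
proof -
  have "B *v (matrix_inv A *v (A *v x)) = B *v x" "A *v (matrix_inv A *v x) = x" for x and B :: "real^'n^'n"
    using assms by (simp_all add: matrix_vector_mul_assoc matrix_inv)
  note this(1)[of "mat 1"] this(2)
  then show ?thesis
    by (auto simp: ell_def image_iff) (metis dist_0_norm mem_cball)
qed

lemma ellipsoid_iff:
  fixes S :: "(real^'n) set"
  shows "ellipsoid S \<longleftrightarrow> (\<exists>A. invertible A \<and> S = ell A)"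
proof
  assume "ellipsoid S"
  then obtain T :: "real^'n \<Rightarrow> real^'n" where T: "linear T" "bij T" "S = T ` cball 0 1" unfolding ellipsoid_def by blast
  have inv: "invertible (matrix T)" using T invertible_matrix_linear_bij by blast
  have "S = (*v) (matrix T) ` ell (mat 1)"
    using T by (simp add: ell_mat_1 matrix_works)
  also have "\<dots> = ell (matrix_inv (matrix T))"
    by (simp add: image_ell[OF inv])
  finally show "\<exists>A. invertible A \<and> S = ell A"
    using inv by (metis invertible_def matrix_inv)
next
  assume "\<exists>A. invertible A \<and> S = ell A"
  then obtain A where A: "invertible A" "S = ell A" by blast
  have "invertible (matrix_inv A)" using A by (metis invertible_def matrix_inv)
  then have "bij ((*v) (matrix_inv A))" by (simp add: invertible_eq_bij)
  then show "ellipsoid S" unfolding ellipsoid_def A(2) ell_eq_image_cball[OF A(1)]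
    using matrix_vector_mul_linear by blast
qed

text \<open>The library states this only for well-ordered index types.\<close>

lemma measure_matrix_image:
  fixes A :: "real^'n^'n"
  assumes "S \<in> lmeasurable"
  shows "measure lebesgue ((*v) A ` S) = \<bar>det A\<bar> * measure lebesgue S"
proof -
  \<comment> \<open>Measurability of the image is part of the property, so that it can be applied
    twice for a product of matrices.\<close>
  define P where "P A \<longleftrightarrow> (\<forall>S\<in>lmeasurable. (*v) A ` S \<in> lmeasurable \<and>
    measure lebesgue ((*v) A ` S) = \<bar>det A\<bar> * measure lebesgue S)" for A :: "real^'n^'n"
  have boxes: "P A"
    if "\<bar>det A\<bar> = 1" "\<And>a b. cbox a b \<noteq> {} \<Longrightarrow> measure lebesgue ((*v) A ` cbox a b) = measure lebesgue (cbox a b)"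
    for A :: "real^'n^'n"
  proof -
    have box: "measure lebesgue ((*v) A ` cbox a b) = 1 * measure lebesgue (cbox a b)" for a b
      using that(2)[of a b] by (cases "cbox a b = {}") auto
    show ?thesis unfolding P_def that(1)
      using measure_linear_sufficient[OF matrix_vector_mul_linear _ box] by metis
  qed
  have "P A"
  proof (rule induct_matrix_elementary_alt)
    fix A B assume "P A" "P B"
    moreover have "(*v) (A ** B) ` S = (*v) A ` ((*v) B ` S)" for S
      by (simp add: image_image matrix_vector_mul_assoc)
    ultimately show "P (A ** B)" by (simp only: P_def det_mul abs_mult mult.assoc) simp
  next
    fix A :: "real^'n^'n" and i assume "row i A = 0"
    then have d: "det A = 0" by (rule det_zero_row)
    have "\<not> inj ((*v) A)"
      using d det_nz_iff_inj[of "(*v) A"] by (simp add: matrix_of_matrix_vector_mul)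
    then have "negligible ((*v) A ` S)" for S
      by (intro negligible_linear_singular_image) auto
    then show "P A" by (simp add: P_def d negligible_iff_measure)
  next
    fix A :: "real^'n^'n" assume A: "\<And>i j. i \<noteq> j \<Longrightarrow> A $ i $ j = 0"
    have "(*v) A = (\<lambda>x. \<chi> k. A $ k $ k * x $ k)"
    proof (intro ext, unfold vec_eq_iff, intro allI)
      fix x k
      have "(A *v x) $ k = (\<Sum>j\<in>UNIV. if k = j then A $ k $ j * x $ j else 0)"
        unfolding matrix_vector_mult_def vec_lambda_beta by (intro sum.cong) (auto simp: A)
      then show "(A *v x) $ k = (\<chi> k. A $ k $ k * x $ k) $ k" by simp
    qed
    then show "P A" by (simp add: P_def measurable_stretch measure_stretch det_diagonal[OF A])
  next
    fix m n :: 'n assume mn: "m \<noteq> n"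
    let ?\<pi> = "Transposition.transpose m n"
    let ?A = "(\<chi> i j. mat 1 $ i $ ?\<pi> j) :: real^'n^'n"
    have app: "(?A *v x) $ i = x $ ?\<pi> i" for x i
    proof -
      have "(?A *v x) $ i = (\<Sum>j\<in>UNIV. if ?\<pi> i = j then x $ j else 0)"
        unfolding matrix_vector_mult_def vec_lambda_beta mat_def
        by (intro sum.cong) (auto simp: transpose_eq_iff)
      then show ?thesis by simp
    qed
    have inv: "?A *v (?A *v x) = x" for x by (simp add: vec_eq_iff app)
    have all: "(\<forall>i. Q (?\<pi> i)) = (\<forall>i. Q i)" for Q by (metis transpose_involutory)
    show "P ?A"
    proof (rule boxes)
      show "\<bar>det ?A\<bar> = 1"
        using det_permute_columns[of ?\<pi> "mat 1 :: real^'n^'n"] mn by (simp add: permutes_swap_id sign_swap_id)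
      fix a b :: "real^'n" assume ne: "cbox a b \<noteq> {}"
      have mem: "?A *v x \<in> cbox (?A *v a) (?A *v b) \<longleftrightarrow> x \<in> cbox a b" for x
        unfolding mem_box_cart app using all[of "\<lambda>i. a $ i \<le> x $ i \<and> x $ i \<le> b $ i"] by auto
      then have eq: "(*v) ?A ` cbox a b = cbox (?A *v a) (?A *v b)"
      proof (intro set_eqI iffI)
        fix y assume "y \<in> cbox (?A *v a) (?A *v b)"
        then have "?A *v y \<in> cbox a b" using mem[of "?A *v y"] unfolding inv by blast
        then show "y \<in> (*v) ?A ` cbox a b" using inv[of y] by (intro image_eqI[of _ _ "?A *v y"]) simp_all
      qed (use mem in blast)
      then have "cbox (?A *v a) (?A *v b) \<noteq> {}" using ne by (metis image_is_empty)
      then show "measure lebesgue ((*v) ?A ` cbox a b) = measure lebesgue (cbox a b)"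
        using ne prod.permute[OF permutes_swap_id, where S=UNIV and g="\<lambda>i. (b - a) $ i", symmetric]
        unfolding eq by (simp add: content_cbox_cart app o_def)
    qed
  next
    fix m n :: 'n assume mn: "m \<noteq> n"
    let ?A = "(\<chi> i j. of_bool (i = m \<and> j = n \<or> i = j)) :: real^'n^'n"
    have app: "(*v) ?A = (\<lambda>x. \<chi> i. if i = m then x $ m + x $ n else x $ i)"
    proof (intro ext, unfold vec_eq_iff, intro allI)
      fix x :: "real^'n" and i
      have "(?A *v x) $ i = (\<Sum>j\<in>UNIV. (if i = j then x $ j else 0) + (if n = j then (if i = m then x $ n else 0) else 0))"
        unfolding matrix_vector_mult_def vec_lambda_beta using mn by (intro sum.cong) auto
      also have "\<dots> = x $ i + (if i = m then x $ n else 0)" by (simp add: sum.distrib)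
      finally show "(?A *v x) $ i = (\<chi> i. if i = m then x $ m + x $ n else x $ i) $ i" by simp
    qed
    show "P ?A"
    proof (rule boxes)
      have "?A = (\<chi> k. if k = m then row m (mat 1) + 1 *s row n (mat 1) else row k (mat 1))"
        using mn by (auto simp: vec_eq_iff row_def mat_def)
      then show "\<bar>det ?A\<bar> = 1" using det_row_operation[OF mn, of "mat 1 :: real^'n^'n" 1] by simp
      fix a b :: "real^'n" assume ne: "cbox a b \<noteq> {}"
      \<comment> \<open>Translating the corner of the box to the origin meets the sign condition of
        \<open>measure_shear_interval\<close>.\<close>
      define v where "v = - a"
      have "measure lebesgue ((*v) ?A ` cbox a b) = measure lebesgue ((*v) ?A ` ((+) v ` cbox a b))"
      proof -
        have "(*v) ?A ` ((+) v ` cbox a b) = (+) (?A *v v) ` ((*v) ?A ` cbox a b)"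
          by (simp add: image_comp o_def matrix_vector_right_distrib)
        then show ?thesis by (simp only: measure_translation)
      qed
      also have "\<dots> = measure lebesgue ((*v) ?A ` cbox (v + a) (v + b))"
        by (simp only: cbox_translation)
      also have "\<dots> = measure lebesgue (cbox (v + a) (v + b))"
        unfolding app
      proof (rule measure_shear_interval[OF mn])
        show "cbox (v + a) (v + b) \<noteq> {}" using ne by (metis cbox_translation image_is_empty)
        show "0 \<le> (v + a) $ n" by (simp add: v_def)
      qed
      also have "\<dots> = measure lebesgue (cbox a b)"
        by (simp only: cbox_translation measure_translation)
      finally show "measure lebesgue ((*v) ?A ` cbox a b) = measure lebesgue (cbox a b)" .
    qed
  qed
  then show ?thesis using assms by (simp add: P_def)
qed

lemma measure_ell:
  fixes A :: "real^'n^'n"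
  assumes "invertible A"
  shows "measure lebesgue (ell A) = measure lebesgue (cball 0 1 :: (real^'n) set) / \<bar>det A\<bar>"
proof -
  have "measure lebesgue (ell A) = \<bar>det (matrix_inv A)\<bar> * measure lebesgue (cball 0 1 :: (real^'n) set)"
    unfolding ell_eq_image_cball[OF assms] by (intro measure_matrix_image lmeasurable_cball)
  moreover have "det (matrix_inv A) * det A = 1"
    using assms by (metis det_I det_mul matrix_inv)
  then have "det (matrix_inv A) = 1 / det A"
    by (metis mult_zero_right nonzero_eq_divide_eq zero_neq_one)
  ultimately show ?thesis by simp
qed

lemma compact_ell:
  fixes A :: "real^'n^'n"
  assumes "invertible A"
  shows "compact (ell A)"
  unfolding ell_eq_image_cball[OF assms]
  by (intro compact_continuous_image linear_continuous_on matrix_vector_mul_bounded_linear compact_cball)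

lemma zero_in_ell: "0 \<in> ell A"
  by (simp add: ell_def)

lemma ell_orthogonal_mult: "orthogonal_matrix M \<Longrightarrow> ell (M ** A) = ell A" for A :: "real^'n^'n"
  by (simp add: ell_def matrix_vector_mul_assoc[symmetric] orthogonal_matrix_norm)

text \<open>The trace condition for the forms \<open>transpose M ** M\<close> with bound one, whose
  trace is the squared norm of \<open>M\<close>.\<close>

definition loewner_position :: "(real^'n) set \<Rightarrow> real^'n^'n \<Rightarrow> bool"
  where "loewner_position Q A \<longleftrightarrow> invertible A \<and> (\<forall>x\<in>Q. norm (A *v x) \<le> 1) \<and>
    (\<forall>M :: real^'n^'n. (\<forall>x\<in>Q. norm (M *v (A *v x)) \<le> 1) \<longrightarrow> (norm M)\<^sup>2 \<le> CARD('n))"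

text \<open>The quotient \<open>B ** matrix_inv A\<close> takes \<open>A Q\<close> into the unit
  ball, so its Frobenius norm is bounded and its determinant is at most one in absolute
  value.\<close>

lemma loewner_position_det_le:
  fixes A B :: "real^'n^'n"
  assumes A: "loewner_position Q A" and B: "\<forall>x\<in>Q. norm (B *v x) \<le> 1"
  shows "(norm (B ** matrix_inv A))\<^sup>2 \<le> CARD('n)" "\<bar>det B\<bar> \<le> \<bar>det A\<bar>"
    "\<bar>det (B ** matrix_inv A)\<bar> = \<bar>det B\<bar> / \<bar>det A\<bar>" "B ** matrix_inv A ** A = B"
proof -
  have inv: "invertible A" using A by (simp add: loewner_position_def)
  show BA: "B ** matrix_inv A ** A = B"
    using inv by (simp add: matrix_mul_assoc[symmetric] matrix_inv)
  show M: "(norm (B ** matrix_inv A))\<^sup>2 \<le> CARD('n)"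
    using A B unfolding loewner_position_def matrix_vector_mul_assoc by (metis BA)
  have dA: "det A \<noteq> 0" using inv by (simp add: invertible_det_nz)
  have "\<bar>det (B ** matrix_inv A)\<bar> * \<bar>det A\<bar> = \<bar>det B\<bar>"
    by (metis BA abs_mult det_mul)
  then show eq: "\<bar>det (B ** matrix_inv A)\<bar> = \<bar>det B\<bar> / \<bar>det A\<bar>" using dA by (simp add: field_simps)
  show "\<bar>det B\<bar> \<le> \<bar>det A\<bar>"
    using abs_det_le_1[OF M] dA unfolding eq by (simp add: field_simps)
qed

text \<open>Minimal volume is maximal determinant. For a second minimal ellipsoid
  \<open>ell B\<close> the quotient \<open>B ** matrix_inv A\<close> has absolute determinant one,
  hence is orthogonal, and an orthogonal factor on the left does not change
  \<open>ell\<close>.\<close>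

proposition Loewner_eq_ell:
  fixes A :: "real^'n^'n"
  assumes A: "loewner_position Q A"
  shows "Loewner Q = ell A"
  unfolding Loewner_def
proof (rule the_equality)
  have inv: "invertible A" using A by (simp add: loewner_position_def)
  define v where "v = measure lebesgue (cball 0 1 :: (real^'n) set)"
  have v: "v > 0" unfolding v_def by (simp add: content_cball_pos)
  have dA: "det A \<noteq> 0" using inv by (simp add: invertible_det_nz)
  have QA: "Q \<subseteq> ell A" using A by (auto simp: loewner_position_def ell_def)
  have le: "\<bar>det B\<bar> \<le> \<bar>det A\<bar>" if "Q \<subseteq> ell B" for B
    using that by (intro loewner_position_det_le(2)[OF A]) (auto simp: ell_def)
  show "ellipsoid (ell A) \<and> Q \<subseteq> ell A \<and>
    (\<forall>S'. ellipsoid S' \<and> Q \<subseteq> S' \<longrightarrow> measure lebesgue (ell A) \<le> measure lebesgue S')"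
  proof (intro conjI allI impI)
    show "ellipsoid (ell A)" using inv ellipsoid_iff[of "ell A"] by metis
    fix S' :: "(real^'n) set" assume "ellipsoid S' \<and> Q \<subseteq> S'"
    then obtain B where B: "invertible B" "S' = ell B" "Q \<subseteq> ell B" using ellipsoid_iff[of S'] by metis
    have "det B \<noteq> 0" using B by (simp add: invertible_det_nz)
    then show "measure lebesgue (ell A) \<le> measure lebesgue S'"
      using le[OF B(3)] v dA unfolding B(2) measure_ell[OF B(1)] measure_ell[OF inv] v_def[symmetric]
      by (intro divide_left_mono) auto
  qed (rule QA)
  fix S assume S: "ellipsoid S \<and> Q \<subseteq> S \<and> (\<forall>S'. ellipsoid S' \<and> Q \<subseteq> S' \<longrightarrow> measure lebesgue S \<le> measure lebesgue S')"
  then obtain B where B: "invertible B" "S = ell B" "Q \<subseteq> ell B" using ellipsoid_iff[of S] by metis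
  have dB: "det B \<noteq> 0" using B by (simp add: invertible_det_nz)
  have "measure lebesgue (ell B) \<le> measure lebesgue (ell A)"
    using S B(2) QA inv ellipsoid_iff[of "ell A"] by metis
  then have "\<bar>det A\<bar> \<le> \<bar>det B\<bar>"
    using v dA dB unfolding measure_ell[OF B(1)] measure_ell[OF inv] v_def[symmetric]
    by (simp add: field_simps)
  with le[OF B(3)] have eq: "\<bar>det B\<bar> = \<bar>det A\<bar>" by simp
  have QB: "\<forall>x\<in>Q. norm (B *v x) \<le> 1" using B(3) by (auto simp: ell_def)
  note pos = loewner_position_det_le[OF A QB]
  have "orthogonal_matrix (B ** matrix_inv A)"
    using dA eq by (intro orthogonal_matrix_if_abs_det_1 pos(1)) (simp add: pos(3))
  then show "S = ell A"
    using ell_orthogonal_mult[of "B ** matrix_inv A" A] B(2) pos(4) by simp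
qed

lemma loewner_position_image:
  fixes A :: "real^'n^'n" and T :: "real^'n \<Rightarrow> real^'n"
  assumes A: "loewner_position Q A" and T: "linear T" "bij T"
  shows "loewner_position (T ` Q) (A ** matrix_inv (matrix T))"
proof -
  let ?B = "matrix T"
  have B: "invertible ?B" using T by (rule invertible_matrix_linear_bij)
  have T': "T x = ?B *v x" for x using T by (simp add: matrix_works)
  have *: "A ** matrix_inv ?B *v T x = A *v x" for x
    using B by (simp add: T' matrix_vector_mul_assoc matrix_mul_assoc[symmetric] matrix_inv)
  have "invertible (A ** matrix_inv ?B)"
    using A B by (intro invertible_mult) (auto simp: loewner_position_def, metis invertible_def matrix_inv)
  then show ?thesis using A by (simp add: loewner_position_def *)
qed

lemma Loewner_image:
  fixes A :: "real^'n^'n" and T :: "real^'n \<Rightarrow> real^'n"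
  assumes A: "loewner_position Q A" and T: "linear T" "bij T"
  shows "Loewner (T ` Q) = T ` Loewner Q"
  using Loewner_eq_ell[OF A] Loewner_eq_ell[OF loewner_position_image[OF A T]]
    image_ell[OF invertible_matrix_linear_bij[OF T], of A] T
  by (simp add: matrix_works)

section \<open>Stability of Loewner ellipsoids under small dilations\<close>

definition near_factor :: "real \<Rightarrow> 'a::real_vector set \<Rightarrow> 'a set \<Rightarrow> bool"
  where "near_factor \<delta> Q Q' \<longleftrightarrow> (\<forall>x\<in>Q. (1 - \<delta>) *\<^sub>R x \<in> Q') \<and> (\<forall>x\<in>Q'. inverse (1 + \<delta>) *\<^sub>R x \<in> Q)"

text \<open>Up to scalars, each of \<open>A\<close> and \<open>A'\<close> is admissible for the
  other body, so the quotient has absolute determinant at least the n-th power of (1 - \<delta>)/(1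
  + \<delta>), n being the dimension, and is almost an isometry. The choice of \<delta> is uniform
  in the bodies.\<close>

proposition loewner_position_stable:
  fixes e :: real
  assumes e: "e > 0"
  obtains \<delta> where "0 < \<delta>" "\<delta> < 1"
    "\<And>Q Q' (A :: real^'n^'n) A' x. \<lbrakk>loewner_position Q A; loewner_position Q' A'; near_factor \<delta> Q Q'\<rbrakk>
      \<Longrightarrow> norm (A' *v x) \<le> (1 + e) * norm (A *v x) \<and> norm (A *v x) \<le> (1 + e) * norm (A' *v x)"
proof -
  \<comment> \<open>\<open>e/2\<close> leaves room for the factor \<open>1 - \<delta>\<close> in the
    upper estimate; \<open>e/(1+e)\<close> gives \<open>1 \<le> (1 + e) * (1 - \<epsilon>)\<close>
    for the lower one.\<close>
  define \<epsilon> where "\<epsilon> = min (e/2) (e/(1+e))"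
  have \<epsilon>: "\<epsilon> > 0" "\<epsilon> < e" "\<epsilon> \<le> e/(1+e)" using e by (auto simp: \<epsilon>_def)
  have \<epsilon>1: "1 \<le> (1 + e) * (1 - \<epsilon>)" "\<epsilon> < 1"
  proof -
    have "(1 + e) * \<epsilon> \<le> e" using \<epsilon>(3) e by (simp add: field_simps)
    then show "1 \<le> (1 + e) * (1 - \<epsilon>)" by (simp add: algebra_simps)
    have "e/(1+e) < 1" using e by simp
    then show "\<epsilon> < 1" using \<epsilon>(3) by linarith
  qed
  obtain s where s: "s < 1"
    "\<And>(M :: real^'n^'n) x. \<lbrakk>(norm M)\<^sup>2 \<le> CARD('n); \<bar>det M\<bar> > s\<rbrakk> \<Longrightarrow> \<bar>norm (M *v x) - norm x\<bar> \<le> \<epsilon> * norm x"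
    using near_maximal_det_near_isometry[OF \<epsilon>(1)] by blast
  have "((\<lambda>\<delta>. ((1 - \<delta>) / (1 + \<delta>)) ^ CARD('n)) \<longlongrightarrow> ((1 - 0) / (1 + 0)) ^ CARD('n)) (at_right (0::real))"
    by (intro tendsto_intros) auto
  then have ev1: "\<forall>\<^sub>F \<delta> in at_right 0. ((1 - \<delta>) / (1 + \<delta>)) ^ CARD('n) > s"
    using s(1) by (intro order_tendstoD) auto
  have "((\<lambda>\<delta>. (1 + e) * (1 - \<delta>)) \<longlongrightarrow> (1 + e) * (1 - 0)) (at_right (0::real))"
    by (intro tendsto_intros)
  then have ev2: "\<forall>\<^sub>F \<delta> in at_right 0. (1 + e) * (1 - \<delta>) > 1 + \<epsilon>"
    using \<epsilon>(2) by (intro order_tendstoD) auto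
  have ev3: "\<forall>\<^sub>F \<delta> in at_right 0. 0 < \<delta> \<and> \<delta> < (1::real)"
    by (auto simp: eventually_at_right_field intro!: exI[of _ 1])
  obtain \<delta> :: real where \<delta>: "((1 - \<delta>) / (1 + \<delta>)) ^ CARD('n) > s" "(1 + e) * (1 - \<delta>) > 1 + \<epsilon>" "0 < \<delta>" "\<delta> < 1"
    using eventually_happens'[OF trivial_limit_at_right_real eventually_conj[OF ev1 eventually_conj[OF ev2 ev3]]] by blast
  show ?thesis
  proof (rule that[OF \<delta>(3,4)])
    fix Q Q' and A A' :: "real^'n^'n" and x
    assume A: "loewner_position Q A" and A': "loewner_position Q' A'" and near: "near_factor \<delta> Q Q'"
    define B where "B = (1 - \<delta>) *\<^sub>R A'"
    have QB: "\<forall>x\<in>Q. norm (B *v x) \<le> 1"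
    proof
      fix x assume x: "x \<in> Q"
      have "B *v x = A' *v ((1 - \<delta>) *\<^sub>R x)"
        by (simp add: B_def matrix_vector_mult_scaleR scaleR_matrix_vector_assoc)
      then show "norm (B *v x) \<le> 1" using x near A' by (simp add: near_factor_def loewner_position_def)
    qed
    have QC: "\<forall>x\<in>Q'. norm ((inverse (1 + \<delta>) *\<^sub>R A) *v x) \<le> 1"
    proof
      fix x assume x: "x \<in> Q'"
      have "(inverse (1 + \<delta>) *\<^sub>R A) *v x = A *v (inverse (1 + \<delta>) *\<^sub>R x)"
        by (simp add: matrix_vector_mult_scaleR scaleR_matrix_vector_assoc)
      then show "norm ((inverse (1 + \<delta>) *\<^sub>R A) *v x) \<le> 1" using x near A by (simp add: near_factor_def loewner_position_def)
    qed
    note M = loewner_position_det_le[OF A QB]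
    have dets: "det A \<noteq> 0" "det A' \<noteq> 0"
      using A A' by (auto simp: loewner_position_def invertible_det_nz)
    have "inverse (1 + \<delta>) ^ CARD('n) * \<bar>det A\<bar> \<le> \<bar>det A'\<bar>"
      using loewner_position_det_le(2)[OF A' QC] \<delta> by (simp add: det_scaleR abs_mult)
    then have "(1 - \<delta>) ^ CARD('n) * (inverse (1 + \<delta>) ^ CARD('n) * \<bar>det A\<bar>) \<le> (1 - \<delta>) ^ CARD('n) * \<bar>det A'\<bar>"
      using \<delta> by (intro mult_left_mono) auto
    also have "\<dots> = \<bar>det B\<bar>" using \<delta> by (simp add: B_def det_scaleR abs_mult)
    finally have "((1 - \<delta>) / (1 + \<delta>)) ^ CARD('n) \<le> \<bar>det B\<bar> / \<bar>det A\<bar>"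
      unfolding divide_inverse[of "1 - \<delta>"] power_mult_distrib
      using dets by (simp add: pos_le_divide_eq mult.assoc)
    then have "s < \<bar>det (B ** matrix_inv A)\<bar>" using \<delta>(1) M(3) by simp
    from s(2)[OF M(1) this, of "A *v x"]
    have "\<bar>norm (B *v x) - norm (A *v x)\<bar> \<le> \<epsilon> * norm (A *v x)"
      by (simp add: matrix_vector_mul_assoc M(4))
    moreover have "norm (B *v x) = (1 - \<delta>) * norm (A' *v x)"
      using \<delta> by (simp add: B_def scaleR_matrix_vector_assoc[symmetric])
    ultimately have b: "(1 - \<delta>) * norm (A' *v x) \<le> (1 + \<epsilon>) * norm (A *v x)"
      "(1 - \<epsilon>) * norm (A *v x) \<le> (1 - \<delta>) * norm (A' *v x)"
      by (simp_all add: abs_le_iff algebra_simps)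
    have "(1 - \<delta>) * norm (A' *v x) \<le> ((1 + e) * (1 - \<delta>)) * norm (A *v x)"
      by (rule order_trans[OF b(1)], rule mult_right_mono) (use \<delta>(2) in auto)
    then have 1: "norm (A' *v x) \<le> (1 + e) * norm (A *v x)"
      using \<delta>(4) mult_le_cancel_left_pos[of "1 - \<delta>" "norm (A' *v x)" "(1 + e) * norm (A *v x)"]
      by (simp only: ac_simps)
    have "norm (A *v x) \<le> ((1 + e) * (1 - \<epsilon>)) * norm (A *v x)"
      using mult_right_mono[OF \<epsilon>1(1), of "norm (A *v x)"] by simp
    also have "\<dots> = (1 + e) * ((1 - \<epsilon>) * norm (A *v x))" by simp
    also have "\<dots> \<le> (1 + e) * ((1 - \<delta>) * norm (A' *v x))"
      using b(2) e by (intro mult_left_mono) auto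
    also have "\<dots> \<le> (1 + e) * (1 * norm (A' *v x))"
      using \<delta> e by (intro mult_left_mono mult_right_mono) auto
    finally show "norm (A' *v x) \<le> (1 + e) * norm (A *v x) \<and> norm (A *v x) \<le> (1 + e) * norm (A' *v x)"
      using 1 by simp
  qed
qed

section \<open>Hausdorff distance of convex bodies and of ellipsoids\<close>

lemma hausdorff_dist_leI:
  assumes "A \<noteq> {}" "B \<noteq> {}"
    and "\<And>a. a \<in> A \<Longrightarrow> \<exists>b\<in>B. dist a b \<le> e" "\<And>b. b \<in> B \<Longrightarrow> \<exists>a\<in>A. dist b a \<le> e" "e \<ge> 0"
  shows "hausdorff_dist A B \<le> e"
proof -
  have "(SUP a\<in>A. infdist a B) \<le> e" "(SUP b\<in>B. infdist b A) \<le> e"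
    using assms by (auto intro!: cSUP_least intro: infdist_le2)
  then show ?thesis using assms(5) by (simp add: hausdorff_dist_def)
qed

lemma hausdorff_dist_lessD:
  fixes A B :: "'a::heine_borel set"
  assumes "hausdorff_dist A B < e" "A \<noteq> {}" "compact A" "B \<noteq> {}" "compact B"
  shows "a \<in> A \<Longrightarrow> \<exists>b\<in>B. dist a b < e" "b \<in> B \<Longrightarrow> \<exists>a\<in>A. dist b a < e"
proof -
  have *: "\<exists>b\<in>B. dist a b < e"
    if "(SUP a\<in>A. infdist a B) < e" "compact A" "compact B" "B \<noteq> {}" "a \<in> A" for A B :: "'a set" and a
  proof -
    have "bdd_above ((\<lambda>a. infdist a B) ` A)"
      by (intro bounded_imp_bdd_above compact_imp_bounded compact_continuous_image that)
        (intro continuous_intros)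
    then have "infdist a B \<le> (SUP a\<in>A. infdist a B)" using that(5) by (rule cSUP_upper2) simp
    then show ?thesis
      using that infdist_attains_inf[of B a] compact_imp_closed by (metis order_le_less_trans)
  qed
  have "(SUP a\<in>A. infdist a B) < e" "(SUP b\<in>B. infdist b A) < e"
    using assms by (simp_all add: hausdorff_dist_def)
  then show "a \<in> A \<Longrightarrow> \<exists>b\<in>B. dist a b < e" "b \<in> B \<Longrightarrow> \<exists>a\<in>A. dist b a < e"
    using * assms by blast+
qed

text \<open>Since \<open>Q\<close> contains the ball of radius \<open>r\<close>, points closer than
  \<open>\<delta> * r\<close> differ by \<delta> times a point of \<open>Q\<close>. So
  \<open>Q'\<close> lies in the Minkowski sum of \<open>Q\<close> and its \<delta>-dilate, which by
  convexity is a dilate of \<open>Q\<close>; and \<open>Q\<close> lies in the sum of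
  \<open>Q'\<close> and the same dilate, which can be cancelled.\<close>

lemma near_factor_if_hausdorff_dist_less:
  fixes Q Q' :: "'a::euclidean_space set"
  assumes Q: "compact Q" "convex Q" "cball 0 r \<subseteq> Q" and r: "r > 0"
    and Q': "compact Q'" "convex Q'" "Q' \<noteq> {}"
    and \<delta>: "0 < \<delta>" "\<delta> < 1" and h: "hausdorff_dist Q Q' < \<delta> * r"
  shows "near_factor \<delta> Q Q'"
proof -
  have ne: "Q \<noteq> {}" using Q(3) r by (metis cball_eq_empty less_le_not_le linorder_not_less subset_empty)
  note haus = hausdorff_dist_lessD[OF h ne Q(1) Q'(3) Q'(1)]
  have split: "\<exists>u\<in>Q. y = x + \<delta> *\<^sub>R u" if "dist y x < \<delta> * r" for x y
  proof
    show "y = x + \<delta> *\<^sub>R ((y - x) /\<^sub>R \<delta>)" using \<delta> by simp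
    have "norm ((y - x) /\<^sub>R \<delta>) = norm (y - x) / \<delta>" using \<delta> by (simp only: norm_scaleR) (simp add: divide_inverse)
    also have "\<dots> \<le> r" using that \<delta> by (simp add: dist_norm field_simps)
    finally have "norm ((y - x) /\<^sub>R \<delta>) \<le> r" .
    then show "(y - x) /\<^sub>R \<delta> \<in> Q" using Q(3) by auto
  qed
  have "inverse (1 + \<delta>) *\<^sub>R y \<in> Q" if y: "y \<in> Q'" for y
  proof -
    obtain x where x: "x \<in> Q" "dist y x < \<delta> * r" using haus(2)[OF y] by blast
    then obtain u where u: "u \<in> Q" "y = x + \<delta> *\<^sub>R u" using split by blast
    have "inverse (1 + \<delta>) *\<^sub>R x + (inverse (1 + \<delta>) * \<delta>) *\<^sub>R u \<in> Q"
      using \<delta> by (intro convexD[OF Q(2) x(1) u(1)]) (auto simp: field_simps)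
    then show ?thesis by (simp add: u(2) scaleR_add_right)
  qed
  \<comment> \<open>Cancellation by separation: at a minimiser \<open>x\<close> over
    \<open>Q\<close> of the separating functional \<open>a\<close>, the decomposition
    \<open>x = y + \<delta> *\<^sub>R u\<close> shows that
    \<open>(1 - \<delta>) * (a \<bullet> x)\<close> is at least
    \<open>a \<bullet> y\<close>.\<close>
  moreover have "(1 - \<delta>) *\<^sub>R x0 \<in> Q'" if x0: "x0 \<in> Q" for x0
  proof (rule ccontr)
    assume "(1 - \<delta>) *\<^sub>R x0 \<notin> Q'"
    then obtain a b where ab: "a \<bullet> ((1 - \<delta>) *\<^sub>R x0) < b" "\<And>x. x \<in> Q' \<Longrightarrow> a \<bullet> x > b"
      using separating_hyperplane_closed_point[OF Q'(2) compact_imp_closed[OF Q'(1)]] by blast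
    obtain x where x: "x \<in> Q" "\<And>y. y \<in> Q \<Longrightarrow> a \<bullet> x \<le> a \<bullet> y"
      using continuous_attains_inf[OF Q(1) ne, of "\<lambda>x. a \<bullet> x"]
        continuous_on_inner[OF continuous_on_const continuous_on_id] by blast
    obtain y where y: "y \<in> Q'" "dist x y < \<delta> * r" using haus(1)[OF x(1)] by blast
    then obtain u where u: "u \<in> Q" "x = y + \<delta> *\<^sub>R u" using split by blast
    have "a \<bullet> x = a \<bullet> y + \<delta> * (a \<bullet> u)" by (simp add: u(2) inner_add_right)
    moreover have "\<delta> * (a \<bullet> x) \<le> \<delta> * (a \<bullet> u)" using x(2)[OF u(1)] \<delta> by (intro mult_left_mono) auto
    ultimately have "(1 - \<delta>) * (a \<bullet> x) > b" using ab(2)[OF y(1)] by (simp add: algebra_simps)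
    moreover have "(1 - \<delta>) * (a \<bullet> x) \<le> (1 - \<delta>) * (a \<bullet> x0)" using x(2)[OF x0] \<delta> by (intro mult_left_mono) auto
    ultimately show False using ab(1) by simp
  qed
  ultimately show ?thesis by (simp add: near_factor_def)
qed

text \<open>A point is matched with its shrinking by \<open>inverse (1 + e)\<close>. The
  displacement is \<open>e\<close> times the norm of the shrunken point, which lies within radius
  \<open>R\<close> whichever of the two sets the point came from.\<close>

lemma hausdorff_dist_ell_le:
  fixes A A' :: "real^'n^'n"
  assumes R: "ell A \<subseteq> cball 0 R" and e: "e \<ge> 0"
    and le: "\<And>x. norm (A' *v x) \<le> (1 + e) * norm (A *v x)" "\<And>x. norm (A *v x) \<le> (1 + e) * norm (A' *v x)"
  shows "hausdorff_dist (ell A) (ell A') \<le> e * R"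
proof -
  have sc: "norm (B *v (inverse (1 + e) *\<^sub>R x)) = norm (B *v x) / (1 + e)" for B :: "real^'n^'n" and x
    using e by (simp add: matrix_vector_mult_scaleR divide_inverse mult.commute)
  have d: "dist x (inverse (1 + e) *\<^sub>R x) = e * norm (inverse (1 + e) *\<^sub>R x)" for x :: "real^'n"
  proof -
    have "x - inverse (1 + e) *\<^sub>R x = e *\<^sub>R (inverse (1 + e) *\<^sub>R x)"
      using e by (simp add: scaleR_left_diff_distrib[of 1, simplified, symmetric] field_simps)
    then show ?thesis using e by (simp add: dist_norm)
  qed
  have i: "inverse (1 + e) *\<^sub>R x \<in> ell A'" if "x \<in> ell A" for x
    using that le(1)[of x] e unfolding ell_def mem_Collect_eq sc
    by (smt (verit, best) divide_le_eq_1_pos mult_left_le)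
  have j: "inverse (1 + e) *\<^sub>R x \<in> ell A" if "x \<in> ell A'" for x
    using that le(2)[of x] e unfolding ell_def mem_Collect_eq sc
    by (smt (verit, best) divide_le_eq_1_pos mult_left_le)
  have R0: "R \<ge> 0" using R zero_in_ell[of A] by auto
  show ?thesis
  proof (rule hausdorff_dist_leI)
    fix x assume x: "x \<in> ell A"
    have "norm (inverse (1 + e) *\<^sub>R x) \<le> norm x" using e
      by (simp add: field_simps)
    also have "\<dots> \<le> R" using R x by auto
    finally show "\<exists>b\<in>ell A'. dist x b \<le> e * R"
      using e by (intro bexI[OF _ i[OF x]]) (simp only: d mult_left_mono)
  next
    fix x assume x: "x \<in> ell A'"
    have "norm (inverse (1 + e) *\<^sub>R x) \<le> R" using R j[OF x] by auto
    then show "\<exists>b\<in>ell A. dist x b \<le> e * R"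
      using e by (intro bexI[OF _ j[OF x]]) (simp only: d mult_left_mono)
  qed (use zero_in_ell e R0 in auto)
qed

section \<open>Tensor products of matrices\<close>

lemma Rsp_eq_coord_subspace: "Rsp n = coord_subspace (coord ` {..<n})"
  by (simp add: Rsp_def coord_subspace_def)

lemma subspace_Rsp: "subspace (Rsp n)"
  by (auto simp: subspace_def Rsp_def)

lemma Rsp_add: "x \<in> Rsp n \<Longrightarrow> y \<in> Rsp n \<Longrightarrow> x + y \<in> Rsp n"
  and Rsp_scaleR: "x \<in> Rsp n \<Longrightarrow> c *\<^sub>R x \<in> Rsp n"
  by (auto simp: Rsp_def)

lemma axis_in_Rsp: "k < n \<Longrightarrow> axis (coord k) c \<in> Rsp n"
  by (auto simp: Rsp_def axis_def)

lemma tensor_cong: "(\<And>i. i < l \<Longrightarrow> x i = y i) \<Longrightarrow> tensor l d x = tensor l d y"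
  by (simp add: tensor_def)

lemma tensor_update_component:
  assumes "i < l"
  shows "tensor l d (x(i := u)) $ m = (\<Prod>j\<in>{..<l} - {i}. x j $ coord (multi_index l d m j)) * u $ coord (multi_index l d m i)"
proof -
  have "tensor l d (x(i := u)) $ m = (\<Prod>j\<in>insert i ({..<l} - {i}). (x(i := u)) j $ coord (multi_index l d m j))"
    using assms by (simp add: tensor_def insert_absorb)
  also have "\<dots> = u $ coord (multi_index l d m i) * (\<Prod>j\<in>{..<l} - {i}. (x(i := u)) j $ coord (multi_index l d m j))"
    by (subst prod.insert) auto
  also have "(\<Prod>j\<in>{..<l} - {i}. (x(i := u)) j $ coord (multi_index l d m j)) = (\<Prod>j\<in>{..<l} - {i}. x j $ coord (multi_index l d m j))"
    by (intro prod.cong) auto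
  finally show ?thesis by (simp only: mult.commute)
qed

lemma tensor_add: "i < l \<Longrightarrow> tensor l d (x(i := u + v)) = tensor l d (x(i := u)) + tensor l d (x(i := v))"
  by (simp add: vec_eq_iff tensor_update_component distrib_left)

lemma tensor_scale: "i < l \<Longrightarrow> tensor l d (x(i := c *\<^sub>R u)) = c *\<^sub>R tensor l d (x(i := u))"
  by (simp add: vec_eq_iff tensor_update_component)

lemma linear_tensor_update: "i < l \<Longrightarrow> linear (\<lambda>u. tensor l d (x(i := u)))"
  by (intro linearI tensor_add tensor_scale)

lemma tensor_scale_all: "tensor l d (\<lambda>i. c i *\<^sub>R x i) = (\<Prod>i<l. c i) *\<^sub>R tensor l d x"
  by (simp add: vec_eq_iff tensor_def prod.distrib)

lemma norm_tensor:
  fixes x :: "nat \<Rightarrow> real ^ 'm::finite"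
  assumes "CARD('m) = (\<Prod>i<l. d i)" "\<And>i. i < l \<Longrightarrow> x i \<in> Rsp (d i)"
  shows "norm (tensor l d x) = (\<Prod>i<l. norm (x i))"
proof (rule power2_eq_imp_eq)
  show "(norm (tensor l d x))\<^sup>2 = (\<Prod>i<l. norm (x i))\<^sup>2"
    using inner_tensor[OF assms, of x] by (simp only: power2_norm_eq_inner prod_power_distrib)
qed (simp_all add: prod_nonneg)

lemma tensor_eq_0_iff:
  fixes x :: "nat \<Rightarrow> real ^ 'm::finite"
  assumes "CARD('m) = (\<Prod>i<l. d i)" "\<And>i. i < l \<Longrightarrow> x i \<in> Rsp (d i)"
  shows "tensor l d x = 0 \<longleftrightarrow> (\<exists>i<l. x i = 0)"
  using norm_tensor[OF assms] by (metis (no_types, lifting) finite_lessThan lessThan_iff norm_eq_zero prod_zero_iff)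

lemma multi_index_less:
  assumes "CARD('m::finite) = (\<Prod>i<l. d i)" "i < l"
  shows "multi_index l d (m :: 'm) i < d i"
  using bij_multi_index[OF assms(1)] assms(2) by (auto simp: bij_betw_def PiE_iff)

lemma axis_eq_tensor:
  assumes card: "CARD('m::finite) = (\<Prod>i<l. d i)"
  shows "(axis m 1 :: real ^ 'm) = tensor l d (\<lambda>i. axis (coord (multi_index l d m i)) 1)"
proof -
  have "tensor l d (\<lambda>i. axis (coord (multi_index l d m i)) 1) $ m' = (if m' = m then 1 else 0 :: real)" for m' :: 'm
  proof (cases "m' = m")
    case True
    then show ?thesis by (simp add: tensor_def)
  next
    case False
    then have "multi_index l d m' \<noteq> multi_index l d m"
      using bij_multi_index[OF card] by (auto simp: bij_betw_def inj_on_def)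
    moreover have mem: "multi_index l d m' \<in> PiE {..<l} (\<lambda>i. {..<d i})" for m' :: 'm
      using bij_multi_index[OF card] by (auto simp: bij_betw_def)
    ultimately obtain i where i: "i < l" "multi_index l d m' i \<noteq> multi_index l d m i"
      using PiE_ext[OF mem mem] by blast
    have "(coord (multi_index l d m' i) :: 'm) \<noteq> coord (multi_index l d m i)"
      using inj_on_coord[OF dim_le_card[OF card i(1)]] multi_index_less[OF card i(1)] i(2)
      unfolding inj_on_def by (metis lessThan_iff)
    then have "\<exists>i<l. (axis (coord (multi_index l d m i)) 1 :: real ^ 'm) $ coord (multi_index l d m' i) = 0"
      using i(1) by (intro exI[of _ i]) (simp add: axis_def)
    then show ?thesis using False by (auto simp: tensor_def)
  qed
  then show ?thesis by (simp add: vec_eq_iff axis_def)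
qed

lemma tensor_span_eq_UNIV:
  assumes "CARD('m::finite) = (\<Prod>i<l. d i)" and "subspace V"
    and "\<And>x. (\<And>i. i < l \<Longrightarrow> x i \<in> Rsp (d i)) \<Longrightarrow> tensor l d x \<in> V"
  shows "v \<in> (V :: (real ^ 'm) set)"
proof -
  have "span {tensor l d x | x. \<forall>i<l. x i \<in> Rsp (d i)} \<subseteq> V"
    using assms(2,3) by (intro span_minimal) auto
  then show ?thesis using span_tensor[OF assms(1)] by auto
qed

lemma linear_eq_on_tensors:
  fixes f g :: "real ^ 'm::finite \<Rightarrow> 'b::real_vector"
  assumes "CARD('m) = (\<Prod>i<l. d i)" "linear f" "linear g"
    and eq: "\<And>x. (\<And>i. i < l \<Longrightarrow> x i \<in> Rsp (d i)) \<Longrightarrow> f (tensor l d x) = g (tensor l d x)"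
  shows "f v = g v"
proof -
  have "v \<in> {v. f v = g v}"
    by (rule tensor_span_eq_UNIV[OF assms(1)])
      (use assms in \<open>auto simp: subspace_def linear_0 linear_add linear_cmul\<close>)
  then show ?thesis by simp
qed

lemma matrix_eq_on_tensors:
  fixes M N :: "real ^ 'm::finite ^ 'm"
  assumes "CARD('m) = (\<Prod>i<l. d i)"
    and "\<And>x. (\<And>i. i < l \<Longrightarrow> x i \<in> Rsp (d i)) \<Longrightarrow> M *v tensor l d x = N *v tensor l d x"
  shows "M = N"
  unfolding matrix_eq
  using linear_eq_on_tensors[OF assms(1) matrix_vector_mul_linear matrix_vector_mul_linear assms(2)] by blast

text \<open>The Kronecker product. When the cardinalities match, \<open>multi_index l d m i\<close>
  is below \<open>d i\<close>, so only the block of \<open>A i\<close> acting on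
  \<open>Rsp (d i)\<close> enters.\<close>

definition tensor_matrix :: "nat \<Rightarrow> (nat \<Rightarrow> nat) \<Rightarrow> (nat \<Rightarrow> real ^ 'm ^ 'm) \<Rightarrow> real ^ 'm::finite ^ 'm"
  where "tensor_matrix l d A = (\<chi> m m'. \<Prod>i<l. A i $ coord (multi_index l d m i) $ coord (multi_index l d m' i))"

lemma transpose_tensor_matrix: "transpose (tensor_matrix l d A) = tensor_matrix l d (\<lambda>i. transpose (A i))"
  by (simp add: tensor_matrix_def transpose_def)

lemma tensor_matrix_tensor:
  fixes x :: "nat \<Rightarrow> real ^ 'm::finite"
  assumes card: "CARD('m) = (\<Prod>i<l. d i)" and x: "\<And>i. i < l \<Longrightarrow> x i \<in> Rsp (d i)"
  shows "tensor_matrix l d A *v tensor l d x = tensor l d (\<lambda>i. A i *v x i)"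
  unfolding vec_eq_iff
proof
  fix m :: 'm
  \<comment> \<open>A row of the Kronecker product is the tensor of the rows of the factors, so the
    product formula for inner products applies. The rows may leave \<open>Rsp (d i)\<close> and
    therefore stand in the unrestricted second argument of \<open>inner_tensor\<close>.\<close>
  let ?r = "\<lambda>i. A i $ coord (multi_index l d m i)"
  have "(tensor_matrix l d A *v tensor l d x) $ m = tensor l d x \<bullet> tensor l d ?r"
    by (simp add: matrix_vector_mult_def tensor_matrix_def inner_vec_def tensor_def mult.commute)
  also have "\<dots> = (\<Prod>i<l. x i \<bullet> ?r i)" by (rule inner_tensor[OF card x])
  also have "\<dots> = tensor l d (\<lambda>i. A i *v x i) $ m"
    by (simp add: tensor_def matrix_vector_mul_component inner_commute)
  finally show "(tensor_matrix l d A *v tensor l d x) $ m = tensor l d (\<lambda>i. A i *v x i) $ m" .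
qed

abbreviation rblock :: "nat \<Rightarrow> real ^ 'm ^ 'm::finite \<Rightarrow> bool"
  where "rblock n \<equiv> block (coord ` {..<n})"

lemma rblock_Rsp: "rblock n A \<Longrightarrow> x \<in> Rsp n \<Longrightarrow> A *v x \<in> Rsp n"
  unfolding Rsp_eq_coord_subspace by (rule block_coord_subspace)

lemma block_matrix_inv:
  fixes A :: "real ^ 'n ^ 'n"
  assumes A: "block I A" and "invertible A"
  shows "block I (matrix_inv A)"
  unfolding block_def
proof (intro allI impI)
  fix i j assume "i \<notin> I \<or> j \<notin> I"
  then show "matrix_inv A $ i $ j = (if i = j then 1 else 0)"
    using block_mult_row[OF A, of i "matrix_inv A" j] block_mult_column[OF A, of j "matrix_inv A" i]
      matrix_inv[OF assms(2)] by (auto simp: mat_def)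
qed

lemma tensor_matrix_inverse:
  fixes A B :: "nat \<Rightarrow> real ^ 'm::finite ^ 'm"
  assumes card: "CARD('m) = (\<Prod>i<l. d i)"
    and B: "\<And>i. i < l \<Longrightarrow> rblock (d i) (B i)" "\<And>i. i < l \<Longrightarrow> A i ** B i = mat 1"
  shows "tensor_matrix l d A ** tensor_matrix l d B = mat 1"
proof (rule matrix_eq_on_tensors[OF card])
  fix x :: "nat \<Rightarrow> real ^ 'm" assume x: "\<And>i. i < l \<Longrightarrow> x i \<in> Rsp (d i)"
  have "tensor_matrix l d A ** tensor_matrix l d B *v tensor l d x = tensor l d (\<lambda>i. A i *v (B i *v x i))"
    using x B by (simp add: matrix_vector_mul_assoc[symmetric] tensor_matrix_tensor[OF card] rblock_Rsp)
  also have "\<dots> = mat 1 *v tensor l d x"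
    using B(2) by (simp add: matrix_vector_mul_assoc cong: tensor_cong)
  finally show "tensor_matrix l d A ** tensor_matrix l d B *v tensor l d x = mat 1 *v tensor l d x" .
qed

lemma invertible_tensor_matrix:
  fixes A :: "nat \<Rightarrow> real ^ 'm::finite ^ 'm"
  assumes card: "CARD('m) = (\<Prod>i<l. d i)"
    and A: "\<And>i. i < l \<Longrightarrow> rblock (d i) (A i)" "\<And>i. i < l \<Longrightarrow> invertible (A i)"
  shows "invertible (tensor_matrix l d A)"
  unfolding invertible_def
  by (intro exI[of _ "tensor_matrix l d (\<lambda>i. matrix_inv (A i))"] conjI tensor_matrix_inverse[OF card])
    (use A matrix_inv block_matrix_inv in blast)+

lemma convex_ell: "convex (ell A)" for A :: "real^'n^'n"
proof -
  have "ell A = (*v) A -` cball 0 1" by (auto simp: ell_def)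
  then show ?thesis by (simp add: convex_linear_vimage)
qed

lemma convex_abs_inner_le: "convex {u. \<bar>u \<bullet> z\<bar> \<le> c}"
proof -
  have "{u. \<bar>u \<bullet> z\<bar> \<le> c} = {u. z \<bullet> u \<le> c} \<inter> {u. z \<bullet> u \<ge> - c}" by (auto simp: inner_commute)
  then show ?thesis by (simp add: convex_Int convex_halfspace_le convex_halfspace_ge)
qed

lemma proj_tensor_subset:
  assumes "convex S" "\<And>x. (\<And>i. i < l \<Longrightarrow> x i \<in> P i) \<Longrightarrow> tensor l d x \<in> S"
  shows "proj_tensor l d P \<subseteq> S"
  unfolding proj_tensor_def using assms by (intro hull_minimal) auto

lemma tensor_in_proj_tensor: "(\<And>i. i < l \<Longrightarrow> x i \<in> P i) \<Longrightarrow> tensor l d x \<in> proj_tensor l d P"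
  unfolding proj_tensor_def by (rule hull_inc) auto

text \<open>
  The trace inequality characterising an optimal position passes from the factors to the tensor product
  by replacing, one slot at a time, the points of the body by the vectors of the canonical basis.
\<close>

proposition loewner_position_proj_tensor:
  fixes A :: "nat \<Rightarrow> real ^ 'm::finite ^ 'm"
  assumes card: "CARD('m) = (\<Prod>i<l. d i)"
    and P: "\<And>i. i < l \<Longrightarrow> P i \<subseteq> Rsp (d i)" "\<And>i. i < l \<Longrightarrow> P i \<noteq> {}"
    and A: "\<And>i. i < l \<Longrightarrow> optimal_position (coord ` {..<d i}) (P i) (A i)"
  shows "loewner_position (proj_tensor l d P) (tensor_matrix l d A)"
proof -
  have blk: "rblock (d i) (A i)" "invertible (A i)" "\<And>x. x \<in> P i \<Longrightarrow> norm (A i *v x) \<le> 1" if "i < l" for i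
    using A[OF that] by (auto simp: optimal_position_def)
  have opt: "(\<Sum>k\<in>coord ` {..<d i}. S $ k $ k) \<le> card (coord ` {..<d i} :: 'm set) * c"
    if "i < l" "\<forall>x\<in>P i. (A i *v x) \<bullet> (S *v (A i *v x)) \<le> c" for i S and c :: real
    using A[OF that(1)] that(2) unfolding optimal_position_def by blast
  have Ax: "tensor_matrix l d A *v tensor l d x = tensor l d (\<lambda>i. A i *v x i)"
    if "\<And>i. i < l \<Longrightarrow> x i \<in> P i" for x
    using that P by (intro tensor_matrix_tensor[OF card]) blast
  have "proj_tensor l d P \<subseteq> ell (tensor_matrix l d A)"
  proof (rule proj_tensor_subset[OF convex_ell])
    fix x assume x: "\<And>i. i < l \<Longrightarrow> x i \<in> P i"
    have "norm (tensor l d (\<lambda>i. A i *v x i)) = (\<Prod>i<l. norm (A i *v x i))"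
      using x P blk by (intro norm_tensor[OF card]) (blast intro: rblock_Rsp)
    also have "\<dots> \<le> 1" using x blk by (intro prod_le_1) auto
    finally show "tensor l d x \<in> ell (tensor_matrix l d A)" by (simp add: ell_def Ax x)
  qed
  then have sub: "\<forall>x\<in>proj_tensor l d P. norm (tensor_matrix l d A *v x) \<le> 1"
    by (auto simp: ell_def)
  have "(norm M)\<^sup>2 \<le> CARD('m)"
    if M: "\<And>u. u \<in> proj_tensor l d P \<Longrightarrow> norm (M *v (tensor_matrix l d A *v u)) \<le> 1" for M :: "real ^ 'm ^ 'm"
  proof -
    \<comment> \<open>Hybrid tuples: canonical basis vectors in the slots below \<open>j\<close>,
      points of the positioned bodies in the others. The bound at \<open>j = 0\<close> is the
      hypothesis on \<open>M\<close>; at \<open>j = l\<close> the sum is its squared Frobenius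
      norm.\<close>
    define e where "e f x j i = (if i < j then axis (coord (f i)) 1 else A i *v x i)"
      for f :: "nat \<Rightarrow> nat" and x :: "nat \<Rightarrow> real ^ 'm" and j i :: nat
    have ind: "(\<Sum>f\<in>PiE {..<j} (\<lambda>i. {..<d i}). (norm (M *v tensor l d (e f x j)))\<^sup>2) \<le> (\<Prod>i<j. d i)"
      if "j \<le> l" "\<And>i. i < l \<Longrightarrow> x i \<in> P i" for j x
      using that
    proof (induction j arbitrary: x)
      case 0
      have "e f x 0 = (\<lambda>i. A i *v x i)" for f by (simp add: e_def fun_eq_iff)
      moreover have "norm (M *v tensor l d (\<lambda>i. A i *v x i)) \<le> 1"
        using M[OF tensor_in_proj_tensor[of l x P d]] 0 Ax[of x] by simp
      ultimately show ?case by (simp add: power_le_one)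
    next
      case (Suc j)
      then have j: "j < l" by simp
      let ?F = "PiE {..<j} (\<lambda>i. {..<d i})"
      define L where "L f = matrix (\<lambda>v. M *v tensor l d ((e f x j)(j := v)))" for f
      have L: "L f *v v = M *v tensor l d ((e f x j)(j := v))" for f v
      proof -
        have "linear (\<lambda>v. M *v tensor l d ((e f x j)(j := v)))"
          using linear_compose[OF linear_tensor_update[OF j] matrix_vector_mul_linear] by (simp add: o_def)
        then show ?thesis by (simp add: L_def matrix_works)
      qed
      \<comment> \<open>The sum over basis choices in the slots below \<open>j\<close>, as a
        quadratic form in the free slot \<open>j\<close>. The induction hypothesis bounds it on the
        positioned body by the product of the earlier dimensions, and the trace of its block is the
        sum for \<open>Suc j\<close>.\<close>
      define S where "S = (\<Sum>f\<in>?F. transpose (L f) ** L f)"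
      have S: "v \<bullet> (S *v w) = (\<Sum>f\<in>?F. (L f *v v) \<bullet> (L f *v w))" for v w
      proof -
        have "(\<Sum>f\<in>F. B f) *v w = (\<Sum>f\<in>F. B f *v w)" if "finite F" for F and B :: "(nat \<Rightarrow> nat) \<Rightarrow> real ^ 'm ^ 'm"
          using that by induction (auto simp: matrix_vector_mult_add_rdistrib)
        moreover have "finite ?F" by (intro finite_PiE) auto
        ultimately show ?thesis
          by (simp only: S_def inner_sum_right matrix_vector_mul_assoc[symmetric] inner_matrix_vector_right transpose_transpose)
      qed
      have "(\<Sum>k\<in>coord ` {..<d j}. S $ k $ k) \<le> real (card (coord ` {..<d j} :: 'm set)) * real (\<Prod>i<j. d i)"
      proof (rule opt[OF j], rule ballI)
        fix y assume y: "y \<in> P j"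
        have "(A j *v y) \<bullet> (S *v (A j *v y)) = (\<Sum>f\<in>?F. (norm (M *v tensor l d (e f (x(j := y)) j)))\<^sup>2)"
        proof -
          have "(e f x j)(j := A j *v y) = e f (x(j := y)) j" for f by (auto simp: e_def)
          then show ?thesis by (simp add: S L power2_norm_eq_inner)
        qed
        also have "\<dots> \<le> (\<Prod>i<j. d i)" using Suc.prems y by (intro Suc.IH) auto
        finally show "(A j *v y) \<bullet> (S *v (A j *v y)) \<le> (\<Prod>i<j. d i)" .
      qed
      also have "(\<Sum>k\<in>coord ` {..<d j}. S $ k $ k) = (\<Sum>k<d j. axis (coord k) 1 \<bullet> (S *v axis (coord k) 1))"
        using inj_on_coord[OF dim_le_card[OF card j]]
        by (subst sum.reindex) (auto simp: matrix_vector_mult_basis column_def inner_axis')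
      also have "\<dots> = (\<Sum>k<d j. \<Sum>f\<in>?F. (norm (M *v tensor l d (e (f(j := k)) x (Suc j))))\<^sup>2)"
      proof -
        have "(e f x j)(j := axis (coord k) 1) = e (f(j := k)) x (Suc j)" for f k
          by (auto simp: e_def)
        then show ?thesis by (simp add: S L power2_norm_eq_inner)
      qed
      also have "\<dots> = (\<Sum>f\<in>PiE {..<Suc j} (\<lambda>i. {..<d i}). (norm (M *v tensor l d (e f x (Suc j))))\<^sup>2)"
        unfolding lessThan_Suc PiE_insert_eq
        by (subst sum.reindex[OF inj_combinator]) (simp_all add: sum.cartesian_product case_prod_unfold)
      also have "card (coord ` {..<d j} :: 'm set) = d j"
        using inj_on_coord[OF dim_le_card[OF card j]] by (simp add: card_image)
      finally show ?case by (simp add: mult.commute)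
    qed
    define x where "x i = (SOME v. v \<in> P i)" for i
    have x: "x i \<in> P i" if "i < l" for i using P(2)[OF that] by (simp add: x_def some_in_eq)
    have "(norm M)\<^sup>2 = (\<Sum>m\<in>(UNIV :: 'm set). (norm (M *v tensor l d (\<lambda>i. axis (coord (multi_index l d m i)) 1)))\<^sup>2)"
      unfolding norm_matrix_power2_columns by (simp only: axis_eq_tensor[OF card, symmetric])
    also have "\<dots> = (\<Sum>f\<in>PiE {..<l} (\<lambda>i. {..<d i}). (norm (M *v tensor l d (\<lambda>i. axis (coord (f i)) 1)))\<^sup>2)"
      by (rule sum.reindex_bij_betw[OF bij_multi_index[OF card]])
    also have "\<dots> = (\<Sum>f\<in>PiE {..<l} (\<lambda>i. {..<d i}). (norm (M *v tensor l d (e f x l)))\<^sup>2)"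
      by (intro sum.cong refl arg_cong[of _ _ "\<lambda>u. (norm (M *v u))\<^sup>2"] tensor_cong) (simp add: e_def)
    also have "\<dots> \<le> (\<Prod>i<l. d i)" using ind[of l x] x by simp
    finally show ?thesis by (simp add: card)
  qed
  then show ?thesis
    using sub invertible_tensor_matrix[OF card blk(1,2)] by (simp add: loewner_position_def)
qed

section \<open>Symmetric bodies, ellipsoids and their polars\<close>

lemma sym_convex_body_iff:
  fixes E :: "'a::euclidean_space set"
  assumes E: "subspace E"
  shows "sym_convex_body E Q \<longleftrightarrow> Q \<subseteq> E \<and> compact Q \<and> convex Q \<and> (\<forall>x\<in>Q. - x \<in> Q) \<and>
    (\<exists>r>0. \<forall>x\<in>E. norm x \<le> r \<longrightarrow> x \<in> Q)"
proof -
  have sym: "Q = uminus ` Q \<longleftrightarrow> (\<forall>x\<in>Q. - x \<in> Q)"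
    by (auto simp: image_iff) (metis minus_minus)
  have "top_of_set E interior_of Q \<noteq> {} \<longleftrightarrow> (\<exists>r>0. \<forall>x\<in>E. norm x \<le> r \<longrightarrow> x \<in> Q)"
    if Q: "Q \<subseteq> E" "convex Q" "\<forall>x\<in>Q. - x \<in> Q"
  proof
    assume "top_of_set E interior_of Q \<noteq> {}"
    then obtain p T where T: "openin (top_of_set E) T" "p \<in> T" "T \<subseteq> Q" by (auto simp: interior_of_def)
    then obtain e where e: "e > 0" "ball p e \<inter> E \<subseteq> T" unfolding openin_contains_ball by blast
    have p: "p \<in> E" "- p \<in> Q" using T Q by auto
    \<comment> \<open>The average of \<open>p + 2 *\<^sub>R x\<close> and \<open>- p\<close> is
      \<open>x\<close>, so symmetry and convexity move the ball around \<open>p\<close> to the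
      origin.\<close>
    have "x \<in> Q" if x: "x \<in> E" "norm x \<le> e/4" for x
    proof -
      have "norm (2 *\<^sub>R x) < e" using x(2) e(1) by simp
      then have "p + 2 *\<^sub>R x \<in> ball p e" by (simp add: dist_norm)
      then have "p + 2 *\<^sub>R x \<in> Q"
        using e(2) T(3) subspace_add[OF E p(1) subspace_scale[OF E x(1), of 2]] by blast
      then have "(1/2) *\<^sub>R (p + 2 *\<^sub>R x) + (1/2) *\<^sub>R (- p) \<in> Q"
        using p(2) by (intro convexD[OF Q(2)]) auto
      then show ?thesis by (simp add: scaleR_add_right)
    qed
    then show "\<exists>r>0. \<forall>x\<in>E. norm x \<le> r \<longrightarrow> x \<in> Q" using e(1) by (intro exI[of _ "e/4"]) auto
  next
    assume "\<exists>r>0. \<forall>x\<in>E. norm x \<le> r \<longrightarrow> x \<in> Q"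
    then obtain r where r: "r > 0" "\<And>x. x \<in> E \<Longrightarrow> norm x \<le> r \<Longrightarrow> x \<in> Q" by blast
    have "openin (top_of_set E) (E \<inter> ball 0 r)" by (simp add: openin_open_Int)
    moreover have "0 \<in> E \<inter> ball 0 r" "E \<inter> ball 0 r \<subseteq> Q" using r E by (auto simp: subspace_0)
    ultimately show "top_of_set E interior_of Q \<noteq> {}" unfolding interior_of_def by blast
  qed
  then show ?thesis by (auto simp: sym_convex_body_def sym)
qed

lemma sym_convex_body_ell:
  assumes "invertible A" "subspace E"
  shows "sym_convex_body E (E \<inter> ell A)"
proof -
  have "\<exists>r>0. \<forall>x\<in>E. norm x \<le> r \<longrightarrow> x \<in> E \<inter> ell A"
  proof (intro exI conjI ballI impI)
    show "inverse (norm A + 1) > 0" by (simp add: add_nonneg_pos)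
    fix x assume x: "x \<in> E" "norm x \<le> inverse (norm A + 1)"
    have "norm (A *v x) \<le> norm A * norm x" by (rule norm_matrix_vector_le)
    also have "\<dots> \<le> (norm A + 1) * inverse (norm A + 1)" using x by (intro mult_mono) auto
    also have "\<dots> = 1" using norm_ge_zero[of A] by (intro right_inverse) linarith
    finally show "x \<in> E \<inter> ell A" using x by (simp add: ell_def)
  qed
  moreover have "compact (E \<inter> ell A)"
    using assms by (intro closed_Int_compact compact_ell closed_subspace)
  moreover have "- x \<in> E \<inter> ell A" if "x \<in> E \<inter> ell A" for x
    using that assms(2) by (auto simp: ell_def subspace_neg linear_neg[OF matrix_vector_mul_linear])
  moreover have "convex (E \<inter> ell A)"
    by (intro convex_Int convex_ell subspace_imp_convex assms)
  ultimately show ?thesis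
    unfolding sym_convex_body_iff[OF assms(2)] by blast
qed

text \<open>The polar of the preimage of a ball under \<open>A\<close> is the image of the ball
  under \<open>transpose A\<close>. The block form keeps inverse and transpose inside
  \<open>Rsp n\<close>; the test point is \<open>matrix_inv A\<close> applied to the normalised
  \<open>w\<close>.\<close>

lemma polar_Rsp_Int_ell:
  fixes A :: "real ^ 'm::finite ^ 'm"
  assumes A: "rblock n A" "invertible A" and y: "y \<in> polar (Rsp n) (Rsp n \<inter> ell A)"
  obtains w where "w \<in> Rsp n" "norm w \<le> 1" "y = transpose A *v w"
proof -
  let ?B = "matrix_inv A"
  note inv = matrix_inv[OF A(2)]
  define w where "w = transpose ?B *v y"
  have yR: "y \<in> Rsp n" using y by (simp add: polar_def)
  have w: "w \<in> Rsp n" unfolding w_def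
    by (intro rblock_Rsp block_transpose block_matrix_inv A yR)
  have "transpose A *v w = transpose (?B ** A) *v y"
    unfolding w_def matrix_vector_mul_assoc matrix_transpose_mul ..
  then have yw: "y = transpose A *v w" using inv by (simp add: transpose_mat)
  have ABw: "A *v (?B *v w) = w" using inv by (simp add: matrix_vector_mul_assoc)
  have "norm w \<le> 1"
  proof (cases "w = 0")
    case False
    define z where "z = inverse (norm w) *\<^sub>R (?B *v w)"
    have "z \<in> Rsp n" unfolding z_def by (intro Rsp_scaleR rblock_Rsp block_matrix_inv A w)
    moreover have "A *v z = inverse (norm w) *\<^sub>R w" by (simp add: z_def matrix_vector_mult_scaleR ABw)
    then have "norm (A *v z) = 1" using False by simp
    ultimately have "\<bar>z \<bullet> y\<bar> \<le> 1" using y by (simp add: polar_def ell_def)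
    moreover have "z \<bullet> y = inverse (norm w) * (w \<bullet> w)"
    proof -
      have "z \<bullet> y = (A *v z) \<bullet> w"
        by (simp only: yw inner_matrix_vector_right transpose_transpose)
      then show ?thesis by (simp add: \<open>A *v z = _\<close>)
    qed
    ultimately show ?thesis using False by (simp add: power2_norm_eq_inner[symmetric] power2_eq_square field_simps)
  qed simp
  then show ?thesis by (rule that[OF w _ yw])
qed

definition tensorial_wrt :: "nat \<Rightarrow> (nat \<Rightarrow> nat) \<Rightarrow> (nat \<Rightarrow> (real ^ 'm::finite) set) \<Rightarrow> (real ^ 'm) set \<Rightarrow> bool"
  where "tensorial_wrt l d P Q \<longleftrightarrow> sym_convex_body UNIV Q \<and> (\<forall>i<l. sym_convex_body (Rsp (d i)) (P i)) \<and>
    proj_tensor l d P \<subseteq> Q \<and> Q \<subseteq> inj_tensor l d P"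

lemma tensorial_bodies_iff: "Q \<in> tensorial_bodies l d \<longleftrightarrow> (\<exists>P. tensorial_wrt l d P Q)"
  by (auto simp: tensorial_bodies_def tensorial_wrt_def)

text \<open>Multiplicativity of the norm on decomposable vectors gives the lower inclusion directly.
  It gives the upper one through Cauchy-Schwarz, since polar vectors of the factors are transposed
  images of vectors of the unit ball.\<close>

proposition ell_tensor_matrix_tensorial:
  fixes A :: "nat \<Rightarrow> real ^ 'm::finite ^ 'm"
  assumes card: "CARD('m) = (\<Prod>i<l. d i)"
    and A: "\<And>i. i < l \<Longrightarrow> rblock (d i) (A i)" "\<And>i. i < l \<Longrightarrow> invertible (A i)"
  shows "tensorial_wrt l d (\<lambda>i. Rsp (d i) \<inter> ell (A i)) (ell (tensor_matrix l d A))"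
proof -
  let ?A = "tensor_matrix l d A" and ?P = "\<lambda>i. Rsp (d i) \<inter> ell (A i)"
  have inv: "invertible ?A" using invertible_tensor_matrix[OF card A] .
  have "proj_tensor l d ?P \<subseteq> ell ?A"
  proof (rule proj_tensor_subset[OF convex_ell])
    fix x assume x: "\<And>i. i < l \<Longrightarrow> x i \<in> Rsp (d i) \<inter> ell (A i)"
    have "norm (?A *v tensor l d x) = (\<Prod>i<l. norm (A i *v x i))"
      using x A by (subst tensor_matrix_tensor[OF card], force, intro norm_tensor[OF card]) (auto intro: rblock_Rsp)
    also have "\<dots> \<le> 1" using x by (intro prod_le_1) (auto simp: ell_def)
    finally show "tensor l d x \<in> ell ?A" by (simp add: ell_def)
  qed
  moreover have "ell ?A \<subseteq> inj_tensor l d ?P"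
  proof
    fix z assume z: "z \<in> ell ?A"
    have "proj_tensor l d (\<lambda>i. polar (Rsp (d i)) (?P i)) \<subseteq> {u. \<bar>u \<bullet> z\<bar> \<le> 1}"
    proof (rule proj_tensor_subset[OF convex_abs_inner_le])
      fix y assume y: "\<And>i. i < l \<Longrightarrow> y i \<in> polar (Rsp (d i)) (?P i)"
      have "\<exists>w. i < l \<longrightarrow> w \<in> Rsp (d i) \<and> norm w \<le> 1 \<and> y i = transpose (A i) *v w" for i
      proof (cases "i < l")
        case True
        from polar_Rsp_Int_ell[OF A[OF True] y[OF True]] show ?thesis by blast
      qed blast
      then have "\<forall>i. \<exists>w. i < l \<longrightarrow> w \<in> Rsp (d i) \<and> norm w \<le> 1 \<and> y i = transpose (A i) *v w" ..
      from choice[OF this] obtain w where w: "\<And>i. i < l \<Longrightarrow> w i \<in> Rsp (d i)" "\<And>i. i < l \<Longrightarrow> norm (w i) \<le> 1"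
        "\<And>i. i < l \<Longrightarrow> y i = transpose (A i) *v w i" by blast
      have "tensor l d y = tensor l d (\<lambda>i. transpose (A i) *v w i)"
        by (rule tensor_cong) (rule w(3))
      also have "\<dots> = transpose ?A *v tensor l d w"
        by (simp only: transpose_tensor_matrix tensor_matrix_tensor[OF card w(1)])
      finally have "tensor l d y \<bullet> z = tensor l d w \<bullet> (?A *v z)"
        by (simp only: inner_matrix_vector_right)
      then have "\<bar>tensor l d y \<bullet> z\<bar> \<le> norm (tensor l d w) * norm (?A *v z)"
        by (simp add: Cauchy_Schwarz_ineq2)
      also have "\<dots> \<le> 1 * 1"
      proof (rule mult_mono)
        show "norm (tensor l d w) \<le> 1"
          by (subst norm_tensor[OF card w(1)]) (use w(2) in \<open>auto intro!: prod_le_1\<close>)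
        show "norm (?A *v z) \<le> 1" using z by (simp add: ell_def)
      qed auto
      finally show "tensor l d y \<in> {u. \<bar>u \<bullet> z\<bar> \<le> 1}" by simp
    qed
    then show "z \<in> inj_tensor l d ?P" by (auto simp: inj_tensor_def polar_def)
  qed
  moreover have "sym_convex_body UNIV (ell ?A)"
    using sym_convex_body_ell[OF inv, of UNIV] by simp
  moreover have "sym_convex_body (Rsp (d i)) (?P i)" if "i < l" for i
    using A that by (intro sym_convex_body_ell subspace_Rsp)
  ultimately show ?thesis by (simp add: tensorial_wrt_def)
qed

section \<open>Gauges of tensorial bodies on decomposable vectors\<close>

text \<open>For a symmetric body this is the Minkowski functional of \<open>P\<close> on
  \<open>Rsp n\<close>, by the bipolar theorem. As a maximum over the polar it comes with a norming
  vector, and norming vectors of the factors can be tensored.\<close>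

definition dual_gauge :: "nat \<Rightarrow> (real ^ 'm::finite) set \<Rightarrow> real ^ 'm \<Rightarrow> real"
  where "dual_gauge n P x = (SUP y\<in>polar (Rsp n) P. \<bar>x \<bullet> y\<bar>)"

definition Rsp_proj :: "nat \<Rightarrow> real ^ 'm::finite \<Rightarrow> real ^ 'm"
  where "Rsp_proj n a = (\<chi> j. if j \<in> coord ` {..<n} then a $ j else 0)"

lemma Rsp_proj_in: "Rsp_proj n a \<in> Rsp n"
  by (simp add: Rsp_proj_def Rsp_def)

lemma linear_Rsp_proj: "linear (Rsp_proj n)"
  by (rule linearI) (auto simp: Rsp_proj_def vec_eq_iff)

lemma Rsp_proj_eq: "x \<in> Rsp n \<Longrightarrow> Rsp_proj n x = x"
  by (auto simp: Rsp_proj_def Rsp_def vec_eq_iff)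

lemma inner_Rsp_proj: "x \<in> Rsp n \<Longrightarrow> x \<bullet> Rsp_proj n a = x \<bullet> a"
  unfolding inner_vec_def by (rule sum.cong) (auto simp: Rsp_proj_def Rsp_def)

lemma sym_convex_body_zero: "subspace E \<Longrightarrow> sym_convex_body E P \<Longrightarrow> 0 \<in> P"
  using subspace_0 by (fastforce simp: sym_convex_body_iff)

context
  fixes n :: nat and P :: "(real ^ 'm::finite) set"
  assumes P: "sym_convex_body (Rsp n) P"
begin

lemma body_facts: "P \<subseteq> Rsp n" "compact P" "convex P" "\<And>x. x \<in> P \<Longrightarrow> - x \<in> P" "0 \<in> P"
  using P sym_convex_body_zero[OF subspace_Rsp P] by (auto simp: sym_convex_body_iff[OF subspace_Rsp])

lemma polar_neg: "y \<in> polar (Rsp n) P \<Longrightarrow> - y \<in> polar (Rsp n) P"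
  by (auto simp: polar_def subspace_neg[OF subspace_Rsp])

lemma zero_in_polar: "0 \<in> polar (Rsp n) P"
  by (simp add: polar_def subspace_0[OF subspace_Rsp])

lemma compact_polar: "compact (polar (Rsp n) P)"
proof -
  obtain r where r: "r > 0" "\<And>x. x \<in> Rsp n \<Longrightarrow> norm x \<le> r \<Longrightarrow> x \<in> P"
    using P by (auto simp: sym_convex_body_iff[OF subspace_Rsp])
  have "norm y \<le> 1 / r" if y: "y \<in> polar (Rsp n) P" for y
  proof (cases "y = 0")
    case False
    have "(r / norm y) *\<^sub>R y \<in> P"
      using y r(1) False by (intro r(2) Rsp_scaleR) (auto simp: polar_def)
    then have "\<bar>((r / norm y) *\<^sub>R y) \<bullet> y\<bar> \<le> 1" using y unfolding polar_def by blast
    moreover have "((r / norm y) *\<^sub>R y) \<bullet> y = r * norm y"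
      using False by (simp add: power2_norm_eq_inner[symmetric] power2_eq_square)
    ultimately show ?thesis using r(1) by (simp add: field_simps)
  qed (use r in simp)
  then have "bounded (polar (Rsp n) P)" by (auto simp: bounded_iff)
  moreover have "closed (polar (Rsp n) P)"
  proof -
    have "polar (Rsp n) P = Rsp n \<inter> (\<Inter>x\<in>P. {y. \<bar>x \<bullet> y\<bar> \<le> 1})" by (auto simp: polar_def)
    moreover have "closed {y. \<bar>x \<bullet> y\<bar> \<le> 1}" for x :: "real ^ 'm"
      by (intro closed_Collect_le continuous_intros)
    ultimately show ?thesis
      by (simp add: closed_Int closed_INT closed_subspace[OF subspace_Rsp])
  qed
  ultimately show ?thesis by (simp add: compact_eq_bounded_closed)
qed

lemma bdd_above_polar: "bdd_above ((\<lambda>y. \<bar>x \<bullet> y\<bar>) ` polar (Rsp n) P)"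
  by (intro bounded_imp_bdd_above compact_imp_bounded compact_continuous_image compact_polar continuous_intros)

lemma dual_gauge_ge: "y \<in> polar (Rsp n) P \<Longrightarrow> \<bar>x \<bullet> y\<bar> \<le> dual_gauge n P x"
  unfolding dual_gauge_def by (rule cSUP_upper[OF _ bdd_above_polar])

lemma dual_gauge_attained: obtains y where "y \<in> polar (Rsp n) P" "x \<bullet> y = dual_gauge n P x"
proof -
  obtain y where y: "y \<in> polar (Rsp n) P" "\<And>z. z \<in> polar (Rsp n) P \<Longrightarrow> \<bar>x \<bullet> z\<bar> \<le> \<bar>x \<bullet> y\<bar>"
  proof -
    have "continuous_on (polar (Rsp n) P) (\<lambda>y. \<bar>x \<bullet> y\<bar>)" by (intro continuous_intros)
    then show ?thesis
      using continuous_attains_sup[OF compact_polar, of "\<lambda>y. \<bar>x \<bullet> y\<bar>"] zero_in_polar that by blast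
  qed
  have "dual_gauge n P x = \<bar>x \<bullet> y\<bar>"
    unfolding dual_gauge_def by (intro cSup_eq_maximum) (use y in auto)
  then show ?thesis
    using that[of y] that[of "- y"] y(1) polar_neg by (cases "x \<bullet> y \<ge> 0") auto
qed

lemma dual_gauge_nonneg: "0 \<le> dual_gauge n P x"
  using dual_gauge_ge[OF zero_in_polar, of x] by simp

lemma dual_gauge_scaleR: "dual_gauge n P (c *\<^sub>R x) = \<bar>c\<bar> * dual_gauge n P x"
proof (rule antisym)
  obtain y where y: "y \<in> polar (Rsp n) P" "(c *\<^sub>R x) \<bullet> y = dual_gauge n P (c *\<^sub>R x)"
    by (rule dual_gauge_attained)
  have "c * (x \<bullet> y) \<le> \<bar>c\<bar> * \<bar>x \<bullet> y\<bar>" by (metis abs_ge_self abs_mult)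
  also have "\<dots> \<le> \<bar>c\<bar> * dual_gauge n P x" by (intro mult_left_mono dual_gauge_ge y) simp
  finally show "dual_gauge n P (c *\<^sub>R x) \<le> \<bar>c\<bar> * dual_gauge n P x" using y(2) by simp
next
  obtain y where y: "y \<in> polar (Rsp n) P" "x \<bullet> y = dual_gauge n P x"
    by (rule dual_gauge_attained)
  have "\<bar>c\<bar> * dual_gauge n P x = \<bar>(c *\<^sub>R x) \<bullet> y\<bar>"
    using dual_gauge_nonneg[of x] by (simp add: y(2) abs_mult)
  also have "\<dots> \<le> dual_gauge n P (c *\<^sub>R x)" by (intro dual_gauge_ge y)
  finally show "\<bar>c\<bar> * dual_gauge n P x \<le> dual_gauge n P (c *\<^sub>R x)" .
qed

lemma in_body_iff_dual_gauge:
  assumes x: "x \<in> Rsp n"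
  shows "x \<in> P \<longleftrightarrow> dual_gauge n P x \<le> 1"
proof
  assume "x \<in> P"
  then show "dual_gauge n P x \<le> 1"
    using dual_gauge_attained[of x] by (smt (verit, best) mem_Collect_eq polar_def)
next
  assume le: "dual_gauge n P x \<le> 1"
  show "x \<in> P"
  proof (rule ccontr)
    assume "x \<notin> P"
    then obtain a b where ab: "a \<bullet> x < b" "\<And>p. p \<in> P \<Longrightarrow> a \<bullet> p > b"
      using separating_hyperplane_closed_point[OF body_facts(3) compact_imp_closed[OF body_facts(2)]] by blast
    have b: "b < 0" using ab(2)[OF body_facts(5)] by simp
    \<comment> \<open>The separating functional, projected to the subspace. Division by the negative
      number \<open>b\<close> makes its values on \<open>P\<close> at most one in absolute value and
      its value at \<open>x\<close> greater than one.\<close>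
    define y where "y = (1/b) *\<^sub>R Rsp_proj n a"
    have yi: "z \<bullet> y = (a \<bullet> z) / b" if "z \<in> Rsp n" for z
      using inner_Rsp_proj[OF that, of a] by (simp add: y_def inner_commute)
    have "\<bar>p \<bullet> y\<bar> \<le> 1" if p: "p \<in> P" for p
    proof -
      have "a \<bullet> p > b" "a \<bullet> (- p) > b" using ab(2) p body_facts(4) by blast+
      then have "\<bar>a \<bullet> p\<bar> \<le> \<bar>b\<bar>" using b by auto
      moreover have "p \<in> Rsp n" using p body_facts(1) by blast
      moreover have "\<bar>b\<bar> > 0" using b by simp
      ultimately show ?thesis by (simp only: yi abs_divide divide_le_eq_1_pos)
    qed
    then have "y \<in> polar (Rsp n) P"
      unfolding polar_def y_def by (auto intro: Rsp_scaleR Rsp_proj_in)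
    from dual_gauge_ge[OF this, of x] le have "(a \<bullet> x) / b \<le> 1" unfolding yi[OF x] by linarith
    then show False using ab(1) b by (simp add: field_simps)
  qed
qed

lemma dual_gauge_pos:
  assumes x: "x \<in> Rsp n" "x \<noteq> 0"
  shows "dual_gauge n P x > 0"
proof -
  obtain B where B: "B > 0" "\<And>p. p \<in> P \<Longrightarrow> norm p \<le> B"
    using compact_imp_bounded[OF body_facts(2)] by (auto simp: bounded_pos)
  define y where "y = (1 / (B * norm x)) *\<^sub>R x"
  have "\<bar>p \<bullet> y\<bar> \<le> 1" if "p \<in> P" for p
  proof -
    have "\<bar>p \<bullet> y\<bar> \<le> norm p * norm y" by (rule Cauchy_Schwarz_ineq2)
    also have "norm y = 1 / B" using x B by (simp add: y_def)
    also have "norm p * (1 / B) \<le> 1" using B(1) B(2)[OF that] by simp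
    finally show ?thesis .
  qed
  then have "y \<in> polar (Rsp n) P"
    unfolding polar_def y_def by (auto intro: Rsp_scaleR x)
  from dual_gauge_ge[OF this, of x]
  have "x \<bullet> y \<le> dual_gauge n P x" by simp
  moreover have "x \<bullet> y = norm x / B"
    using x B by (simp add: y_def power2_norm_eq_inner[symmetric] power2_eq_square)
  ultimately show ?thesis using x B by (smt (verit) divide_pos_pos zero_less_norm_iff)
qed

end

lemma tensor_zero: "l \<ge> 1 \<Longrightarrow> (\<exists>i<l. x i = 0) \<Longrightarrow> tensor l d x = 0"
  by (auto simp: vec_eq_iff tensor_def)

context
  fixes l :: nat and d :: "nat \<Rightarrow> nat" and P :: "nat \<Rightarrow> (real ^ 'm::finite) set" and Q
  assumes card: "CARD('m) = (\<Prod>i<l. d i)" and l: "l \<ge> 1" and d1: "\<And>i. i < l \<Longrightarrow> d i \<ge> 1"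
    and PQ: "tensorial_wrt l d P Q"
begin

lemma tensorial_factor: "i < l \<Longrightarrow> sym_convex_body (Rsp (d i)) (P i)"
  and tensorial_body: "sym_convex_body UNIV Q"
  and tensorial_lower: "proj_tensor l d P \<subseteq> Q"
  and tensorial_upper: "Q \<subseteq> inj_tensor l d P"
  using PQ by (auto simp: tensorial_wrt_def)

abbreviation "gg \<equiv> \<lambda>i. dual_gauge (d i) (P i)"

text \<open>Scalars can be moved between the factors without changing the tensor, so only the
  product of the gauges matters.\<close>

lemma factors_normalised:
  assumes x: "\<And>i. i < l \<Longrightarrow> x i \<in> Rsp (d i)" and le: "(\<Prod>i<l. gg i (x i)) \<le> 1"
  obtains y where "\<And>i. i < l \<Longrightarrow> y i \<in> P i" "tensor l d y = tensor l d x"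
proof (cases "\<exists>i<l. x i = 0")
  case True
  have "tensor l d (\<lambda>i. 0) = tensor l d x" using l True by (subst (1 2) tensor_zero) auto
  then show ?thesis
    using sym_convex_body_zero[OF subspace_Rsp tensorial_factor] by (intro that[of "\<lambda>i. 0"]) auto
next
  case False
  \<comment> \<open>Every factor is normalised to gauge one and slot 0 receives the whole product,
    which is at most one; the scalars then multiply to one.\<close>
  define c where "c i = (if i = 0 then (\<Prod>i<l. gg i (x i)) else 1) / gg i (x i)" for i
  have pos: "gg i (x i) > 0" if "i < l" for i
    using False x that by (intro dual_gauge_pos tensorial_factor) auto
  have G: "(\<Prod>i<l. gg i (x i)) > 0" using pos by (intro prod_pos) auto
  have "(\<Prod>i<l. c i) = (\<Prod>i<l. if i = 0 then (\<Prod>i<l. gg i (x i)) else 1) / (\<Prod>i<l. gg i (x i))"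
    unfolding c_def by (rule prod_dividef)
  also have "(\<Prod>i<l. if i = 0 then (\<Prod>i<l. gg i (x i)) else 1) = (\<Prod>i<l. gg i (x i))"
    using l by (subst prod.delta) auto
  also have "(\<Prod>i<l. gg i (x i)) / (\<Prod>i<l. gg i (x i)) = 1"
    by (rule divide_self[OF less_imp_neq[OF G, symmetric]])
  finally have c: "(\<Prod>i<l. c i) = 1" .
  show ?thesis
  proof (rule that[of "\<lambda>i. c i *\<^sub>R x i"])
    show "tensor l d (\<lambda>i. c i *\<^sub>R x i) = tensor l d x" by (simp add: tensor_scale_all c)
    fix i assume i: "i < l"
    have "gg i (c i *\<^sub>R x i) = \<bar>c i\<bar> * gg i (x i)" by (rule dual_gauge_scaleR[OF tensorial_factor[OF i]])
    also have "\<dots> \<le> 1" using pos[OF i] G le by (simp add: c_def)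
    finally show "c i *\<^sub>R x i \<in> P i"
      using in_body_iff_dual_gauge[OF tensorial_factor[OF i] Rsp_scaleR[OF x[OF i]]] by blast
  qed
qed

lemma factor_subset_Rsp: "i < l \<Longrightarrow> P i \<subseteq> Rsp (d i)"
  using body_facts(1)[OF tensorial_factor] .

text \<open>
  On decomposable vectors the projective and the injective tensor norms agree, so the gauge of any
  tensorial body is multiplicative there.
\<close>

lemma tensor_in_tensorial_iff:
  assumes x: "\<And>i. i < l \<Longrightarrow> x i \<in> Rsp (d i)"
  shows "tensor l d x \<in> Q \<longleftrightarrow> (\<Prod>i<l. gg i (x i)) \<le> 1"
proof
  assume "(\<Prod>i<l. gg i (x i)) \<le> 1"
  then obtain y where y: "\<And>i. i < l \<Longrightarrow> y i \<in> P i" "tensor l d y = tensor l d x"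
    using factors_normalised[OF x] by blast
  then show "tensor l d x \<in> Q"
    using tensor_in_proj_tensor[of l y P d] tensorial_lower by auto
next
  assume "tensor l d x \<in> Q"
  then have xi: "tensor l d x \<in> inj_tensor l d P" using tensorial_upper by blast
  \<comment> \<open>Norming vectors of the factors: their tensor is a generator of the projective
    product of the polars, and its value on the given tensor is the product of the gauges.\<close>
  have "\<exists>y. i < l \<longrightarrow> y \<in> polar (Rsp (d i)) (P i) \<and> x i \<bullet> y = gg i (x i)" for i
    using dual_gauge_attained[OF tensorial_factor, of i "x i"] by metis
  then obtain y where y: "\<And>i. i < l \<Longrightarrow> y i \<in> polar (Rsp (d i)) (P i)" "\<And>i. i < l \<Longrightarrow> x i \<bullet> y i = gg i (x i)"
    by metis
  have "tensor l d y \<in> proj_tensor l d (\<lambda>i. polar (Rsp (d i)) (P i))"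
    by (rule tensor_in_proj_tensor) (rule y(1))
  then have "\<bar>tensor l d y \<bullet> tensor l d x\<bar> \<le> 1"
    using xi by (auto simp: inj_tensor_def polar_def)
  moreover have "tensor l d y \<bullet> tensor l d x = (\<Prod>i<l. gg i (x i))"
    using inner_tensor[OF card x, of y] y(2) by (simp add: inner_commute)
  ultimately show "(\<Prod>i<l. gg i (x i)) \<le> 1" by simp
qed

lemma tensor_in_tensorialE:
  assumes "\<And>i. i < l \<Longrightarrow> x i \<in> Rsp (d i)" "tensor l d x \<in> Q"
  obtains y where "\<And>i. i < l \<Longrightarrow> y i \<in> P i" "tensor l d y = tensor l d x"
  using factors_normalised[OF assms(1)] tensor_in_tensorial_iff[OF assms(1)] assms(2) by blast

section \<open>Sections of a tensorial body through the anchor\<close>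

lemma e1_in_Rsp: "i < l \<Longrightarrow> e1 \<in> Rsp (d i)"
  using d1[of i] by (simp add: e1_def axis_in_Rsp)

lemma e1_gauge_pos: "i < l \<Longrightarrow> gg i e1 > 0"
  by (intro dual_gauge_pos tensorial_factor e1_in_Rsp) (simp_all add: e1_def axis_eq_0_iff)

lemma minkowski_functional_e1: "minkowski_functional Q (tensor l d (\<lambda>_. e1)) = (\<Prod>i<l. gg i e1)"
proof -
  let ?G = "\<Prod>i<l. gg i e1"
  have G: "?G > 0" using e1_gauge_pos by (intro prod_pos) auto
  have "r > 0 \<and> inverse r *\<^sub>R tensor l d (\<lambda>_. e1) \<in> Q \<longleftrightarrow> r \<ge> ?G" for r
  proof (cases "r > 0")
    case True
    let ?c = "\<lambda>i. if i = 0 then inverse r else 1"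
    have c: "(\<Prod>i<l. ?c i) = inverse r" using l by (subst prod.delta) auto
    then have "inverse r *\<^sub>R tensor l d (\<lambda>_. e1) = (tensor l d (\<lambda>i. ?c i *\<^sub>R e1) :: real ^ 'm)"
      by (simp only: tensor_scale_all)
    then have "inverse r *\<^sub>R tensor l d (\<lambda>_. e1) \<in> Q \<longleftrightarrow> tensor l d (\<lambda>i. ?c i *\<^sub>R e1) \<in> Q"
      by (simp only:)
    also have "\<dots> \<longleftrightarrow> (\<Prod>i<l. gg i (?c i *\<^sub>R e1)) \<le> 1"
      by (rule tensor_in_tensorial_iff) (intro Rsp_scaleR e1_in_Rsp)
    also have "(\<Prod>i<l. gg i (?c i *\<^sub>R e1)) = (\<Prod>i<l. ?c i * gg i e1)"
      using True by (intro prod.cong refl) (simp add: dual_gauge_scaleR[OF tensorial_factor])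
    also have "\<dots> = inverse r * ?G" by (simp only: prod.distrib c)
    also have "inverse r * ?G \<le> 1 \<longleftrightarrow> r \<ge> ?G" using True by (simp add: field_simps)
    finally show ?thesis using True by blast
  qed (use G in auto)
  then have "{r. r > 0 \<and> inverse r *\<^sub>R tensor l d (\<lambda>_. e1) \<in> Q} = {?G..}" by auto
  then show ?thesis by (simp add: minkowski_functional_def)
qed

lemma anchor_in_Rsp: "i < l \<Longrightarrow> anchor l d Q i \<in> Rsp (d i)"
  by (auto simp: anchor_def intro: Rsp_scaleR e1_in_Rsp)

lemma prod_e1_gauge_pos: "(\<Prod>i<l. gg i e1) > 0"
  using e1_gauge_pos by (intro prod_pos) auto

lemma anchor_gauge:
  assumes i: "i < l"
  shows "gg i (anchor l d Q i) = (if i = l - 1 then 1 / (\<Prod>i<l. gg i e1) else 1) * gg i e1"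
proof (cases "i = l - 1")
  case True
  then have "gg i (anchor l d Q i) = gg i ((1 / (\<Prod>i<l. gg i e1)) *\<^sub>R e1)"
    by (simp add: anchor_def minkowski_functional_e1)
  also have "\<dots> = \<bar>1 / (\<Prod>i<l. gg i e1)\<bar> * gg i e1"
    by (rule dual_gauge_scaleR[OF tensorial_factor[OF i]])
  also have "\<bar>1 / (\<Prod>i<l. gg i e1)\<bar> = 1 / (\<Prod>i<l. gg i e1)"
    by (intro abs_of_nonneg divide_nonneg_nonneg less_imp_le[OF prod_e1_gauge_pos]) simp
  finally show ?thesis unfolding if_P[OF True] .
qed (simp add: anchor_def)

lemma anchor_gauge_pos: "i < l \<Longrightarrow> gg i (anchor l d Q i) > 0"
  unfolding anchor_gauge using e1_gauge_pos prod_e1_gauge_pos by (intro mult_pos_pos) auto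

text \<open>The scalar in the last anchor puts the anchor tensor on the boundary of
  \<open>Q\<close>.\<close>

lemma prod_anchor_gauge: "(\<Prod>i<l. gg i (anchor l d Q i)) = 1"
proof -
  let ?G = "\<Prod>i<l. gg i e1"
  have "(\<Prod>i<l. gg i (anchor l d Q i)) = (\<Prod>i<l. (if i = l - 1 then 1 / ?G else 1) * gg i e1)"
    by (intro prod.cong refl) (simp add: anchor_gauge)
  also have "\<dots> = (1 / ?G) * ?G"
    unfolding prod.distrib using l by (subst prod.delta) auto
  also have "\<dots> = 1"
  proof -
    have "1 / g * g = 1" if "g > 0" for g :: real using that by simp
    then show ?thesis using prod_e1_gauge_pos .
  qed
  finally show ?thesis .
qed

text \<open>The gauges of the other anchors multiply to the reciprocal of the gauge of anchor
  \<open>i\<close>, so the section is the dilate of \<open>P i\<close> by that gauge.\<close>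

lemma body_section_iff:
  assumes i: "i < l"
  shows "x \<in> body_section l d Q i \<longleftrightarrow> x \<in> Rsp (d i) \<and> gg i x \<le> gg i (anchor l d Q i)"
proof (cases "x \<in> Rsp (d i)")
  case True
  let ?a = "anchor l d Q" and ?R = "\<Prod>j\<in>{..<l} - {i}. gg j (anchor l d Q j)"
  have "tensor l d (?a(i := x)) \<in> Q \<longleftrightarrow> (\<Prod>j<l. gg j ((?a(i := x)) j)) \<le> 1"
    using anchor_in_Rsp True by (intro tensor_in_tensorial_iff) auto
  also have "(\<Prod>j<l. gg j ((?a(i := x)) j)) = gg i x * ?R"
  proof -
    have "(\<Prod>j<l. gg j ((?a(i := x)) j)) = gg i x * (\<Prod>j\<in>{..<l} - {i}. gg j ((?a(i := x)) j))"
      using i by (subst prod.remove[of _ i]) auto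
    also have "(\<Prod>j\<in>{..<l} - {i}. gg j ((?a(i := x)) j)) = ?R" by (rule prod.cong) auto
    finally show ?thesis .
  qed
  also have "gg i x * ?R \<le> 1 \<longleftrightarrow> gg i x \<le> gg i (?a i)"
  proof -
    have 1: "gg i (?a i) * ?R = 1"
      using prod_anchor_gauge i by (subst (asm) prod.remove[of _ i]) auto
    have R: "?R > 0" using anchor_gauge_pos by (intro prod_pos) auto
    show ?thesis by (subst 1[symmetric]) (use R in simp)
  qed
  finally show ?thesis using True unfolding body_section_def by blast
qed (simp add: body_section_def)

text \<open>The dilation factors of the sections cancel in the tensor product. This frees the
  construction from the choice of \<open>e1\<close> and from the special role of the last
  slot.\<close>

lemma proj_tensor_body_section: "proj_tensor l d (body_section l d Q) = proj_tensor l d P"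
proof -
  have "{tensor l d x | x. \<forall>i<l. x i \<in> body_section l d Q i} = {tensor l d x | x. \<forall>i<l. x i \<in> P i}"
  proof (intro set_eqI iffI; elim CollectE exE conjE)
    fix u x assume u: "u = tensor l d x" and x: "\<forall>i<l. x i \<in> body_section l d Q i"
    have "(\<Prod>i<l. gg i (x i)) \<le> (\<Prod>i<l. gg i (anchor l d Q i))"
      using x by (intro prod_mono) (auto simp: body_section_iff dual_gauge_nonneg[OF tensorial_factor])
    then obtain y where y: "\<And>i. i < l \<Longrightarrow> y i \<in> P i" "tensor l d y = tensor l d x"
      using factors_normalised[of x] x by (auto simp: prod_anchor_gauge body_section_iff)
    then show "u \<in> {tensor l d x | x. \<forall>i<l. x i \<in> P i}"
      using u by (intro CollectI exI[of _ y]) simp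
  next
    fix u x assume u: "u = tensor l d x" and x: "\<forall>i<l. x i \<in> P i"
    let ?c = "\<lambda>i. gg i (anchor l d Q i)"
    have "tensor l d (\<lambda>i. ?c i *\<^sub>R x i) = tensor l d x"
      by (simp only: tensor_scale_all prod_anchor_gauge scaleR_one)
    moreover have "?c i *\<^sub>R x i \<in> body_section l d Q i" if i: "i < l" for i
    proof -
      have xR: "x i \<in> Rsp (d i)" using x i factor_subset_Rsp by blast
      have "gg i (x i) \<le> 1"
        using x i in_body_iff_dual_gauge[OF tensorial_factor[OF i] xR] by blast
      then show ?thesis
        using anchor_gauge_pos[OF i] xR i
        by (simp add: body_section_iff dual_gauge_scaleR[OF tensorial_factor] Rsp_scaleR)
    qed
    ultimately show "u \<in> {tensor l d x | x. \<forall>i<l. x i \<in> body_section l d Q i}"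
      using u by (intro CollectI exI[of _ "\<lambda>i. ?c i *\<^sub>R x i"]) auto
  qed
  then show ?thesis by (simp add: proj_tensor_def)
qed

lemma l_tensor_eq: "l_tensor l d Q = Loewner (proj_tensor l d P)"
  by (simp add: l_tensor_def proj_tensor_body_section)

lemma tensorial_optimal_position:
  obtains A where "\<And>i. i < l \<Longrightarrow> optimal_position (coord ` {..<d i}) (P i) (A i)"
proof -
  have "\<exists>A. i < l \<longrightarrow> optimal_position (coord ` {..<d i}) (P i) A" for i
  proof (cases "i < l")
    case True
    note body = tensorial_factor[OF True]
    obtain r where r: "r > 0" "\<forall>x\<in>Rsp (d i). norm x \<le> r \<longrightarrow> x \<in> P i"
      using body unfolding sym_convex_body_iff[OF subspace_Rsp] by blast
    have "\<exists>A. optimal_position (coord ` {..<d i}) (P i) A"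
      by (rule optimal_position_exists[of "P i" "coord ` {..<d i}" r])
        (use r body_facts(1,2)[OF body] compact_imp_bounded in \<open>auto simp: Rsp_eq_coord_subspace\<close>)
    then show ?thesis by blast
  qed blast
  then show ?thesis using that by metis
qed

lemma loewner_position_tensorial:
  assumes "\<And>i. i < l \<Longrightarrow> optimal_position (coord ` {..<d i}) (P i) (A i)"
  shows "loewner_position (proj_tensor l d P) (tensor_matrix l d A)"
  using sym_convex_body_zero[OF subspace_Rsp tensorial_factor]
  by (intro loewner_position_proj_tensor card factor_subset_Rsp assms) auto

end

lemma l_tensor_loewner_position:
  fixes Q :: "(real ^ 'm::finite) set"
  assumes "CARD('m) = (\<Prod>i<l. d i)" "l \<ge> 1" "\<And>i. i < l \<Longrightarrow> d i \<ge> 1" "tensorial_wrt l d P Q"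
  obtains A where "loewner_position (proj_tensor l d P) (tensor_matrix l d A)"
    "l_tensor l d Q = ell (tensor_matrix l d A)"
    "\<And>i. i < l \<Longrightarrow> rblock (d i) (A i)" "\<And>i. i < l \<Longrightarrow> invertible (A i)"
proof -
  obtain A where A: "\<And>i. i < l \<Longrightarrow> optimal_position (coord ` {..<d i}) (P i) (A i)"
    using tensorial_optimal_position[OF assms] by blast
  have pos: "loewner_position (proj_tensor l d P) (tensor_matrix l d A)"
    using loewner_position_tensorial[OF assms] A by blast
  show ?thesis
    using that[OF pos] l_tensor_eq[OF assms] Loewner_eq_ell[OF pos] A by (simp add: optimal_position_def)
qed

lemma ex_loewner_position:
  fixes Q :: "(real ^ 'm::finite) set"
  assumes "CARD('m) = (\<Prod>i<l. d i)" "l \<ge> 1" "\<And>i. i < l \<Longrightarrow> d i \<ge> 1" "tensorial_wrt l d P Q"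
  shows "\<exists>A. loewner_position (proj_tensor l d P) A \<and> l_tensor l d Q = ell A"
proof (rule l_tensor_loewner_position[OF assms])
  fix A
  assume "loewner_position (proj_tensor l d P) (tensor_matrix l d A)" "l_tensor l d Q = ell (tensor_matrix l d A)"
  then show ?thesis by blast
qed

lemma l_tensor_in_tensorial_ellipsoids:
  fixes Q :: "(real ^ 'm::finite) set"
  assumes "CARD('m) = (\<Prod>i<l. d i)" "l \<ge> 1" "\<And>i. i < l \<Longrightarrow> d i \<ge> 1" "tensorial_wrt l d P Q"
  shows "l_tensor l d Q \<in> tensorial_ellipsoids l d"
proof -
  obtain A where A: "loewner_position (proj_tensor l d P) (tensor_matrix l d A)"
    "l_tensor l d Q = ell (tensor_matrix l d A)"
    "\<And>i. i < l \<Longrightarrow> rblock (d i) (A i)" "\<And>i. i < l \<Longrightarrow> invertible (A i)"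
    using l_tensor_loewner_position[OF assms] by blast
  have "ellipsoid (ell (tensor_matrix l d A))"
    using A(1) ellipsoid_iff[of "ell (tensor_matrix l d A)"] unfolding loewner_position_def by metis
  then show ?thesis
    using ell_tensor_matrix_tensorial[OF assms(1) A(3,4)]
    unfolding A(2) tensorial_ellipsoids_def tensorial_bodies_iff by blast
qed

section \<open>Tensorial ellipsoids\<close>

lemma inj_on_subspace_if_zero:
  assumes "linear L" "subspace E" and L0: "\<And>x. x \<in> E \<Longrightarrow> L x = 0 \<Longrightarrow> x = 0"
  shows "inj_on L E"
proof (rule inj_onI)
  fix x y assume xy: "x \<in> E" "y \<in> E" "L x = L y"
  have "L (x - y) = 0" using xy(3) linear_diff[OF assms(1)] by simp
  then show "x = y" using L0[OF subspace_diff[OF assms(2) xy(1,2)]] by simp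
qed

lemma dim_image_if_zero:
  fixes L :: "'a::euclidean_space \<Rightarrow> 'b::euclidean_space"
  assumes "linear L" "subspace E" and "\<And>x. x \<in> E \<Longrightarrow> L x = 0 \<Longrightarrow> x = 0"
  shows "dim (L ` E) = dim E"
  using dim_image_eq[OF assms(1), of E] inj_on_subspace_if_zero[OF assms] span_eq_iff[of E] assms(2) by metis

lemma block_matrix_extension:
  fixes L :: "real ^ 'm::finite \<Rightarrow> real ^ 'm"
  assumes L: "linear L" and LR: "\<And>x. x \<in> Rsp n \<Longrightarrow> L x \<in> Rsp n"
    and L0: "\<And>x. x \<in> Rsp n \<Longrightarrow> L x = 0 \<Longrightarrow> x = 0"
  obtains B where "rblock n B" "invertible B" "\<And>x. x \<in> Rsp n \<Longrightarrow> B *v x = L x"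
proof -
  define F where "F x = L (Rsp_proj n x) + (x - Rsp_proj n x)" for x
  have linF: "linear F"
    unfolding F_def
    by (intro linear_compose_add linear_compose_sub linear_Rsp_proj linear_id[unfolded id_def]
        linear_compose[OF linear_Rsp_proj L, unfolded o_def])
  have FR: "F x = L x" if "x \<in> Rsp n" for x using that by (simp add: F_def Rsp_proj_eq)
  let ?B = "matrix F"
  have B: "?B *v x = F x" for x using linF by (simp add: matrix_works)
  have "rblock n ?B"
    unfolding block_def
  proof (intro allI impI)
    fix i j :: 'm assume ij: "i \<notin> coord ` {..<n} \<or> j \<notin> coord ` {..<n}"
    have Bij: "?B $ i $ j = F (axis j 1) $ i" by (simp add: matrix_def)
    show "?B $ i $ j = (if i = j then 1 else 0)"
    proof (cases "j \<in> coord ` {..<n}")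
      case True
      then have "axis j 1 \<in> Rsp n" by (auto intro: axis_in_Rsp)
      then have "F (axis j 1) \<in> Rsp n" using FR LR by simp
      then show ?thesis using ij True Bij by (auto simp: Rsp_def)
    next
      case False
      then have "Rsp_proj n (axis j 1) = (0 :: real ^ 'm)" by (auto simp: Rsp_proj_def vec_eq_iff axis_def)
      then have "F (axis j 1) = axis j 1" by (simp add: F_def linear_0[OF L])
      then show ?thesis using Bij by (simp add: axis_def)
    qed
  qed
  moreover have "inj F"
  proof (rule linear_injective_0[OF linF, THEN iffD2], intro allI impI)
    fix x assume x0: "F x = 0"
    let ?p = "Rsp_proj n x"
    have "Rsp_proj n (F x) = L ?p"
      unfolding F_def linear_add[OF linear_Rsp_proj] linear_diff[OF linear_Rsp_proj]
        Rsp_proj_eq[OF LR[OF Rsp_proj_in]] Rsp_proj_eq[OF Rsp_proj_in] by simp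
    then have "L ?p = 0" unfolding x0 linear_0[OF linear_Rsp_proj] by simp
    then have "?p = 0" using L0 Rsp_proj_in by blast
    then show "x = 0" using x0 by (simp add: F_def linear_0[OF L])
  qed
  then have "invertible ?B" using det_nz_iff_inj[OF linF] invertible_det_nz by blast
  ultimately show ?thesis using that[of ?B] B FR by simp
qed

text \<open>The image of \<open>Rsp n\<close> under \<open>L\<close> is a subspace of equal
  dimension somewhere in the space; an isometry carries it back to \<open>Rsp n\<close> without
  changing norms, and the composition extends to a block matrix.\<close>

lemma block_matrix_of_injective:
  fixes L :: "real ^ 'm::finite \<Rightarrow> real ^ 'm"
  assumes L: "linear L" and L0: "\<And>x. x \<in> Rsp n \<Longrightarrow> L x = 0 \<Longrightarrow> x = 0"
  obtains B where "rblock n B" "invertible B" "\<And>x. x \<in> Rsp n \<Longrightarrow> norm (B *v x) = norm (L x)"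
proof -
  obtain f where f: "linear f" "f ` L ` Rsp n = (Rsp n :: (real ^ 'm) set)" "\<And>x. x \<in> L ` Rsp n \<Longrightarrow> norm (f x) = norm x"
    using isometry_subspaces[OF linear_subspace_image[OF L subspace_Rsp] subspace_Rsp]
      dim_image_if_zero[OF L subspace_Rsp L0] by blast
  have fn: "norm (f (L x)) = norm (L x)" if "x \<in> Rsp n" for x using f(3) that by blast
  obtain B where "rblock n B" "invertible B" "\<And>x. x \<in> Rsp n \<Longrightarrow> B *v x = (f \<circ> L) x"
  proof (rule block_matrix_extension[of "f \<circ> L" n])
    show "linear (f \<circ> L)" using L f(1) by (rule linear_compose)
    show "(f \<circ> L) x \<in> Rsp n" if "x \<in> Rsp n" for x using f(2) that by auto
    show "x = 0" if "x \<in> Rsp n" "(f \<circ> L) x = 0" for x using fn[OF that(1)] that L0 by simp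
  qed blast
  then show ?thesis using that[of B] fn by simp
qed

text \<open>Each canonical basis vector of \<open>Rsp n\<close> is \<open>B *v x\<close> for a point
  \<open>x\<close> of the body, so every diagonal entry in the trace is at most
  \<open>c\<close>.\<close>

lemma optimal_position_ell:
  fixes B :: "real ^ 'm::finite ^ 'm"
  assumes B: "rblock n B" "invertible B"
  shows "optimal_position (coord ` {..<n}) (Rsp n \<inter> ell B) B"
proof -
  have "(\<Sum>k\<in>coord ` {..<n}. S $ k $ k) \<le> card (coord ` {..<n} :: 'm set) * c"
    if S: "\<forall>x\<in>Rsp n \<inter> ell B. (B *v x) \<bullet> (S *v (B *v x)) \<le> c" for S and c :: real
  proof (rule sum_bounded_above)
    fix k :: 'm assume k: "k \<in> coord ` {..<n}"
    let ?x = "matrix_inv B *v axis k 1"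
    have Bx: "B *v ?x = axis k 1" using matrix_inv[OF B(2)] by (simp add: matrix_vector_mul_assoc)
    have "?x \<in> Rsp n" using k by (intro rblock_Rsp block_matrix_inv B) (auto intro: axis_in_Rsp)
    then have "?x \<in> Rsp n \<inter> ell B" by (simp add: ell_def Bx)
    then have "axis k 1 \<bullet> (S *v axis k 1) \<le> c" using S Bx by metis
    then show "S $ k $ k \<le> c" by (simp add: inner_axis' matrix_vector_mult_basis column_def)
  qed
  then show ?thesis using B by (simp add: optimal_position_def ell_def)
qed

text \<open>On a decomposable \<open>v\<close>, the vectors \<open>N *v v\<close> and
  \<open>transpose M *v v\<close> have inner product the squared norm of \<open>v\<close> because
  \<open>M ** N\<close> is the identity, and neither is longer than \<open>v\<close>. Hence they
  coincide, and decomposable vectors span.\<close>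

lemma orthogonal_if_transpose_contracts:
  fixes M N :: "real ^ 'm::finite ^ 'm"
  assumes card: "CARD('m) = (\<Prod>i<l. d i)" and MN: "M ** N = mat 1"
    and N: "\<And>w. (\<And>i. i < l \<Longrightarrow> w i \<in> Rsp (d i)) \<Longrightarrow> norm (N *v tensor l d w) = norm (tensor l d w)"
    and M: "\<And>w. (\<And>i. i < l \<Longrightarrow> w i \<in> Rsp (d i)) \<Longrightarrow> norm (transpose M *v tensor l d w) \<le> norm (tensor l d w)"
  shows "orthogonal_matrix M"
proof -
  have "N = transpose M"
  proof (rule matrix_eq_on_tensors[OF card])
    fix w :: "nat \<Rightarrow> real ^ 'm" assume w: "\<And>i. i < l \<Longrightarrow> w i \<in> Rsp (d i)"
    let ?v = "tensor l d w"
    have "(N *v ?v) \<bullet> (transpose M *v ?v) = (M *v (N *v ?v)) \<bullet> ?v"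
      by (simp only: inner_matrix_vector_right transpose_transpose)
    also have "\<dots> = (norm ?v)\<^sup>2"
      by (simp add: matrix_vector_mul_assoc MN power2_norm_eq_inner)
    finally have ip: "(N *v ?v) \<bullet> (transpose M *v ?v) = (norm ?v)\<^sup>2" .
    have "(norm (N *v ?v - transpose M *v ?v))\<^sup>2
        = (norm (N *v ?v))\<^sup>2 - 2 * ((N *v ?v) \<bullet> (transpose M *v ?v)) + (norm (transpose M *v ?v))\<^sup>2"
      unfolding power2_norm_eq_inner
      by (simp only: inner_diff_left inner_diff_right inner_commute[of "transpose M *v ?v" "N *v ?v"])
    also have "\<dots> \<le> (norm ?v)\<^sup>2 - 2 * (norm ?v)\<^sup>2 + (norm ?v)\<^sup>2"
    proof -
      have "norm (N *v ?v) = norm ?v" by (rule N) (rule w)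
      moreover have "(norm (transpose M *v ?v))\<^sup>2 \<le> (norm ?v)\<^sup>2"
        by (intro power_mono M w) auto
      ultimately show ?thesis unfolding ip by simp
    qed
    finally show "N *v ?v = transpose M *v ?v" by simp
  qed
  then show ?thesis
    using MN matrix_left_right_inverse[of M "transpose M"] by (simp add: orthogonal_matrix_def)
qed

text \<open>Sections of an ellipsoid are ellipsoids, so each \<open>P i\<close> is cut out by some
  \<open>ell (B i)\<close> and \<open>S\<close> can be compared with the Kronecker product of the
  \<open>B i\<close>. Equal gauges on decomposable vectors make \<open>N\<close> norm-preserving
  there; the upper inclusion, paired with polar vectors, makes \<open>transpose M\<close>
  contracting there.\<close>

proposition tensorial_ellipsoid_eq_Loewner:
  fixes S :: "(real ^ 'm::finite) set"
  assumes card: "CARD('m) = (\<Prod>i<l. d i)" and l: "l \<ge> 1" and d1: "\<And>i. i < l \<Longrightarrow> d i \<ge> 1"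
    and PS: "tensorial_wrt l d P S" and S: "ellipsoid S"
  shows "Loewner (proj_tensor l d P) = S"
proof -
  obtain A where A: "invertible A" "S = ell A" using S ellipsoid_iff[of S] by metis
  note assm = card l d1 PS
  let ?g = "\<lambda>i. dual_gauge (d i) (P i)" and ?a = "anchor l d S"
  have Ainj: "A *v u = 0 \<Longrightarrow> u = 0" for u
    using matrix_inv[OF A(1)] by (metis matrix_vector_mul_assoc matrix_vector_mul_lid matrix_vector_mult_0_right)
  have "\<exists>B. i < l \<longrightarrow> rblock (d i) B \<and> invertible B \<and> P i = Rsp (d i) \<inter> ell B" for i
  proof (cases "i < l")
    case i: True
    note body = tensorial_factor[OF assm i]
    define c where "c = ?g i (?a i)"
    have c: "c > 0" unfolding c_def by (rule anchor_gauge_pos[OF assm i])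
    \<comment> \<open>The factor \<open>c\<close> undoes the dilation of the section, so that
      \<open>norm (L x) \<le> 1\<close> describes \<open>P i\<close> itself.\<close>
    define L where "L x = c *\<^sub>R (A *v tensor l d (?a(i := x)))" for x
    have L: "linear L"
      unfolding L_def
      using linear_compose_scale_right[OF linear_compose[OF linear_tensor_update[OF i] matrix_vector_mul_linear]]
      by (simp add: o_def)
    have L0: "x = 0" if x: "x \<in> Rsp (d i)" "L x = 0" for x
    proof -
      have "tensor l d (?a(i := x)) = 0" using x(2) c Ainj by (simp add: L_def)
      moreover have "(?a(i := x)) j \<in> Rsp (d j)" if "j < l" for j
        using anchor_in_Rsp[OF assm that] x(1) by auto
      ultimately obtain j where j: "j < l" "(?a(i := x)) j = 0"
        using tensor_eq_0_iff[OF card, of "?a(i := x)"] by blast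
      have "?a j \<noteq> 0"
        using anchor_gauge_pos[OF assm j(1)] dual_gauge_scaleR[OF tensorial_factor[OF assm j(1)], of 0 0] by auto
      then show ?thesis using j by (auto split: if_splits)
    qed
    obtain B where B: "rblock (d i) B" "invertible B" "\<And>x. x \<in> Rsp (d i) \<Longrightarrow> norm (B *v x) = norm (L x)"
      using block_matrix_of_injective[OF L L0] by blast
    have "x \<in> P i \<longleftrightarrow> norm (B *v x) \<le> 1" if x: "x \<in> Rsp (d i)" for x
    proof -
      have "x \<in> P i \<longleftrightarrow> ?g i (c *\<^sub>R x) \<le> c"
        using c in_body_iff_dual_gauge[OF body x] by (simp add: dual_gauge_scaleR[OF body])
      also have "\<dots> \<longleftrightarrow> c *\<^sub>R x \<in> body_section l d S i"
        by (simp add: body_section_iff[OF assm i] Rsp_scaleR[OF x] c_def)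
      also have "\<dots> \<longleftrightarrow> norm (A *v tensor l d (?a(i := c *\<^sub>R x))) \<le> 1"
        by (simp add: body_section_def Rsp_scaleR[OF x] A(2) ell_def)
      also have "A *v tensor l d (?a(i := c *\<^sub>R x)) = L x"
        by (simp add: L_def tensor_scale[OF i] matrix_vector_mult_scaleR)
      finally show ?thesis using B(3)[OF x] by simp
    qed
    then have "P i = Rsp (d i) \<inter> ell B"
      using factor_subset_Rsp[OF assm i] by (auto simp: ell_def)
    then show ?thesis using B by blast
  qed blast
  then obtain B where B: "\<And>i. i < l \<Longrightarrow> rblock (d i) (B i)" "\<And>i. i < l \<Longrightarrow> invertible (B i)"
    "\<And>i. i < l \<Longrightarrow> P i = Rsp (d i) \<inter> ell (B i)" by metis
  let ?B = "tensor_matrix l d B"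
  have invB: "invertible ?B" using invertible_tensor_matrix[OF card B(1,2)] by blast
  have "optimal_position (coord ` {..<d i}) (P i) (B i)" if "i < l" for i
    unfolding B(3)[OF that] by (rule optimal_position_ell[OF B(1,2)[OF that]])
  then have Loew: "Loewner (proj_tensor l d P) = ell ?B"
    using Loewner_eq_ell[OF loewner_position_tensorial[OF assm]] by blast
  have PB: "tensorial_wrt l d P (ell ?B)"
  proof -
    have "proj_tensor l d P = proj_tensor l d (\<lambda>i. Rsp (d i) \<inter> ell (B i))"
      unfolding proj_tensor_def using B(3) by (intro arg_cong[of _ _ "\<lambda>D. convex hull D"]) auto
    moreover have "inj_tensor l d P = inj_tensor l d (\<lambda>i. Rsp (d i) \<inter> ell (B i))"
      unfolding inj_tensor_def proj_tensor_def using B(3)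
      by (intro arg_cong[of _ _ "\<lambda>D. polar UNIV (convex hull D)"]) auto
    ultimately show ?thesis
      using ell_tensor_matrix_tensorial[OF card B(1,2)] B(3) by (simp add: tensorial_wrt_def)
  qed
  have AB: "norm (A *v tensor l d x) = norm (?B *v tensor l d x)"
    if x: "\<And>i. i < l \<Longrightarrow> x i \<in> Rsp (d i)" for x
  proof -
    let ?u = "tensor l d x"
    have iff: "norm (A *v (c *\<^sub>R ?u)) \<le> 1 \<longleftrightarrow> norm (?B *v (c *\<^sub>R ?u)) \<le> 1" for c
    proof -
      define y where "y = x(0 := c *\<^sub>R x 0)"
      have y: "y i \<in> Rsp (d i)" if "i < l" for i using x[OF that] by (auto simp: y_def intro: Rsp_scaleR)
      have "tensor l d y = c *\<^sub>R ?u" using tensor_scale[of 0 l d x c "x 0"] l by (simp add: y_def)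
      moreover have "tensor l d y \<in> ell A \<longleftrightarrow> tensor l d y \<in> ell ?B"
        using tensor_in_tensorial_iff[OF assm y] tensor_in_tensorial_iff[OF card l d1 PB y] A(2) by simp
      ultimately show ?thesis by (simp add: ell_def)
    qed
    \<comment> \<open>Two nonnegative numbers are compared through the multiples that stay below
      one; adding \<open>e\<close> avoids dividing by zero.\<close>
    have le: "q \<le> p" if pq: "\<And>c. \<bar>c\<bar> * p \<le> 1 \<Longrightarrow> \<bar>c\<bar> * q \<le> 1" "p \<ge> 0" "q \<ge> 0" for p q :: real
    proof (rule field_le_epsilon)
      fix e :: real assume e: "e > 0"
      have "\<bar>inverse (p + e)\<bar> * q \<le> 1" using e that(2) by (intro pq(1)) (simp add: field_simps)
      then show "q \<le> p + e" using e that(2) by (simp add: field_simps)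
    qed
    have iff': "\<bar>c\<bar> * norm (A *v ?u) \<le> 1 \<longleftrightarrow> \<bar>c\<bar> * norm (?B *v ?u) \<le> 1" for c
      using iff[of c] by (simp only: matrix_vector_mult_scaleR norm_scaleR)
    show ?thesis
      by (rule antisym; rule le) (simp_all only: iff' norm_ge_zero)
  qed
  define M where "M = ?B ** matrix_inv A"
  define N where "N = A ** matrix_inv ?B"
  have MN: "M ** N = mat 1"
  proof -
    have "M ** N = ?B ** (matrix_inv A ** A) ** matrix_inv ?B" by (simp add: M_def N_def matrix_mul_assoc)
    then show ?thesis using matrix_inv[OF A(1)] matrix_inv[OF invB] by simp
  qed
  have "orthogonal_matrix M"
  proof (rule orthogonal_if_transpose_contracts[OF card MN])
    fix w :: "nat \<Rightarrow> real ^ 'm" assume w: "\<And>i. i < l \<Longrightarrow> w i \<in> Rsp (d i)"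
    let ?v = "tensor l d w"
    define x where "x i = matrix_inv (B i) *v w i" for i
    have x: "x i \<in> Rsp (d i)" "B i *v x i = w i" if "i < l" for i
      using B(1,2)[OF that] w[OF that] matrix_inv[OF B(2)[OF that]]
      by (auto simp: x_def matrix_vector_mul_assoc intro: rblock_Rsp block_matrix_inv)
    have Bx: "?B *v tensor l d x = ?v"
      using x by (simp add: tensor_matrix_tensor[OF card] cong: tensor_cong)
    then have "matrix_inv ?B *v ?v = tensor l d x"
      using matrix_inv[OF invB] by (metis matrix_vector_mul_assoc matrix_vector_mul_lid)
    then have "N *v ?v = A *v tensor l d x" by (simp add: N_def matrix_vector_mul_assoc[symmetric])
    then show "norm (N *v ?v) = norm ?v" using AB[of x] x(1) Bx by simp
    show "norm (transpose M *v ?v) \<le> norm ?v"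
    proof (cases "?v = 0 \<or> transpose M *v ?v = 0")
      case False
      have w0: "w i \<noteq> 0" if "i < l" for i using False that tensor_eq_0_iff[OF card w] by blast
      \<comment> \<open>\<open>z\<close> below is the point of \<open>S\<close> whose pairing with
        the tensor of the polar vectors \<open>y i\<close> equals
        \<open>norm (transpose M *v ?v) / norm ?v\<close>. The upper inclusion bounds this pairing
        by one.\<close>
      define q where "q = (1 / norm (transpose M *v ?v)) *\<^sub>R (transpose M *v ?v)"
      have q: "norm q = 1" using False by (simp add: q_def)
      define z where "z = matrix_inv A *v q"
      have "A *v z = q" using matrix_inv[OF A(1)] by (simp add: z_def matrix_vector_mul_assoc)
      then have zS: "z \<in> S" using q by (simp add: A(2) ell_def)
      define y where "y i = (1 / norm (w i)) *\<^sub>R (transpose (B i) *v w i)" for i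
      have "y i \<in> polar (Rsp (d i)) (P i)" if i: "i < l" for i
      proof -
        have "\<bar>x \<bullet> y i\<bar> \<le> 1" if "x \<in> P i" for x
        proof -
          have "norm (B i *v x) \<le> 1" using that B(3)[OF i] by (simp add: ell_def)
          have "x \<bullet> y i = ((B i *v x) \<bullet> w i) / norm (w i)"
            by (simp only: y_def inner_scaleR_right inner_matrix_vector_right transpose_transpose) simp
          moreover have "\<bar>(B i *v x) \<bullet> w i\<bar> \<le> 1 * norm (w i)"
            using Cauchy_Schwarz_ineq2 mult_right_mono[OF \<open>norm (B i *v x) \<le> 1\<close> norm_ge_zero] by (rule order_trans)
          ultimately show ?thesis using w0[OF i] by simp
        qed
        moreover have "y i \<in> Rsp (d i)"
          unfolding y_def using B(1)[OF i] w[OF i] by (intro Rsp_scaleR rblock_Rsp block_transpose)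
        ultimately show ?thesis by (simp add: polar_def)
      qed
      then have "tensor l d y \<in> proj_tensor l d (\<lambda>i. polar (Rsp (d i)) (P i))"
        by (rule tensor_in_proj_tensor)
      moreover have "z \<in> inj_tensor l d P" using zS tensorial_upper[OF assm] by blast
      ultimately have le: "\<bar>tensor l d y \<bullet> z\<bar> \<le> 1" by (auto simp: inj_tensor_def polar_def)
      have nv: "norm ?v = (\<Prod>i<l. norm (w i))" by (rule norm_tensor[OF card w])
      have "tensor l d y = (1 / norm ?v) *\<^sub>R tensor l d (\<lambda>i. transpose (B i) *v w i)"
        unfolding y_def tensor_scale_all nv by (simp add: prod_dividef)
      also have "tensor l d (\<lambda>i. transpose (B i) *v w i) = transpose ?B *v ?v"
        unfolding transpose_tensor_matrix by (rule tensor_matrix_tensor[OF card w, symmetric])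
      finally have "z \<bullet> tensor l d y = (z \<bullet> (transpose ?B *v ?v)) / norm ?v" by simp
      also have "z \<bullet> (transpose ?B *v ?v) = q \<bullet> (transpose M *v ?v)"
      proof -
        have "?B *v z = M *v q" by (simp add: z_def M_def matrix_vector_mul_assoc)
        then show ?thesis by (simp only: inner_matrix_vector_right transpose_transpose)
      qed
      also have "\<dots> = norm (transpose M *v ?v)"
        using False by (simp only: q_def inner_scaleR_left power2_norm_eq_inner[symmetric]) (simp add: power2_eq_square)
      finally show ?thesis using le False by (simp add: inner_commute field_simps)
    qed auto
  qed
  then have "ell (M ** A) = ell A" by (rule ell_orthogonal_mult)
  moreover have "M ** A = ?B" using matrix_inv[OF A(1)] by (simp add: M_def matrix_mul_assoc[symmetric])
  ultimately show ?thesis using Loew A(2) by simp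
qed

section \<open>Linear maps preserving decomposable vectors\<close>

definition parallel_vec :: "'a::real_vector \<Rightarrow> 'a \<Rightarrow> bool"
  where "parallel_vec u v \<longleftrightarrow> (\<exists>c. c \<noteq> 0 \<and> u = c *\<^sub>R v)"

lemma parallel_vec_refl: "parallel_vec u u"
  by (auto simp: parallel_vec_def intro: exI[of _ 1])

lemma parallel_vec_sym: "parallel_vec u v \<Longrightarrow> parallel_vec v u"
proof -
  assume "parallel_vec u v"
  then obtain c where "c \<noteq> 0" "u = c *\<^sub>R v" by (auto simp: parallel_vec_def)
  then have "v = inverse c *\<^sub>R u" by simp
  then show ?thesis using \<open>c \<noteq> 0\<close> unfolding parallel_vec_def by (intro exI[of _ "inverse c"]) simp
qed

lemma parallel_vec_trans: "parallel_vec u v \<Longrightarrow> parallel_vec v w \<Longrightarrow> parallel_vec u w"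
  unfolding parallel_vec_def by (metis mult_eq_0_iff scaleR_scaleR)

lemma parallel_vec_if_combination:
  assumes "a *\<^sub>R u = b *\<^sub>R v" "b \<noteq> 0" "u \<noteq> 0" "v \<noteq> 0"
  shows "parallel_vec u v"
proof -
  have "a \<noteq> 0" using assms by auto
  have "inverse a *\<^sub>R (a *\<^sub>R u) = inverse a *\<^sub>R (b *\<^sub>R v)" using assms(1) by simp
  with \<open>a \<noteq> 0\<close> have "u = (b / a) *\<^sub>R v" by (simp add: divide_inverse mult.commute)
  then show ?thesis using \<open>a \<noteq> 0\<close> assms(2) unfolding parallel_vec_def by (intro exI[of _ "b / a"]) simp
qed

lemma exists_orthogonal_witness:
  fixes x y :: "'a::real_inner"
  assumes E: "subspace E" "x \<in> E" "y \<in> E" and nz: "x \<noteq> 0" "y \<noteq> 0" and np: "\<not> parallel_vec x y"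
  obtains u where "u \<in> E" "x \<bullet> u = 0" "y \<bullet> u \<noteq> 0"
proof -
  define u where "u = y - ((x \<bullet> y) / (x \<bullet> x)) *\<^sub>R x"
  have xu: "x \<bullet> u = 0" using nz by (simp add: u_def inner_diff_right)
  have "u \<noteq> 0"
  proof
    assume "u = 0"
    then have "((x \<bullet> y) / (x \<bullet> x)) *\<^sub>R x = 1 *\<^sub>R y" by (simp add: u_def)
    then show False using parallel_vec_if_combination nz np by (metis zero_neq_one)
  qed
  moreover have "y \<bullet> u = u \<bullet> u"
  proof -
    have "y = u + ((x \<bullet> y) / (x \<bullet> x)) *\<^sub>R x" by (simp add: u_def)
    then have "y \<bullet> u = u \<bullet> u + ((x \<bullet> y) / (x \<bullet> x)) * (x \<bullet> u)" by (metis inner_add_left inner_scaleR_left)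
    then show ?thesis by (simp add: xu)
  qed
  moreover have "u \<in> E" unfolding u_def by (intro subspace_diff subspace_scale E)
  ultimately show ?thesis using that[of u] xu by simp
qed

definition nonzero_tuple :: "nat \<Rightarrow> (nat \<Rightarrow> nat) \<Rightarrow> (nat \<Rightarrow> real ^ 'm::finite) \<Rightarrow> bool"
  where "nonzero_tuple l d x \<longleftrightarrow> (\<forall>i<l. x i \<in> Rsp (d i) \<and> x i \<noteq> 0)"

lemma nonzero_tuple_upd:
  "nonzero_tuple l d x \<Longrightarrow> v \<in> Rsp (d i) \<Longrightarrow> v \<noteq> 0 \<Longrightarrow> nonzero_tuple l d (x(i := v))"
  by (simp add: nonzero_tuple_def)

text \<open>Induction principle: every nonzero tuple is reached from \<open>b\<close> by changing
  one slot at a time through nonzero tuples. Tuples are functions on all naturals, and the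
  congruence hypothesis disregards the values from \<open>l\<close> on.\<close>

lemma nonzero_tuple_path:
  assumes step: "\<And>x k w. nonzero_tuple l d x \<Longrightarrow> k < l \<Longrightarrow> w \<in> Rsp (d k) \<Longrightarrow> w \<noteq> 0 \<Longrightarrow> \<Phi> x \<Longrightarrow> \<Phi> (x(k := w))"
    and cong: "\<And>x y. (\<And>i. i < l \<Longrightarrow> x i = y i) \<Longrightarrow> \<Phi> x \<Longrightarrow> \<Phi> y"
    and "nonzero_tuple l d b" "nonzero_tuple l d x" "\<Phi> b"
  shows "\<Phi> x"
proof -
  let ?y = "\<lambda>k j. if j < k then x j else b j"
  have "\<Phi> (?y k)" if "k \<le> l" for k
    using that
  proof (induction k)
    case 0
    then show ?case using assms(5) by simp
  next
    case (Suc k)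
    then have "\<Phi> (?y k)" and k: "k < l" by auto
    moreover have "nonzero_tuple l d (?y k)" using assms(3,4) by (simp add: nonzero_tuple_def)
    ultimately have "\<Phi> ((?y k)(k := x k))" using step assms(4) by (simp add: nonzero_tuple_def)
    moreover have "(?y k)(k := x k) = ?y (Suc k)" by (auto simp: fun_eq_iff less_Suc_eq)
    ultimately show ?case by simp
  qed
  from this[of l] show ?thesis by (rule cong[rotated]) auto
qed

context
  fixes l :: nat and d :: "nat \<Rightarrow> nat"
  assumes card: "CARD('m::finite) = (\<Prod>i<l. d i)" and l: "l \<ge> 1" and d2: "\<And>i. i < l \<Longrightarrow> d i \<ge> 2"
begin

abbreviation "nonzero \<equiv> nonzero_tuple l d :: (nat \<Rightarrow> real ^ 'm) \<Rightarrow> bool"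
abbreviation "tens \<equiv> tensor l d :: (nat \<Rightarrow> real ^ 'm) \<Rightarrow> real ^ 'm"

lemma nonzero_Rsp: "nonzero x \<Longrightarrow> i < l \<Longrightarrow> x i \<in> Rsp (d i)"
  and nonzero_nonzero: "nonzero x \<Longrightarrow> i < l \<Longrightarrow> x i \<noteq> 0"
  by (auto simp: nonzero_tuple_def)

lemma tens_nonzero: "nonzero x \<Longrightarrow> tens x \<noteq> 0"
  using tensor_eq_0_iff[OF card, of x] by (auto simp: nonzero_tuple_def)

lemma inner_tensor_upd:
  assumes i: "i < l" and x: "\<And>j. j < l \<Longrightarrow> x j \<in> Rsp (d j)"
  shows "tens x \<bullet> tens (y(i := w)) = (\<Prod>j\<in>{..<l} - {i}. x j \<bullet> y j) * (x i \<bullet> w)"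
proof -
  have "tens x \<bullet> tens (y(i := w)) = (\<Prod>j<l. x j \<bullet> (y(i := w)) j)" by (rule inner_tensor[OF card x])
  also have "\<dots> = (x i \<bullet> w) * (\<Prod>j\<in>{..<l} - {i}. x j \<bullet> (y(i := w)) j)"
    using i by (subst prod.remove[of _ i]) auto
  also have "(\<Prod>j\<in>{..<l} - {i}. x j \<bullet> (y(i := w)) j) = (\<Prod>j\<in>{..<l} - {i}. x j \<bullet> y j)"
    by (rule prod.cong) auto
  finally show ?thesis by (simp only: mult.commute)
qed

lemma inner_tensor_upd2:
  assumes pq: "p < l" "q < l" "p \<noteq> q" and x: "\<And>j. j < l \<Longrightarrow> x j \<in> Rsp (d j)"
  shows "tens x \<bullet> tens (y(p := u, q := v)) = (\<Prod>j\<in>{..<l} - {p, q}. x j \<bullet> y j) * (x p \<bullet> u) * (x q \<bullet> v)"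
proof -
  have "tens x \<bullet> tens (y(p := u, q := v)) = (\<Prod>j\<in>{..<l} - {q}. x j \<bullet> (y(p := u)) j) * (x q \<bullet> v)"
    by (rule inner_tensor_upd[OF pq(2) x])
  also have "(\<Prod>j\<in>{..<l} - {q}. x j \<bullet> (y(p := u)) j) = (x p \<bullet> u) * (\<Prod>j\<in>{..<l} - {q} - {p}. x j \<bullet> (y(p := u)) j)"
    using pq by (subst prod.remove[of _ p]) auto
  also have "(\<Prod>j\<in>{..<l} - {q} - {p}. x j \<bullet> (y(p := u)) j) = (\<Prod>j\<in>{..<l} - {p, q}. x j \<bullet> y j)"
    by (rule prod.cong) auto
  finally show ?thesis by (simp only: mult.commute mult.left_commute)
qed

lemma inner_eq_on_Rsp:
  assumes "x \<in> Rsp n" "y \<in> Rsp n" and eq: "\<And>w. w \<in> Rsp n \<Longrightarrow> x \<bullet> w = y \<bullet> w"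
  shows "x = (y :: real ^ 'm)"
proof -
  have "(x - y) \<bullet> (x - y) = 0"
    using eq[OF subspace_diff[OF subspace_Rsp assms(1,2)]] by (simp add: inner_diff_left)
  then show ?thesis by simp
qed

text \<open>Contracting every slot but \<open>i\<close> with the factors of \<open>y\<close> leaves
  multiples of \<open>x i\<close> and \<open>y i\<close>, the second with a nonzero coefficient:
  \<open>c\<close> times a product of squared norms.\<close>

lemma tensor_factors_unique:
  assumes x: "nonzero x" and y: "nonzero y" and eq: "tens x = c *\<^sub>R tens y" and i: "i < l"
  shows "parallel_vec (x i) (y i)"
proof -
  have c: "c \<noteq> 0" using eq tens_nonzero[OF x] by auto
  let ?\<alpha> = "\<Prod>j\<in>{..<l} - {i}. x j \<bullet> y j" and ?\<beta> = "c * (\<Prod>j\<in>{..<l} - {i}. y j \<bullet> y j)"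
  have "?\<beta> \<noteq> 0" using c nonzero_nonzero[OF y] by simp
  moreover have "?\<alpha> *\<^sub>R x i = ?\<beta> *\<^sub>R y i"
  proof (rule inner_eq_on_Rsp)
    show "?\<alpha> *\<^sub>R x i \<in> Rsp (d i)" "?\<beta> *\<^sub>R y i \<in> Rsp (d i)"
      using x y i by (auto intro: Rsp_scaleR nonzero_Rsp)
    fix w :: "real ^ 'm"
    have "tens x \<bullet> tens (y(i := w)) = c * (tens y \<bullet> tens (y(i := w)))" by (simp add: eq)
    then show "(?\<alpha> *\<^sub>R x i) \<bullet> w = (?\<beta> *\<^sub>R y i) \<bullet> w"
      using inner_tensor_upd[OF i nonzero_Rsp[OF x], of y w] inner_tensor_upd[OF i nonzero_Rsp[OF y], of y w]
      by (simp add: mult.assoc)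
  qed
  ultimately show ?thesis
    using parallel_vec_if_combination nonzero_nonzero[OF x i] nonzero_nonzero[OF y i] by blast
qed

text \<open>Contracting all slots but two reduces this to a sum of two matrices of rank one.\<close>

lemma decomposable_sum_one_slot:
  assumes x: "nonzero x" and y: "nonzero y" and z: "\<And>j. j < l \<Longrightarrow> z j \<in> Rsp (d j)"
    and sum: "tens x + tens y = tens z"
    and pq: "p < l" "q < l" "p \<noteq> q" and np: "\<not> parallel_vec (x p) (y p)"
  shows "parallel_vec (x q) (y q)"
proof -
  \<comment> \<open>A vector orthogonal to neither \<open>x j\<close> nor \<open>y j\<close>, so
    that contracting the remaining slots loses neither summand.\<close>
  define w where "w j = (if x j \<bullet> y j = 0 then x j + y j else x j)" for j
  have w: "x j \<bullet> w j \<noteq> 0" "y j \<bullet> w j \<noteq> 0" if "j < l" for j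
    using nonzero_nonzero[OF x that] nonzero_nonzero[OF y that]
    by (auto simp: w_def inner_add_right inner_commute)
  let ?I = "{..<l} - {p, q}"
  define A where "A = (\<Prod>j\<in>?I. x j \<bullet> w j)"
  define B where "B = (\<Prod>j\<in>?I. y j \<bullet> w j)"
  define C where "C = (\<Prod>j\<in>?I. z j \<bullet> w j)"
  have AB: "A \<noteq> 0" "B \<noteq> 0" using w by (auto simp: A_def B_def)
  have key: "(A * (x p \<bullet> u)) *\<^sub>R x q + (B * (y p \<bullet> u)) *\<^sub>R y q = (C * (z p \<bullet> u)) *\<^sub>R z q" for u
  proof (rule inner_eq_on_Rsp)
    show "(A * (x p \<bullet> u)) *\<^sub>R x q + (B * (y p \<bullet> u)) *\<^sub>R y q \<in> Rsp (d q)" "(C * (z p \<bullet> u)) *\<^sub>R z q \<in> Rsp (d q)"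
      using nonzero_Rsp[OF x pq(2)] nonzero_Rsp[OF y pq(2)] z[OF pq(2)] by (auto intro: Rsp_scaleR Rsp_add)
    fix v :: "real ^ 'm"
    have "tens x \<bullet> tens (w(p := u, q := v)) + tens y \<bullet> tens (w(p := u, q := v)) = tens z \<bullet> tens (w(p := u, q := v))"
      by (simp add: sum[symmetric] inner_add_left)
    then show "((A * (x p \<bullet> u)) *\<^sub>R x q + (B * (y p \<bullet> u)) *\<^sub>R y q) \<bullet> v = ((C * (z p \<bullet> u)) *\<^sub>R z q) \<bullet> v"
      using inner_tensor_upd2[OF pq nonzero_Rsp[OF x], of w u v] inner_tensor_upd2[OF pq nonzero_Rsp[OF y], of w u v]
        inner_tensor_upd2[OF pq z, of w u v]
      by (simp add: A_def B_def C_def inner_add_left)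
  qed
  note xp = nonzero_Rsp[OF x pq(1)] nonzero_nonzero[OF x pq(1)] and yp = nonzero_Rsp[OF y pq(1)] nonzero_nonzero[OF y pq(1)]
  \<comment> \<open>Contracting slot \<open>p\<close> with a vector orthogonal to \<open>x p\<close>
    but not to \<open>y p\<close> leaves only the \<open>y\<close> summand, so \<open>z q\<close> is
    parallel to \<open>y q\<close>; then the roles are exchanged.\<close>
  obtain u where u: "x p \<bullet> u = 0" "y p \<bullet> u \<noteq> 0"
    using exists_orthogonal_witness[OF subspace_Rsp xp(1) yp(1) xp(2) yp(2) np] by blast
  obtain u' where u': "y p \<bullet> u' = 0" "x p \<bullet> u' \<noteq> 0"
    using exists_orthogonal_witness[OF subspace_Rsp yp(1) xp(1) yp(2) xp(2)] np parallel_vec_sym by blast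
  have yq: "(C * (z p \<bullet> u)) *\<^sub>R z q = (B * (y p \<bullet> u)) *\<^sub>R y q" using key[of u] u by simp
  have xq: "(C * (z p \<bullet> u')) *\<^sub>R z q = (A * (x p \<bullet> u')) *\<^sub>R x q" using key[of u'] u' by simp
  have zq: "z q \<noteq> 0" using yq AB u nonzero_nonzero[OF y pq(2)] by auto
  have "parallel_vec (z q) (y q)" "parallel_vec (z q) (x q)"
    using parallel_vec_if_combination[OF yq] parallel_vec_if_combination[OF xq] AB u u' zq
      nonzero_nonzero[OF y pq(2)] nonzero_nonzero[OF x pq(2)] by auto
  then show ?thesis using parallel_vec_sym parallel_vec_trans by blast
qed

text \<open>Dimension at least two enters here: a vector cannot be parallel to two different
  axes.\<close>

lemma exists_not_parallel:
  assumes i: "i < l" and v: "v \<noteq> 0"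
  obtains w where "w \<in> Rsp (d i)" "w \<noteq> 0" "\<not> parallel_vec (v :: real ^ 'm) w"
proof -
  let ?e = "\<lambda>k. axis (coord k) 1 :: real ^ 'm"
  have "(coord 0 :: 'm) \<noteq> coord 1"
    using inj_on_coord[OF dim_le_card[OF card i]] d2[OF i] unfolding inj_on_def
    by (metis lessThan_iff less_le_trans one_less_numeral_iff pos2 semiring_norm(76) zero_neq_one)
  then have "\<not> parallel_vec (?e 0) (?e 1)"
    by (auto simp: parallel_vec_def vec_eq_iff axis_def)
  then have "\<not> (parallel_vec v (?e 0) \<and> parallel_vec v (?e 1))"
    using parallel_vec_sym parallel_vec_trans by blast
  moreover have "?e 0 \<in> Rsp (d i)" "?e 1 \<in> Rsp (d i)" "?e 0 \<noteq> 0" "?e 1 \<noteq> 0"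
    using d2[OF i] by (auto intro: axis_in_Rsp simp: axis_eq_0_iff)
  ultimately show ?thesis using that by blast
qed

section \<open>Images of decomposable vectors under an isomorphism that preserves them\<close>

context
  fixes T :: "real ^ 'm \<Rightarrow> real ^ 'm"
  assumes T: "T \<in> GL_tensor l d"
begin

lemma GL_facts: "linear T" "bij T" "decomposable l d u \<Longrightarrow> decomposable l d (T u)"
  using T by (auto simp: GL_tensor_def)

lemma GL_zero: "T u = 0 \<Longrightarrow> u = 0"
  using GL_facts(1,2) by (metis bij_is_inj injD linear_0)

text \<open>A chosen factorisation of the image. It is a function of the tensor and not of the
  tuple, so tuples with the same tensor get the same factors. Factors are determined only up to
  scalars, hence the comparison by parallelism in \<open>agree\<close>.\<close>

definition img :: "real ^ 'm \<Rightarrow> nat \<Rightarrow> real ^ 'm"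
  where "img u = (SOME y. nonzero y \<and> T u = tens y)"

lemma img:
  assumes x: "nonzero x"
  shows "nonzero (img (tens x))" "T (tens x) = tens (img (tens x))"
proof -
  have "decomposable l d (tens x)" using nonzero_Rsp[OF x] by (auto simp: decomposable_def)
  then obtain y where y: "\<forall>i<l. y i \<in> Rsp (d i)" "T (tens x) = tens y"
    using GL_facts(3) unfolding decomposable_def by metis
  have "tens y \<noteq> 0" using GL_zero[of "tens x"] tens_nonzero[OF x] y(2) by auto
  then have "nonzero y" using y(1) tensor_eq_0_iff[OF card, of y] by (auto simp: nonzero_tuple_def)
  then have "nonzero (img (tens x)) \<and> T (tens x) = tens (img (tens x))"
    unfolding img_def using y(2) by (intro someI[of "\<lambda>y'. nonzero y' \<and> T (tens x) = tens y'" y]) simp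
  then show "nonzero (img (tens x))" "T (tens x) = tens (img (tens x))" by auto
qed

definition agree :: "nat \<Rightarrow> (nat \<Rightarrow> real ^ 'm) \<Rightarrow> (nat \<Rightarrow> real ^ 'm) \<Rightarrow> bool"
  where "agree s x y \<longleftrightarrow> parallel_vec (img (tens x) s) (img (tens y) s)"

lemma agree_refl: "agree s x x"
  and agree_sym: "agree s x y \<Longrightarrow> agree s y x"
  and agree_trans: "agree s x y \<Longrightarrow> agree s y z \<Longrightarrow> agree s x z"
  unfolding agree_def by (blast intro: parallel_vec_refl parallel_vec_sym parallel_vec_trans)+

lemma agree_upd_parallel:
  assumes x: "nonzero x" and i: "i < l" and w: "w \<in> Rsp (d i)" "w \<noteq> 0" "parallel_vec (x i) w" and s: "s < l"
  shows "agree s x (x(i := w))"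
proof -
  obtain c where c: "c \<noteq> 0" "x i = c *\<^sub>R w" using w(3) by (auto simp: parallel_vec_def)
  have "tens x = c *\<^sub>R tens (x(i := w))" using tensor_scale[OF i, of d x c w] c(2) by (metis fun_upd_triv)
  then have "T (tens x) = c *\<^sub>R T (tens (x(i := w)))" using linear_cmul[OF GL_facts(1)] by simp
  then have "tens (img (tens x)) = c *\<^sub>R tens (img (tens (x(i := w))))"
    by (simp only: img(2)[OF x] img(2)[OF nonzero_tuple_upd[OF x w(1,2)]])
  then show ?thesis
    unfolding agree_def
    by (rule tensor_factors_unique[OF img(1)[OF x] img(1)[OF nonzero_tuple_upd[OF x w(1,2)]] _ s])
qed

text \<open>Images parallel in every slot would be proportional, and by injectivity so would the
  original tensors, against the uniqueness of factors.\<close>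

lemma not_all_agree:
  assumes x: "nonzero x" and y: "nonzero y" and i: "i < l" "\<not> parallel_vec (x i) (y i)"
  shows "\<exists>s<l. \<not> agree s x y"
proof (rule ccontr)
  assume "\<not> (\<exists>s<l. \<not> agree s x y)"
  then have "\<exists>c. s < l \<longrightarrow> c \<noteq> 0 \<and> img (tens x) s = c *\<^sub>R img (tens y) s" for s
    by (auto simp: agree_def parallel_vec_def)
  then obtain c where c: "\<And>s. s < l \<Longrightarrow> img (tens x) s = c s *\<^sub>R img (tens y) s" by metis
  have "T (tens x) = tens (\<lambda>s. c s *\<^sub>R img (tens y) s)"
    unfolding img(2)[OF x] using c by (rule tensor_cong)
  also have "\<dots> = T ((\<Prod>s<l. c s) *\<^sub>R tens y)"
    by (simp add: tensor_scale_all img(2)[OF y] linear_cmul[OF GL_facts(1)])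
  finally have "tens x = (\<Prod>s<l. c s) *\<^sub>R tens y" using GL_facts(2) by (metis bij_is_inj injD)
  then show False using tensor_factors_unique[OF x y _ i(1)] i(2) by blast
qed

text \<open>Tuples that differ in one slot have a decomposable sum of tensors. So have their images,
  and then at most one slot can fail to be parallel.\<close>

lemma differ_upd_unique:
  assumes x: "nonzero x" and i: "i < l" and w: "w \<in> Rsp (d i)" "w \<noteq> 0"
    and pq: "p < l" "q < l" "\<not> agree p x (x(i := w))" "\<not> agree q x (x(i := w))"
  shows "p = q"
proof (rule ccontr)
  assume "p \<noteq> q"
  let ?y = "x(i := w)"
  have y: "nonzero ?y" by (rule nonzero_tuple_upd[OF x w])
  have "tens x + tens ?y = tens (x(i := x i + w))"
    using tensor_add[OF i, of d x "x i" w] by simp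
  moreover have "decomposable l d (tens (x(i := x i + w)))"
    unfolding decomposable_def using nonzero_Rsp[OF x] w(1) by (intro exI[of _ "x(i := x i + w)"]) (auto intro: Rsp_add)
  ultimately have "decomposable l d (T (tens x) + T (tens ?y))"
    using GL_facts(3) linear_add[OF GL_facts(1)] by metis
  then obtain z where z: "\<And>j. j < l \<Longrightarrow> z j \<in> Rsp (d j)" "tens (img (tens x)) + tens (img (tens ?y)) = tens z"
    unfolding decomposable_def img(2)[OF x] img(2)[OF y] by blast
  show False
    using decomposable_sum_one_slot[OF img(1)[OF x] img(1)[OF y] z pq(1,2) \<open>p \<noteq> q\<close>] pq(3,4)
    by (simp add: agree_def)
qed

text \<open>\<open>slot x i s\<close>: moving the \<open>i\<close>-th factor of \<open>x\<close> moves only the \<open>s\<close>-th factor of the image, up to scalars.\<close>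

definition slot :: "(nat \<Rightarrow> real ^ 'm) \<Rightarrow> nat \<Rightarrow> nat \<Rightarrow> bool"
  where "slot x i s \<longleftrightarrow> (\<forall>v t. v \<in> Rsp (d i) \<longrightarrow> v \<noteq> 0 \<longrightarrow> t < l \<longrightarrow> t \<noteq> s \<longrightarrow> agree t x (x(i := v)))"

lemma slot_exists:
  assumes x: "nonzero x" and i: "i < l"
  obtains s where "s < l" "slot x i s"
proof -
  obtain v0 where v0: "v0 \<in> Rsp (d i)" "v0 \<noteq> 0" "\<not> parallel_vec (x i) v0"
    using exists_not_parallel[OF i nonzero_nonzero[OF x i]] by blast
  note nz0 = nonzero_tuple_upd[OF x v0(1,2)]
  obtain s where s: "s < l" "\<not> agree s x (x(i := v0))"
    using not_all_agree[OF x nz0 i] v0(3) by auto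
  have "agree t x (x(i := v))" if v: "v \<in> Rsp (d i)" "v \<noteq> 0" and t: "t < l" "t \<noteq> s" for v t
  proof (rule ccontr)
    assume nt: "\<not> agree t x (x(i := v))"
    have t0: "agree t x (x(i := v0))" using differ_upd_unique[OF x i v0(1,2) t(1) s(1)] s(2) t(2) by blast
    have sv: "agree s x (x(i := v))" using differ_upd_unique[OF x i v t(1) s(1) nt] t(2) by blast
    \<comment> \<open>Passing from \<open>v0\<close> to \<open>v\<close> directly would change both
      slots \<open>s\<close> and \<open>t\<close>.\<close>
    have "\<not> agree t (x(i := v0)) ((x(i := v0))(i := v))" "\<not> agree s (x(i := v0)) ((x(i := v0))(i := v))"
      using nt t0 sv s(2) agree_trans agree_sym by (metis fun_upd_upd)+
    then show False using differ_upd_unique[OF nz0 i v t(1) s(1)] t(2) by blast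
  qed
  then show ?thesis using that[OF s(1)] by (simp add: slot_def)
qed

lemma slot_differs:
  assumes x: "nonzero x" and i: "i < l" and v: "v \<in> Rsp (d i)" "v \<noteq> 0" "\<not> parallel_vec (x i) v" and s: "slot x i s"
  shows "\<not> agree s x (x(i := v))"
  using not_all_agree[OF x nonzero_tuple_upd[OF x v(1,2)] i] v s unfolding slot_def by auto

text \<open>
  If the slot changed, the four images of a square (two values in each of two slots) would contain two
  that differ in no slot.
\<close>

lemma slot_upd:
  assumes x: "nonzero x" and i: "i < l" and s: "slot x i s" "s < l" and k: "k < l" and w: "w \<in> Rsp (d k)" "w \<noteq> 0"
  shows "slot (x(k := w)) i s"
proof (cases "k = i")
  case True
  show ?thesis
    unfolding slot_def
  proof (intro allI impI)
    fix v :: "real ^ 'm" and t assume v: "v \<in> Rsp (d i)" "v \<noteq> 0" "t < l" "t \<noteq> s"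
    have "agree t x (x(i := w))" "agree t x (x(i := v))"
      using s(1) v w True unfolding slot_def by blast+
    then show "agree t (x(k := w)) ((x(k := w))(i := v))"
      using agree_trans agree_sym True by (metis fun_upd_upd)
  qed
next
  case ki: False
  let ?C = "x(k := w)"
  have C: "nonzero ?C" by (rule nonzero_tuple_upd[OF x w])
  show ?thesis
  proof (cases "parallel_vec (x k) w")
    case True
    show ?thesis
      unfolding slot_def
    proof (intro allI impI)
      fix v :: "real ^ 'm" and t assume v: "v \<in> Rsp (d i)" "v \<noteq> 0" "t < l" "t \<noteq> s"
      have B: "nonzero (x(i := v))" by (rule nonzero_tuple_upd[OF x v(1,2)])
      have "agree t x ?C" by (rule agree_upd_parallel[OF x k w True v(3)])
      moreover have "agree t (x(i := v)) ((x(i := v))(k := w))"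
        using True ki by (intro agree_upd_parallel[OF B k w _ v(3)]) simp
      moreover have "agree t x (x(i := v))" using s(1) v unfolding slot_def by blast
      ultimately show "agree t ?C (?C(i := v))"
        using agree_trans agree_sym ki by (metis fun_upd_twist)
    qed
  next
    case npw: False
    obtain s' where s': "s' < l" "slot ?C i s'" by (rule slot_exists[OF C i])
    obtain v where v: "v \<in> Rsp (d i)" "v \<noteq> 0" "\<not> parallel_vec (x i) v"
      using exists_not_parallel[OF i nonzero_nonzero[OF x i]] by blast
    \<comment> \<open>The square has corners \<open>x\<close>, \<open>?B\<close>, \<open>?C\<close>
      and \<open>?E\<close>. Its two sides that vary slot \<open>i\<close> change exactly the image
      slots \<open>s\<close> and \<open>s'\<close>; the two that vary slot \<open>k\<close> change
      at most \<open>a\<close> and \<open>b\<close>.\<close>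
    let ?B = "x(i := v)" and ?E = "x(k := w, i := v)"
    have B: "nonzero ?B" by (rule nonzero_tuple_upd[OF x v(1,2)])
    have E: "nonzero ?E" by (rule nonzero_tuple_upd[OF C v(1,2)])
    have E': "?E = ?B(k := w)" using ki by (simp add: fun_upd_twist)
    obtain a where a: "a < l" "slot x k a" by (rule slot_exists[OF x k])
    obtain b where b: "b < l" "slot ?B k b" by (rule slot_exists[OF B k])
    have AB: "\<not> agree s x ?B" "\<And>t. t < l \<Longrightarrow> t \<noteq> s \<Longrightarrow> agree t x ?B"
      using slot_differs[OF x i v s(1)] s(1) v unfolding slot_def by blast+
    have CE: "\<not> agree s' ?C ?E" "\<And>t. t < l \<Longrightarrow> t \<noteq> s' \<Longrightarrow> agree t ?C ?E"
      using slot_differs[OF C i v(1,2) _ s'(2)] s'(2) v ki unfolding slot_def by auto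
    have AC: "\<And>t. t < l \<Longrightarrow> t \<noteq> a \<Longrightarrow> agree t x ?C"
      using a(2) w unfolding slot_def by blast
    have BE: "\<And>t. t < l \<Longrightarrow> t \<noteq> b \<Longrightarrow> agree t ?B ?E"
      using b(2) w unfolding slot_def E' by blast
    have AE: "\<exists>t<l. \<not> agree t x ?E" using v(3) by (intro not_all_agree[OF x E i]) simp
    have BC: "\<exists>t<l. \<not> agree t ?B ?C"
      using v(3) ki by (intro not_all_agree[OF B C i]) (auto dest: parallel_vec_sym)
    have "s = s'"
    proof (rule ccontr)
      assume ss: "s \<noteq> s'"
      \<comment> \<open>Slot \<open>s\<close> changes from \<open>x\<close> to \<open>?B\<close> but
        not from \<open>?C\<close> to \<open>?E\<close>, so one of the other two sides must change
        it; likewise for \<open>s'\<close>. This forces \<open>a\<close> and \<open>b\<close> to be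
        \<open>s\<close> and \<open>s'\<close> in some order, and then the ends of one diagonal
        agree everywhere.\<close>
      have "a = s \<or> b = s"
        using AB(1) AC[OF s(2)] CE(2)[OF s(2) ss] BE[OF s(2)] agree_trans agree_sym by metis
      moreover have "a = s' \<or> b = s'"
        using CE(1) AC[OF s'(1)] AB(2)[OF s'(1)] BE[OF s'(1)] ss agree_trans agree_sym by metis
      ultimately consider "a = s" "b = s'" | "a = s'" "b = s" using ss by blast
      then show False
      proof cases
        case 1
        have "agree t ?B ?C" if t: "t < l" for t
        proof (cases "t = s")
          case True
          then show ?thesis using BE[OF t] CE(2)[OF t] 1 ss agree_trans agree_sym by metis
        next
          case False
          then show ?thesis using AB(2)[OF t] AC[OF t] 1 agree_trans agree_sym by metis
        qed
        then show False using BC by blast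
      next
        case 2
        have "agree t x ?E" if t: "t < l" for t
        proof (cases "t = s")
          case True
          then show ?thesis using AC[OF t] CE(2)[OF t] 2 ss agree_trans by metis
        next
          case False
          then show ?thesis using AB(2)[OF t] BE[OF t] 2 agree_trans by metis
        qed
        then show False using AE by blast
      qed
    qed
    then show ?thesis using s' by simp
  qed
qed

lemma slot_cong: "(\<And>i. i < l \<Longrightarrow> x i = y i) \<Longrightarrow> slot x i s \<Longrightarrow> slot y i s"
proof -
  assume eq: "\<And>i. i < l \<Longrightarrow> x i = y i" and s: "slot x i s"
  have "tens x = tens y" using eq by (rule tensor_cong)
  moreover have "tens (x(i := v)) = tens (y(i := v))" for v
    by (rule tensor_cong) (simp add: eq)
  ultimately show ?thesis using s by (simp add: slot_def agree_def)
qed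

lemma nonzero_e1: "nonzero (\<lambda>_. e1)"
  unfolding nonzero_tuple_def e1_def
proof (intro allI impI conjI)
  fix i assume "i < l"
  then show "axis (coord 0) 1 \<in> Rsp (d i)" using d2[of i] by (intro axis_in_Rsp) simp
qed (simp add: axis_eq_0_iff)

lemma slot_map_exists:
  obtains \<tau> where "\<And>i. i < l \<Longrightarrow> \<tau> i < l" "\<And>x i. nonzero x \<Longrightarrow> i < l \<Longrightarrow> slot x i (\<tau> i)"
proof -
  note b = nonzero_e1
  have "\<exists>s. i < l \<longrightarrow> s < l \<and> slot (\<lambda>_. e1) i s" for i
    by (cases "i < l") (use slot_exists[OF b] in blast)+
  then obtain \<tau> where \<tau>: "\<And>i. i < l \<Longrightarrow> \<tau> i < l" "\<And>i. i < l \<Longrightarrow> slot (\<lambda>_. e1) i (\<tau> i)" by metis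
  have "slot x i (\<tau> i)" if x: "nonzero x" and i: "i < l" for x i
  proof (rule nonzero_tuple_path[of l d "\<lambda>x. slot x i (\<tau> i)", OF _ _ b x \<tau>(2)[OF i]])
    fix x :: "nat \<Rightarrow> real ^ 'm" and k and w :: "real ^ 'm"
    assume "nonzero x" "k < l" "w \<in> Rsp (d k)" "w \<noteq> 0" "slot x i (\<tau> i)"
    then show "slot (x(k := w)) i (\<tau> i)" using slot_upd[OF _ i _ \<tau>(1)[OF i]] by blast
  next
    fix x y :: "nat \<Rightarrow> real ^ 'm"
    assume "\<And>i. i < l \<Longrightarrow> x i = y i" "slot x i (\<tau> i)"
    then show "slot y i (\<tau> i)" by (rule slot_cong)
  qed
  then show ?thesis using that \<tau>(1) by blast
qed

section \<open>The induced permutation of the slots and the factor maps\<close>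

context
  fixes \<tau> :: "nat \<Rightarrow> nat"
  assumes \<tau>: "\<And>i. i < l \<Longrightarrow> \<tau> i < l" "\<And>x i. nonzero x \<Longrightarrow> i < l \<Longrightarrow> slot x i (\<tau> i)"
begin

text \<open>On the way from \<open>x\<close> to \<open>y\<close>, one slot at a time, image slot
  \<open>s\<close> is affected only by the slots that \<open>\<tau>\<close> sends to
  \<open>s\<close>.\<close>

lemma agree_if_parallel_on_fibre:
  assumes x: "nonzero x" and y: "nonzero y" and s: "s < l"
    and par: "\<And>i. i < l \<Longrightarrow> \<tau> i = s \<Longrightarrow> parallel_vec (x i) (y i)"
  shows "agree s x y"
proof -
  let ?z = "\<lambda>k j. if j < k then y j else x j"
  have "agree s x (?z k)" if "k \<le> l" for k
    using that
  proof (induction k)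
    case 0
    then show ?case by (simp add: agree_refl)
  next
    case (Suc k)
    then have IH: "agree s x (?z k)" and k: "k < l" by auto
    have z: "nonzero (?z k)" using x y by (simp add: nonzero_tuple_def)
    note yk = nonzero_Rsp[OF y k] nonzero_nonzero[OF y k]
    have "agree s (?z k) ((?z k)(k := y k))"
    proof (cases "\<tau> k = s")
      case True
      then show ?thesis using par[OF k] by (intro agree_upd_parallel[OF z k yk _ s]) simp
    next
      case False
      then show ?thesis using \<tau>(2)[OF z k] yk s unfolding slot_def by blast
    qed
    moreover have "(?z k)(k := y k) = ?z (Suc k)" by (auto simp: fun_eq_iff less_Suc_eq)
    ultimately have "agree s (?z k) (?z (Suc k))" by simp
    then show ?case by (rule agree_trans[OF IH])
  qed
  from this[of l] have "agree s x (?z l)" by simp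
  moreover have "tens (?z l) = tens y" by (rule tensor_cong) simp
  ultimately show ?thesis by (simp add: agree_def)
qed

abbreviation "base \<equiv> \<lambda>_ :: nat. e1 :: real ^ 'm"
abbreviation "base_img \<equiv> img (tens base)"

lemma nonzero_base_img: "nonzero base_img"
  by (rule img(1)[OF nonzero_e1])

text \<open>For an index \<open>j\<close> outside the range, the \<open>j\<close>-th image factor
  would be constant up to scalars. The range of \<open>T\<close> would then be orthogonal to a
  nonzero decomposable vector, against surjectivity.\<close>

lemma \<tau>_surj: "\<tau> ` {..<l} = {..<l}"
proof
  show "\<tau> ` {..<l} \<subseteq> {..<l}" using \<tau>(1) by auto
  show "{..<l} \<subseteq> \<tau> ` {..<l}"
  proof (rule ccontr)
    assume "\<not> {..<l} \<subseteq> \<tau> ` {..<l}"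
    then obtain j where j: "j < l" "\<And>i. i < l \<Longrightarrow> \<tau> i \<noteq> j" by blast
    note g = nonzero_Rsp[OF nonzero_base_img j(1)] nonzero_nonzero[OF nonzero_base_img j(1)]
    obtain w where w: "w \<in> Rsp (d j)" "w \<noteq> 0" "\<not> parallel_vec (base_img j) w"
      using exists_not_parallel[OF j(1) g(2)] by blast
    obtain u where u: "u \<in> Rsp (d j)" "base_img j \<bullet> u = 0" "w \<bullet> u \<noteq> 0"
      using exists_orthogonal_witness[OF subspace_Rsp g(1) w(1) g(2) w(2,3)] by blast
    have u0: "u \<noteq> 0" using u(3) by auto
    let ?t = "tens (base_img(j := u))"
    have van: "T (tens x) \<bullet> ?t = 0" if x: "\<And>i. i < l \<Longrightarrow> x i \<in> Rsp (d i)" for x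
    proof (cases "nonzero x")
      case True
      have "agree j base x" using j(2) by (intro agree_if_parallel_on_fibre nonzero_e1 True j(1)) blast
      then obtain c where "c \<noteq> 0" "base_img j = c *\<^sub>R img (tens x) j"
        by (auto simp: agree_def parallel_vec_def)
      then have "img (tens x) j \<bullet> u = 0" using u(2) by simp
      then show ?thesis
        unfolding img(2)[OF True] by (subst inner_tensor_upd[OF j(1)]) (use nonzero_Rsp[OF img(1)[OF True]] in auto)
    next
      case False
      then have "tens x = 0" using x l by (intro tensor_zero) (auto simp: nonzero_tuple_def)
      then show ?thesis using linear_0[OF GL_facts(1)] by simp
    qed
    have "T v \<bullet> ?t = 0" for v
    proof (rule linear_eq_on_tensors[OF card, where f = "\<lambda>v. T v \<bullet> ?t" and g = "\<lambda>v. 0"])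
      show "linear (\<lambda>v. T v \<bullet> ?t)"
        using linear_compose[OF GL_facts(1) bounded_linear.linear[OF bounded_linear_inner_left]] by (simp add: o_def)
      show "linear (\<lambda>v. 0 :: real)" by (rule linearI) auto
      show "T (tens x) \<bullet> ?t = 0" if "\<And>i. i < l \<Longrightarrow> x i \<in> Rsp (d i)" for x using van that by blast
    qed
    moreover obtain v where "?t = T v" using GL_facts(2) by (metis bij_pointE)
    ultimately have "?t = 0" by (metis inner_eq_zero_iff)
    then show False using tens_nonzero[OF nonzero_tuple_upd[OF nonzero_base_img u(1) u0]] by simp
  qed
qed

definition slot_inv :: "nat \<Rightarrow> nat"
  where "slot_inv j = inv_into {..<l} \<tau> j"

lemma inj_\<tau>: "inj_on \<tau> {..<l}"
  using \<tau>_surj by (simp add: eq_card_imp_inj_on)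

lemma slot_inv: "j < l \<Longrightarrow> slot_inv j < l" "j < l \<Longrightarrow> \<tau> (slot_inv j) = j" "i < l \<Longrightarrow> slot_inv (\<tau> i) = i"
proof -
  show "slot_inv j < l" if "j < l"
    using inv_into_into[of j \<tau> "{..<l}"] that \<tau>_surj by (simp add: slot_inv_def)
  show "\<tau> (slot_inv j) = j" if "j < l"
    using f_inv_into_f[of j \<tau> "{..<l}"] that \<tau>_surj by (simp add: slot_inv_def)
  show "slot_inv (\<tau> i) = i" if "i < l"
    using inv_into_f_f[OF inj_\<tau>] that by (simp add: slot_inv_def)
qed

lemma bij_slot_inv: "bij_betw slot_inv {..<l} {..<l}"
  by (rule bij_betw_byWitness[where f' = \<tau>]) (use slot_inv \<tau>(1) in auto)

text \<open>
  The \<open>j\<close>-th factor of a decomposable vector whose other factors are those of the image of the base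
  point is recovered by contracting with these factors.
\<close>

definition contract :: "nat \<Rightarrow> real ^ 'm \<Rightarrow> real ^ 'm"
  where "contract j u = (\<chi> c. if c \<in> coord ` {..<d j}
    then (u \<bullet> tens (base_img(j := axis c 1))) / (\<Prod>s\<in>{..<l} - {j}. base_img s \<bullet> base_img s) else 0)"

lemma linear_contract: "linear (contract j)"
  by (rule linearI) (auto simp: contract_def vec_eq_iff inner_add_left add_divide_distrib)

lemma contract_in_Rsp: "contract j u \<in> Rsp (d j)"
  by (simp add: contract_def Rsp_def)

lemma contract_tensor:
  assumes j: "j < l" and z: "z \<in> Rsp (d j)"
  shows "contract j (tens (base_img(j := z))) = z"
proof -
  let ?N = "\<Prod>s\<in>{..<l} - {j}. base_img s \<bullet> base_img s"
  have N: "?N \<noteq> 0" using nonzero_nonzero[OF nonzero_base_img] by simp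
  have "tens (base_img(j := z)) \<bullet> tens (base_img(j := axis c 1)) = ?N * z $ c" for c
  proof -
    have "tens (base_img(j := z)) \<bullet> tens (base_img(j := axis c 1)) =
      (\<Prod>s\<in>{..<l} - {j}. (base_img(j := z)) s \<bullet> base_img s) * ((base_img(j := z)) j \<bullet> axis c 1)"
      using z nonzero_Rsp[OF nonzero_base_img] by (intro inner_tensor_upd[OF j]) auto
    also have "(\<Prod>s\<in>{..<l} - {j}. (base_img(j := z)) s \<bullet> base_img s) = ?N" by (rule prod.cong) auto
    also have "(base_img(j := z)) j \<bullet> axis c 1 = z $ c" by (simp add: inner_axis)
    finally show ?thesis .
  qed
  then have "contract j (tens (base_img(j := z))) $ c = z $ c" for c
    using N z by (auto simp: contract_def Rsp_def)
  then show ?thesis by (simp add: vec_eq_iff)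
qed

text \<open>The contraction makes this a linear map, whereas the factor given by \<open>img\<close>
  is chosen only up to a scalar that may depend on \<open>x\<close>.\<close>

definition factor_map :: "nat \<Rightarrow> real ^ 'm \<Rightarrow> real ^ 'm"
  where "factor_map j x = contract j (T (tens (base(slot_inv j := x))))"

lemma linear_factor_map: "j < l \<Longrightarrow> linear (factor_map j)"
  unfolding factor_map_def
  using linear_compose[OF linear_compose[OF linear_tensor_update[OF slot_inv(1)] GL_facts(1)] linear_contract]
  by (simp add: o_def)

lemma factor_map_facts:
  assumes j: "j < l" and x: "x \<in> Rsp (d (slot_inv j))" "x \<noteq> 0"
  shows "factor_map j x \<noteq> 0" "parallel_vec (img (tens (base(slot_inv j := x))) j) (factor_map j x)"
proof -
  note i = slot_inv(1)[OF j]
  let ?y = "base(slot_inv j := x)"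
  have y: "nonzero ?y" by (rule nonzero_tuple_upd[OF nonzero_e1 x])
  let ?G = "img (tens ?y)"
  have "\<exists>c. s < l \<longrightarrow> s \<noteq> j \<longrightarrow> c \<noteq> 0 \<and> ?G s = c *\<^sub>R base_img s" for s
  proof (cases "s < l \<and> s \<noteq> j")
    case True
    then have "agree s base ?y" using \<tau>(2)[OF nonzero_e1 i] x slot_inv(2)[OF j] unfolding slot_def by simp
    then show ?thesis using agree_sym unfolding agree_def parallel_vec_def by blast
  qed auto
  then obtain c where c: "\<And>s. s < l \<Longrightarrow> s \<noteq> j \<Longrightarrow> c s \<noteq> 0 \<and> ?G s = c s *\<^sub>R base_img s" by metis
  define c' where "c' = c(j := 1)"
  have c': "c' s \<noteq> 0" if "s < l" for s using c that by (simp add: c'_def)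
  define a where "a = (\<Prod>s<l. c' s)"
  have a: "a \<noteq> 0" using c' by (simp add: a_def)
  have "tens ?G = tens (\<lambda>s. c' s *\<^sub>R (base_img(j := ?G j)) s)"
    by (rule tensor_cong) (use c in \<open>auto simp: c'_def\<close>)
  also have "\<dots> = tens (base_img(j := a *\<^sub>R ?G j))"
    by (simp only: tensor_scale_all tensor_scale[OF j] a_def)
  finally have "T (tens ?y) = tens (base_img(j := a *\<^sub>R ?G j))" using img(2)[OF y] by simp
  moreover have "a *\<^sub>R ?G j \<in> Rsp (d j)" by (intro Rsp_scaleR nonzero_Rsp img(1) y j)
  ultimately have fm: "factor_map j x = a *\<^sub>R ?G j"
    unfolding factor_map_def using contract_tensor[OF j] by simp
  show "factor_map j x \<noteq> 0" using fm a nonzero_nonzero[OF img(1)[OF y] j] by simp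
  have "parallel_vec (factor_map j x) (?G j)" unfolding parallel_vec_def fm using a by blast
  then show "parallel_vec (?G j) (factor_map j x)" by (rule parallel_vec_sym)
qed

lemma factor_map_Rsp: "factor_map j x \<in> Rsp (d j)"
  unfolding factor_map_def by (rule contract_in_Rsp)

lemma factor_map_zero: "j < l \<Longrightarrow> x \<in> Rsp (d (slot_inv j)) \<Longrightarrow> factor_map j x = 0 \<Longrightarrow> x = 0"
  using factor_map_facts(1) by blast

abbreviation "mapped \<equiv> \<lambda>x j. factor_map j (x (slot_inv j))"

lemma GL_tensor_up_to_scalar:
  assumes x: "nonzero x"
  obtains c where "T (tens x) = c *\<^sub>R tens (mapped x)"
proof -
  have "parallel_vec (img (tens x) j) (mapped x j)" if j: "j < l" for j
  proof -
    let ?i = "slot_inv j"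
    note xi = nonzero_Rsp[OF x slot_inv(1)[OF j]] nonzero_nonzero[OF x slot_inv(1)[OF j]]
    have "agree j x (base(?i := x ?i))"
    proof (rule agree_if_parallel_on_fibre[OF x nonzero_tuple_upd[OF nonzero_e1 xi] j])
      fix i assume "i < l" "\<tau> i = j"
      then have "i = ?i" using slot_inv(3) by auto
      then show "parallel_vec (x i) ((base(?i := x ?i)) i)" by (simp add: parallel_vec_refl)
    qed
    then show ?thesis using factor_map_facts(2)[OF j xi] parallel_vec_trans unfolding agree_def by blast
  qed
  then have "\<exists>c. j < l \<longrightarrow> img (tens x) j = c *\<^sub>R mapped x j" for j
    unfolding parallel_vec_def by blast
  then obtain c where c: "\<And>j. j < l \<Longrightarrow> img (tens x) j = c j *\<^sub>R mapped x j" by metis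
  have "T (tens x) = tens (\<lambda>j. c j *\<^sub>R mapped x j)"
    unfolding img(2)[OF x] using c by (rule tensor_cong)
  also have "\<dots> = (\<Prod>j<l. c j) *\<^sub>R tens (mapped x)" by (rule tensor_scale_all)
  finally show ?thesis by (rule that)
qed

lemma mapped_upd:
  assumes k: "k < l"
  shows "tens (mapped (x(k := w))) = tens ((mapped x)(\<tau> k := factor_map (\<tau> k) w))"
proof (rule tensor_cong)
  fix j assume j: "j < l"
  show "mapped (x(k := w)) j = ((mapped x)(\<tau> k := factor_map (\<tau> k) w)) j"
    using slot_inv(2)[OF j] slot_inv(3)[OF k] by auto
qed

text \<open>The scalar in \<open>GL_tensor_up_to_scalar\<close> may depend on the tuple. For
  \<open>w\<close> not parallel to \<open>x k\<close>, additivity in slot \<open>k\<close> compares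
  the scalars at \<open>x k\<close>, at \<open>w\<close> and at their sum, and linear independence
  makes them equal.\<close>

lemma GL_tensor_mapped_step:
  assumes x: "nonzero x" and k: "k < l" and w: "w \<in> Rsp (d k)" "w \<noteq> 0" and eq: "T (tens x) = tens (mapped x)"
  shows "T (tens (x(k := w))) = tens (mapped (x(k := w)))"
proof -
  let ?t = "\<tau> k"
  note t = \<tau>(1)[OF k]
  note xk = nonzero_Rsp[OF x k] nonzero_nonzero[OF x k]
  let ?f = "factor_map ?t" and ?m = "mapped x"
  have f: "linear ?f" by (rule linear_factor_map[OF t])
  have f0: "v = 0" if "v \<in> Rsp (d k)" "?f v = 0" for v
    using factor_map_zero[OF t] that slot_inv(3)[OF k] by simp
  have mx: "tens ?m = tens (?m(?t := ?f (x k)))" using mapped_upd[OF k, of x "x k"] by simp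
  have nzm: "nonzero ?m"
    unfolding nonzero_tuple_def
    using factor_map_Rsp factor_map_zero nonzero_Rsp[OF x slot_inv(1)] nonzero_nonzero[OF x slot_inv(1)] by blast
  show ?thesis
  proof (cases "parallel_vec w (x k)")
    case True
    then obtain a where a: "w = a *\<^sub>R x k" by (auto simp: parallel_vec_def)
    have "T (tens (x(k := w))) = a *\<^sub>R tens ?m"
      using eq by (simp add: a tensor_scale[OF k] linear_cmul[OF GL_facts(1)])
    also have "\<dots> = tens (?m(?t := ?f w))"
      by (simp only: mx a linear_cmul[OF f] tensor_scale[OF t])
    finally show ?thesis by (simp only: mapped_upd[OF k])
  next
    case False
    have sum0: "x k + w \<noteq> 0"
    proof
      assume "x k + w = 0"
      then have "1 *\<^sub>R w = (- 1) *\<^sub>R x k" by (simp add: eq_neg_iff_add_eq_0 add.commute)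
      then show False using False parallel_vec_if_combination[of 1 w "-1" "x k"] w xk by simp
    qed
    obtain c where c: "T (tens (x(k := w))) = c *\<^sub>R tens (mapped (x(k := w)))"
      using GL_tensor_up_to_scalar[OF nonzero_tuple_upd[OF x w]] by blast
    obtain c' where c': "T (tens (x(k := x k + w))) = c' *\<^sub>R tens (mapped (x(k := x k + w)))"
      using GL_tensor_up_to_scalar[OF nonzero_tuple_upd[OF x Rsp_add[OF xk(1) w(1)] sum0]] by blast
    have "T (tens (x(k := x k + w))) = tens ?m + c *\<^sub>R tens (?m(?t := ?f w))"
      using eq c mapped_upd[OF k, of x w] by (simp add: tensor_add[OF k] linear_add[OF GL_facts(1)])
    moreover have "T (tens (x(k := x k + w))) = c' *\<^sub>R tens ?m + c' *\<^sub>R tens (?m(?t := ?f w))"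
      unfolding c' mapped_upd[OF k] linear_add[OF f] tensor_add[OF t] mx by (simp only: scaleR_add_right fun_upd_upd)
    ultimately have "(1 - c') *\<^sub>R tens ?m + (c - c') *\<^sub>R tens (?m(?t := ?f w)) = 0"
      by (simp add: algebra_simps)
    then have "tens (?m(?t := (1 - c') *\<^sub>R ?f (x k) + (c - c') *\<^sub>R ?f w)) = 0"
      unfolding mx by (simp only: tensor_add[OF t] tensor_scale[OF t] fun_upd_upd)
    then have "tens (?m(?t := ?f ((1 - c') *\<^sub>R x k + (c - c') *\<^sub>R w))) = 0"
      by (simp only: linear_add[OF f] linear_cmul[OF f])
    then have "?f ((1 - c') *\<^sub>R x k + (c - c') *\<^sub>R w) = 0"
      using tens_nonzero[OF nonzero_tuple_upd[OF nzm factor_map_Rsp]] by blast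
    then have comb: "(1 - c') *\<^sub>R x k + (c - c') *\<^sub>R w = 0"
      by (rule f0[rotated]) (intro Rsp_add Rsp_scaleR xk w)
    have "(c - c') *\<^sub>R w - (c' - 1) *\<^sub>R x k = (1 - c') *\<^sub>R x k + (c - c') *\<^sub>R w"
      by (simp add: scaleR_left_diff_distrib)
    then have cw: "(c - c') *\<^sub>R w = (c' - 1) *\<^sub>R x k"
      by (simp only: comb right_minus_eq)
    have c'1: "c' = 1"
      using parallel_vec_if_combination[OF cw _ w(2) xk(2)] False by auto
    have "c = 1" using cw w(2) unfolding c'1 by simp
    then show ?thesis using c by simp
  qed
qed

lemma GL_tensor_mapped:
  assumes x: "\<And>i. i < l \<Longrightarrow> x i \<in> Rsp (d i)"
  shows "T (tens x) = tens (mapped x)"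
proof (cases "nonzero x")
  case True
  show ?thesis
  proof (rule nonzero_tuple_path[of l d "\<lambda>x. T (tens x) = tens (mapped x)", OF _ _ nonzero_e1 True])
    fix x :: "nat \<Rightarrow> real ^ 'm" and k and w :: "real ^ 'm"
    assume "nonzero x" "k < l" "w \<in> Rsp (d k)" "w \<noteq> 0" "T (tens x) = tens (mapped x)"
    then show "T (tens (x(k := w))) = tens (mapped (x(k := w)))" by (rule GL_tensor_mapped_step)
  next
    fix x y :: "nat \<Rightarrow> real ^ 'm"
    assume xy: "\<And>i. i < l \<Longrightarrow> x i = y i" "T (tens x) = tens (mapped x)"
    have "tens x = tens y" using xy(1) by (rule tensor_cong)
    moreover have "tens (mapped x) = tens (mapped y)"
      by (rule tensor_cong) (simp add: xy(1)[OF slot_inv(1)])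
    ultimately show "T (tens y) = tens (mapped y)" using xy(2) by simp
  next
    \<comment> \<open>No scalar occurs at the base tuple, because \<open>contract\<close> is
      normalised there.\<close>
    have "mapped base j = base_img j" if j: "j < l" for j
    proof -
      have "base(slot_inv j := e1) = base" by auto
      then have "factor_map j e1 = contract j (tens (base_img(j := base_img j)))"
        unfolding factor_map_def using img(2)[OF nonzero_e1] by (simp only: fun_upd_triv)
      then show ?thesis using contract_tensor[OF j nonzero_Rsp[OF nonzero_base_img j]] by simp
    qed
    then show "T (tens base) = tens (mapped base)"
      unfolding img(2)[OF nonzero_e1] by (intro tensor_cong) simp
  qed
next
  case False
  then obtain i where i: "i < l" "x i = 0" using x by (auto simp: nonzero_tuple_def)
  then have "mapped x (\<tau> i) = 0" using slot_inv(3) linear_0[OF linear_factor_map[OF \<tau>(1)]] by simp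
  then have "tens (mapped x) = 0" using \<tau>(1) i l by (intro tensor_zero) auto
  moreover have "tens x = 0" using i l by (intro tensor_zero) auto
  ultimately show ?thesis using linear_0[OF GL_facts(1)] by simp
qed

text \<open>Injectivity of the factor maps gives one inequality for each \<open>j\<close>; a
  permutation does not change the sum of the dimensions, so all are equalities.\<close>

lemma dim_slot_inv:
  assumes j: "j < l"
  shows "d (slot_inv j) = d j"
proof -
  have dim: "dim (Rsp (d j) :: (real ^ 'm) set) = d j" if "j < l" for j
  proof -
    have "dim (Rsp (d j) :: (real ^ 'm) set) = card (coord ` {..<d j} :: 'm set)"
      unfolding Rsp_def dim_vec_eq[symmetric] by (rule dim_substandard_cart)
    then show ?thesis using inj_on_coord[OF dim_le_card[OF card that]] by (simp add: card_image)
  qed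
  have le: "d (slot_inv j) \<le> d j" if j: "j < l" for j
  proof -
    let ?E = "Rsp (d (slot_inv j)) :: (real ^ 'm) set"
    have "dim (factor_map j ` ?E) = dim ?E"
      by (rule dim_image_if_zero[OF linear_factor_map[OF j] subspace_Rsp factor_map_zero[OF j]])
    moreover have "dim (factor_map j ` ?E) \<le> dim (Rsp (d j) :: (real ^ 'm) set)"
      by (intro dim_subset) (use factor_map_Rsp in blast)
    ultimately show ?thesis using dim[OF j] dim[OF slot_inv(1)[OF j]] by simp
  qed
  have "(\<Sum>j<l. d (slot_inv j)) = (\<Sum>j<l. d j)"
    by (rule sum.reindex_bij_betw[OF bij_slot_inv])
  then show ?thesis
    using sum_mono_inv[of "\<lambda>j. d (slot_inv j)" "{..<l}" d j] le j by simp
qed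

end

proposition GL_tensor_structure:
  obtains \<sigma> B where "bij_betw \<sigma> {..<l} {..<l}" "\<And>j. j < l \<Longrightarrow> d (\<sigma> j) = d j"
    "\<And>j. j < l \<Longrightarrow> rblock (d j) (B j)" "\<And>j. j < l \<Longrightarrow> invertible (B j)"
    "\<And>x. (\<And>i. i < l \<Longrightarrow> x i \<in> Rsp (d i)) \<Longrightarrow> T (tens x) = tens (\<lambda>j. B j *v x (\<sigma> j))"
proof -
  obtain \<tau> where \<tau>: "\<And>i. i < l \<Longrightarrow> \<tau> i < l" "\<And>x i. nonzero x \<Longrightarrow> i < l \<Longrightarrow> slot x i (\<tau> i)"
    using slot_map_exists by blast
  let ?\<sigma> = "slot_inv \<tau>" and ?f = "factor_map \<tau>"
  have "\<exists>B. j < l \<longrightarrow> rblock (d j) B \<and> invertible B \<and> (\<forall>x\<in>Rsp (d j). B *v x = ?f j x)" for j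
  proof (cases "j < l")
    case True
    show ?thesis
    proof (rule block_matrix_extension[of "?f j" "d j"])
      show "linear (?f j)" by (rule linear_factor_map[OF \<tau> True])
      show "?f j x \<in> Rsp (d j)" for x by (rule factor_map_Rsp[OF \<tau>])
      show "x = 0" if "x \<in> Rsp (d j)" "?f j x = 0" for x
        using factor_map_zero[OF \<tau> True] dim_slot_inv[OF \<tau> True] that by simp
    qed blast
  qed blast
  then obtain B where B: "\<And>j. j < l \<Longrightarrow> rblock (d j) (B j)" "\<And>j. j < l \<Longrightarrow> invertible (B j)"
    "\<And>j x. j < l \<Longrightarrow> x \<in> Rsp (d j) \<Longrightarrow> B j *v x = ?f j x" by metis
  have "T (tens x) = tens (\<lambda>j. B j *v x (?\<sigma> j))" if x: "\<And>i. i < l \<Longrightarrow> x i \<in> Rsp (d i)" for x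
  proof -
    have "T (tens x) = tens (\<lambda>j. ?f j (x (?\<sigma> j)))" using GL_tensor_mapped[OF \<tau> x] by blast
    also have "\<dots> = tens (\<lambda>j. B j *v x (?\<sigma> j))"
    proof (rule tensor_cong)
      fix j assume j: "j < l"
      have "x (?\<sigma> j) \<in> Rsp (d j)" using x[OF slot_inv(1)[OF \<tau> j]] dim_slot_inv[OF \<tau> j] by simp
      then show "?f j (x (?\<sigma> j)) = B j *v x (?\<sigma> j)" using B(3)[OF j] by simp
    qed
    finally show ?thesis .
  qed
  then show ?thesis
    using that[OF bij_slot_inv[OF \<tau>] dim_slot_inv[OF \<tau>] B(1,2)] by blast
qed

end

end

section \<open>The retraction\<close>

lemma sym_convex_body_image:
  fixes B :: "real ^ 'n ^ 'n"
  assumes E: "subspace E" and inv: "invertible B"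
    and BE: "\<And>x. x \<in> E \<Longrightarrow> B *v x \<in> E" "\<And>x. x \<in> E \<Longrightarrow> matrix_inv B *v x \<in> E"
    and P: "sym_convex_body E P"
  shows "sym_convex_body E ((*v) B ` P)"
proof -
  let ?C = "matrix_inv B"
  have BC: "B *v (?C *v x) = x" for x
    using matrix_inv[OF inv] by (simp add: matrix_vector_mul_assoc)
  have facts: "P \<subseteq> E" "compact P" "convex P" "\<forall>x\<in>P. - x \<in> P"
    using P unfolding sym_convex_body_iff[OF E] by blast+
  obtain r where r: "r > 0" "\<And>x. x \<in> E \<Longrightarrow> norm x \<le> r \<Longrightarrow> x \<in> P"
    using P unfolding sym_convex_body_iff[OF E] by blast
  have "\<exists>r>0. \<forall>x\<in>E. norm x \<le> r \<longrightarrow> x \<in> (*v) B ` P"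
  proof (intro exI conjI ballI impI)
    have k: "norm ?C + 1 > 0" using norm_ge_zero[of ?C] by linarith
    then show "r / (norm ?C + 1) > 0" using r by simp
    fix x assume x: "x \<in> E" "norm x \<le> r / (norm ?C + 1)"
    have "norm (?C *v x) \<le> norm ?C * norm x" by (rule norm_matrix_vector_le)
    also have "\<dots> \<le> (norm ?C + 1) * (r / (norm ?C + 1))" using x k r by (intro mult_mono) auto
    also have "\<dots> = r" using k by simp
    finally have "?C *v x \<in> P" using r(2) BE(2)[OF x(1)] by blast
    then show "x \<in> (*v) B ` P" using BC[of x] by (metis image_eqI)
  qed
  moreover have "(*v) B ` P \<subseteq> E" using BE(1) facts(1) by blast
  moreover have "compact ((*v) B ` P)"
    using facts(2) by (intro compact_continuous_image linear_continuous_on matrix_vector_mul_bounded_linear)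
  moreover have "convex ((*v) B ` P)" using facts(3) by (intro convex_linear_image matrix_vector_mul_linear)
  moreover have "\<forall>x\<in>(*v) B ` P. - x \<in> (*v) B ` P"
    using facts(4) linear_neg[OF matrix_vector_mul_linear, of B] by (metis (no_types, lifting) image_iff)
  ultimately show ?thesis unfolding sym_convex_body_iff[OF E] by blast
qed

text \<open>The new factors are the images of \<open>P (\<sigma> j)\<close> under
  \<open>B j\<close>. The upper inclusion uses the adjoint of \<open>T\<close>, which takes a tensor
  of polar vectors of the \<open>P' j\<close> to a tensor of polar vectors of the
  \<open>P i\<close>.\<close>

lemma GL_tensor_image_tensorial:
  fixes T :: "real ^ 'm::finite \<Rightarrow> real ^ 'm"
  assumes card: "CARD('m) = (\<Prod>i<l. d i)" and l: "l \<ge> 1" and d2: "\<And>i. i < l \<Longrightarrow> d i \<ge> 2"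
    and T: "T \<in> GL_tensor l d" and PQ: "tensorial_wrt l d P Q"
  obtains P' where "tensorial_wrt l d P' (T ` Q)" "proj_tensor l d P' = T ` proj_tensor l d P"
proof -
  have d1: "\<And>i. i < l \<Longrightarrow> d i \<ge> 1" using d2 by fastforce
  note assm = card l d1 PQ
  have lin: "linear T" and bij: "bij T" using T by (auto simp: GL_tensor_def)
  obtain \<sigma> B where \<sigma>: "bij_betw \<sigma> {..<l} {..<l}" "\<And>j. j < l \<Longrightarrow> d (\<sigma> j) = d j"
    and B: "\<And>j. j < l \<Longrightarrow> rblock (d j) (B j)" "\<And>j. j < l \<Longrightarrow> invertible (B j)"
    and TB: "\<And>x. (\<And>i. i < l \<Longrightarrow> x i \<in> Rsp (d i)) \<Longrightarrow> T (tensor l d x) = tensor l d (\<lambda>j. B j *v x (\<sigma> j))"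
    using GL_tensor_structure[OF card l d2 T] by blast
  have \<sigma>l: "\<sigma> j < l" if "j < l" for j using \<sigma>(1) that by (auto simp: bij_betw_def)
  define \<tau> where "\<tau> = inv_into {..<l} \<sigma>"
  have \<tau>: "\<tau> i < l" "\<sigma> (\<tau> i) = i" if "i < l" for i
    using bij_betw_inv_into_right[OF \<sigma>(1), of i] bij_betw_inv_into[OF \<sigma>(1)] that
    by (auto simp: \<tau>_def bij_betw_def)
  have \<tau>\<sigma>: "\<tau> (\<sigma> j) = j" if "j < l" for j
    using bij_betw_inv_into_left[OF \<sigma>(1)] that by (simp add: \<tau>_def)
  define P' where "P' j = (*v) (B j) ` P (\<sigma> j)" for j
  have PR: "x \<in> Rsp (d i)" if "i < l" "x \<in> P i" for i x
    using factor_subset_Rsp[OF assm that(1)] that(2) by blast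
  have body: "sym_convex_body (Rsp (d j)) (P' j)" if j: "j < l" for j
    unfolding P'_def
    using rblock_Rsp[OF B(1)[OF j]] rblock_Rsp[OF block_matrix_inv[OF B(1,2)[OF j]]]
      tensorial_factor[OF assm \<sigma>l[OF j]] \<sigma>(2)[OF j]
    by (intro sym_convex_body_image subspace_Rsp B(2)[OF j]) auto
  have "T ` {tensor l d x | x. \<forall>i<l. x i \<in> P i} = {tensor l d x | x. \<forall>i<l. x i \<in> P' i}"
  proof (intro set_eqI iffI)
    fix u assume "u \<in> T ` {tensor l d x | x. \<forall>i<l. x i \<in> P i}"
    then obtain x where x: "\<forall>i<l. x i \<in> P i" "u = T (tensor l d x)" by blast
    have "u = tensor l d (\<lambda>j. B j *v x (\<sigma> j))" unfolding x(2) using x(1) PR by (intro TB) blast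
    moreover have "\<forall>j<l. B j *v x (\<sigma> j) \<in> P' j" using x(1) \<sigma>l by (auto simp: P'_def)
    ultimately show "u \<in> {tensor l d x | x. \<forall>i<l. x i \<in> P' i}" by blast
  next
    fix u assume "u \<in> {tensor l d x | x. \<forall>i<l. x i \<in> P' i}"
    then obtain y where y: "\<forall>j<l. y j \<in> P' j" "u = tensor l d y" by blast
    then have "\<exists>z. j < l \<longrightarrow> z \<in> P (\<sigma> j) \<and> y j = B j *v z" for j by (auto simp: P'_def)
    then obtain z where z: "\<And>j. j < l \<Longrightarrow> z j \<in> P (\<sigma> j)" "\<And>j. j < l \<Longrightarrow> y j = B j *v z j" by metis
    let ?x = "\<lambda>i. z (\<tau> i)"
    have x: "?x i \<in> P i" if "i < l" for i using z(1)[OF \<tau>(1)[OF that]] \<tau>(2)[OF that] by simp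
    have "T (tensor l d ?x) = tensor l d (\<lambda>j. B j *v ?x (\<sigma> j))" using x PR by (intro TB) blast
    also have "\<dots> = tensor l d y" by (rule tensor_cong) (simp add: z(2) \<tau>\<sigma>)
    finally have "u = T (tensor l d ?x)" using y(2) by simp
    then show "u \<in> T ` {tensor l d x | x. \<forall>i<l. x i \<in> P i}" using x by blast
  qed
  then have proj: "proj_tensor l d P' = T ` proj_tensor l d P"
    unfolding proj_tensor_def by (simp add: convex_hull_linear_image[OF lin])
  have inj: "T z \<in> inj_tensor l d P'" if z: "z \<in> inj_tensor l d P" for z
  proof -
    have "proj_tensor l d (\<lambda>j. polar (Rsp (d j)) (P' j)) \<subseteq> {u. \<bar>u \<bullet> T z\<bar> \<le> 1}"
    proof (rule proj_tensor_subset[OF convex_abs_inner_le])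
      fix y assume y: "\<And>j. j < l \<Longrightarrow> y j \<in> polar (Rsp (d j)) (P' j)"
      define w where "w j = transpose (B j) *v y j" for j
      have yR: "y j \<in> Rsp (d j)" if "j < l" for j using y[OF that] by (simp add: polar_def)
      have "w j \<in> polar (Rsp (d (\<sigma> j))) (P (\<sigma> j))" if j: "j < l" for j
      proof -
        have "w j \<in> Rsp (d j)"
          unfolding w_def by (intro rblock_Rsp block_transpose B(1) yR j)
        moreover have "\<bar>p \<bullet> w j\<bar> \<le> 1" if p: "p \<in> P (\<sigma> j)" for p
        proof -
          have "p \<bullet> w j = (B j *v p) \<bullet> y j"
            by (simp only: w_def inner_matrix_vector_right transpose_transpose)
          moreover have "B j *v p \<in> P' j" using p by (simp add: P'_def)
          ultimately show ?thesis using y[OF j] by (simp add: polar_def)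
        qed
        ultimately show ?thesis by (simp add: polar_def \<sigma>(2)[OF j])
      qed
      then have "w (\<tau> i) \<in> polar (Rsp (d i)) (P i)" if "i < l" for i using \<tau>[OF that] by metis
      then have "tensor l d (\<lambda>i. w (\<tau> i)) \<in> proj_tensor l d (\<lambda>i. polar (Rsp (d i)) (P i))"
        by (rule tensor_in_proj_tensor)
      then have le: "\<bar>tensor l d (\<lambda>i. w (\<tau> i)) \<bullet> z\<bar> \<le> 1" using z by (auto simp: inj_tensor_def polar_def)
      \<comment> \<open>The adjoint of \<open>T\<close> on decomposable vectors: factor
        \<open>j\<close> is multiplied by \<open>transpose (B j)\<close> and moved to slot
        \<open>\<sigma> j\<close>.\<close>
      have "tensor l d y \<bullet> T v = tensor l d (\<lambda>i. w (\<tau> i)) \<bullet> v" for v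
      proof (rule linear_eq_on_tensors[OF card, where f = "\<lambda>v. tensor l d y \<bullet> T v"])
        show "linear (\<lambda>v. tensor l d y \<bullet> T v)"
          using linear_compose[OF lin bounded_linear.linear[OF bounded_linear_inner_right]] by (simp add: o_def)
        show "linear (\<lambda>v. tensor l d (\<lambda>i. w (\<tau> i)) \<bullet> v)"
          by (rule bounded_linear.linear[OF bounded_linear_inner_right])
        fix x :: "nat \<Rightarrow> real ^ 'm" assume x: "\<And>i. i < l \<Longrightarrow> x i \<in> Rsp (d i)"
        have "tensor l d y \<bullet> T (tensor l d x) = tensor l d y \<bullet> tensor l d (\<lambda>j. B j *v x (\<sigma> j))"
          using TB x by simp
        also have "\<dots> = (\<Prod>j<l. y j \<bullet> (B j *v x (\<sigma> j)))"
          by (rule inner_tensor[OF card yR])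
        also have "\<dots> = (\<Prod>j<l. w (\<tau> (\<sigma> j)) \<bullet> x (\<sigma> j))"
          by (intro prod.cong refl) (simp only: w_def inner_matrix_vector_right \<tau>\<sigma> lessThan_iff)
        also have "\<dots> = (\<Prod>i<l. w (\<tau> i) \<bullet> x i)"
          by (rule prod.reindex_bij_betw[OF \<sigma>(1)])
        also have "\<dots> = tensor l d x \<bullet> tensor l d (\<lambda>i. w (\<tau> i))"
          using inner_tensor[OF card x, of "\<lambda>i. w (\<tau> i)"] by (simp add: inner_commute)
        finally show "tensor l d y \<bullet> T (tensor l d x) = tensor l d (\<lambda>i. w (\<tau> i)) \<bullet> tensor l d x"
          by (simp add: inner_commute)
      qed
      then show "tensor l d y \<in> {u. \<bar>u \<bullet> T z\<bar> \<le> 1}" using le by simp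
    qed
    then show ?thesis by (auto simp: inj_tensor_def polar_def)
  qed
  have "sym_convex_body UNIV (T ` Q)"
  proof -
    have "sym_convex_body UNIV ((*v) (matrix T) ` Q)"
      using tensorial_body[OF assm] invertible_matrix_linear_bij[OF lin bij]
      by (intro sym_convex_body_image) auto
    then show ?thesis using lin by (simp add: matrix_works)
  qed
  moreover have "proj_tensor l d P' \<subseteq> T ` Q" unfolding proj using tensorial_lower[OF assm] by blast
  moreover have "T ` Q \<subseteq> inj_tensor l d P'" using inj tensorial_upper[OF assm] by blast
  ultimately show ?thesis using that[of P'] body proj by (simp add: tensorial_wrt_def)
qed

text \<open>A dilation inclusion passes to the hulls of the decomposable parts, since multiples of
  decomposable vectors are decomposable and decomposable points of \<open>Q'\<close> can be written
  with factors in the \<open>P' i\<close>.\<close>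

lemma scaled_proj_tensor_subset:
  fixes Q Q' :: "(real ^ 'm::finite) set"
  assumes card: "CARD('m) = (\<Prod>i<l. d i)" and l: "l \<ge> 1" and d1: "\<And>i. i < l \<Longrightarrow> d i \<ge> 1"
    and Q: "tensorial_wrt l d P Q" and Q': "tensorial_wrt l d P' Q'"
    and a: "\<And>u. u \<in> Q \<Longrightarrow> a *\<^sub>R u \<in> Q'" and u: "u \<in> proj_tensor l d P"
  shows "a *\<^sub>R u \<in> proj_tensor l d P'"
proof -
  have "proj_tensor l d P \<subseteq> (*\<^sub>R) a -` proj_tensor l d P'"
  proof (rule proj_tensor_subset)
    show "convex ((*\<^sub>R) a -` proj_tensor l d P')"
      unfolding proj_tensor_def
      by (intro convex_linear_vimage convex_convex_hull bounded_linear.linear bounded_linear_scaleR_right)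
    fix x assume x: "\<And>i. i < l \<Longrightarrow> x i \<in> P i"
    let ?y = "x(0 := a *\<^sub>R x 0)"
    have eq: "tensor l d ?y = a *\<^sub>R tensor l d x" using tensor_scale[of 0 l d x a "x 0"] l by simp
    have "tensor l d x \<in> Q"
      using tensor_in_proj_tensor[of l x P d] x tensorial_lower[OF card l d1 Q] by blast
    then have "tensor l d ?y \<in> Q'" unfolding eq by (rule a)
    moreover have "?y i \<in> Rsp (d i)" if "i < l" for i
      using factor_subset_Rsp[OF card l d1 Q that] x[OF that] by (auto intro: Rsp_scaleR)
    ultimately obtain y' where "\<And>i. i < l \<Longrightarrow> y' i \<in> P' i" "tensor l d y' = tensor l d ?y"
      using tensor_in_tensorialE[OF card l d1 Q'] by blast
    then show "tensor l d x \<in> (*\<^sub>R) a -` proj_tensor l d P'"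
      using tensor_in_proj_tensor[of l y' P' d] by (simp add: eq)
  qed
  then show ?thesis using u by blast
qed

lemma l_tensor_continuous:
  fixes Q :: "(real ^ 'm::finite) set"
  assumes card: "CARD('m) = (\<Prod>i<l. d i)" and l: "l \<ge> 1" and d1: "\<And>i. i < l \<Longrightarrow> d i \<ge> 1"
    and Q: "Q \<in> tensorial_bodies l d" and e: "e > 0"
  obtains \<eta> where "\<eta> > 0"
    "\<And>Q'. Q' \<in> tensorial_bodies l d \<Longrightarrow> hausdorff_dist Q Q' < \<eta> \<Longrightarrow> hausdorff_dist (l_tensor l d Q) (l_tensor l d Q') < e"
proof -
  obtain P where P: "tensorial_wrt l d P Q" using Q tensorial_bodies_iff by blast
  obtain A where A: "loewner_position (proj_tensor l d P) A" "l_tensor l d Q = ell A"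
    using ex_loewner_position[OF card l d1 P] by blast
  have "bounded (ell A)"
    using A(1) compact_ell compact_imp_bounded unfolding loewner_position_def by blast
  then obtain R where R: "R > 0" "ell A \<subseteq> cball 0 R" by (auto simp: bounded_pos subset_iff)
  \<comment> \<open>Multiplied by the radius \<open>R\<close>, this relative error becomes
    \<open>e/2\<close>, strictly below \<open>e\<close>.\<close>
  have e': "e / (2 * R) > 0" using e R by simp
  obtain \<delta> where \<delta>: "0 < \<delta>" "\<delta> < 1"
    "\<And>C C' (A :: real^'m^'m) A' x. \<lbrakk>loewner_position C A; loewner_position C' A'; near_factor \<delta> C C'\<rbrakk>
      \<Longrightarrow> norm (A' *v x) \<le> (1 + e / (2 * R)) * norm (A *v x) \<and> norm (A *v x) \<le> (1 + e / (2 * R)) * norm (A' *v x)"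
    using loewner_position_stable[OF e'] by blast
  have bodyQ: "compact Q" "convex Q" "\<exists>r>0. cball 0 r \<subseteq> Q"
    using tensorial_body[OF card l d1 P] unfolding sym_convex_body_iff[OF subspace_UNIV] by (auto simp: subset_iff)
  then obtain r where r: "r > 0" "cball 0 r \<subseteq> Q" by blast
  show ?thesis
  proof (rule that)
    \<comment> \<open>The threshold below which Hausdorff closeness to \<open>Q\<close> yields
      dilation factors for \<delta>; \<open>r\<close> is the radius of a ball inside
      \<open>Q\<close>.\<close>
    show "\<delta> * r > 0" using \<delta> r by simp
    fix Q' :: "(real ^ 'm) set" assume Q': "Q' \<in> tensorial_bodies l d" and h: "hausdorff_dist Q Q' < \<delta> * r"
    obtain P' where P': "tensorial_wrt l d P' Q'" using Q' tensorial_bodies_iff by blast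
    obtain A' where A': "loewner_position (proj_tensor l d P') A'" "l_tensor l d Q' = ell A'"
      using ex_loewner_position[OF card l d1 P'] by blast
    have bodyQ': "compact Q'" "convex Q'" "Q' \<noteq> {}"
      using tensorial_body[OF card l d1 P'] sym_convex_body_zero[OF subspace_UNIV tensorial_body[OF card l d1 P']]
      unfolding sym_convex_body_iff[OF subspace_UNIV] by auto
    have "near_factor \<delta> Q Q'"
      by (rule near_factor_if_hausdorff_dist_less[OF bodyQ(1,2) r(2,1) bodyQ' \<delta>(1,2) h])
    then have "near_factor \<delta> (proj_tensor l d P) (proj_tensor l d P')"
      unfolding near_factor_def
      using scaled_proj_tensor_subset[OF card l d1 P P'] scaled_proj_tensor_subset[OF card l d1 P' P] by blast
    note near = \<delta>(3)[OF A(1) A'(1) this]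
    have "hausdorff_dist (ell A) (ell A') \<le> e / (2 * R) * R"
      using near e' by (intro hausdorff_dist_ell_le R(2)) auto
    also have "\<dots> < e" using e R by simp
    finally show "hausdorff_dist (l_tensor l d Q) (l_tensor l d Q') < e" by (simp add: A(2) A'(2))
  qed
qed

theorem proposition4p5:
  fixes l :: nat and d :: "nat \<Rightarrow> nat"
  assumes "l \<ge> 2" and "\<forall>i<l. d i \<ge> 2"
    and "CARD('m::finite) = (\<Prod>i<l. d i)"
  shows "retraction_maps
           (tensorial_body_topology l d)
           (subtopology (tensorial_body_topology l d) (tensorial_ellipsoids l d))
           (l_tensor l d :: (real ^ 'm) set \<Rightarrow> (real ^ 'm) set) id \<and>
         (\<forall>T \<in> GL_tensor l d. \<forall>Q \<in> tensorial_bodies l d.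
           l_tensor l d (T ` Q) = T ` l_tensor l d (Q :: (real ^ 'm) set))"
proof
  note card = assms(3)
  have l: "l \<ge> 1" using assms(1) by simp
  have d2: "\<And>i. i < l \<Longrightarrow> d i \<ge> 2" using assms(2) by blast
  then have d1: "\<And>i. i < l \<Longrightarrow> d i \<ge> 1" by fastforce
  let ?B = "tensorial_bodies l d :: (real ^ 'm) set set" and ?E = "tensorial_ellipsoids l d :: (real ^ 'm) set set"
  let ?X = "tensorial_body_topology l d :: (real ^ 'm) set topology"
  let ?f = "l_tensor l d :: (real ^ 'm) set \<Rightarrow> (real ^ 'm) set"
  interpret Metric_space ?B hausdorff_dist by (rule Metric_space_tensorial_bodies)
  have X: "?X = mtopology" by (simp add: tensorial_body_topology_def)
  have topX: "topspace ?X = ?B" by (simp add: X)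
  have EB: "?E \<subseteq> ?B" by (auto simp: tensorial_ellipsoids_def)
  have fE: "?f Q \<in> ?E" if "Q \<in> ?B" for Q
    using that l_tensor_in_tensorial_ellipsoids[OF card l d1] tensorial_bodies_iff by blast
  have "continuous_map ?X ?X ?f"
    unfolding X metric_continuous_map[OF Metric_space_tensorial_bodies]
  proof (intro conjI ballI allI impI)
    show "?f ` ?B \<subseteq> ?B" using fE EB by blast
    fix Q and e :: real assume "Q \<in> ?B" "e > 0"
    then obtain \<eta> where "\<eta> > 0" "\<And>Q'. Q' \<in> ?B \<Longrightarrow> hausdorff_dist Q Q' < \<eta> \<Longrightarrow> hausdorff_dist (?f Q) (?f Q') < e"
      using l_tensor_continuous[OF card l d1] by blast
    then show "\<exists>\<delta>>0. \<forall>Q'. Q' \<in> ?B \<and> hausdorff_dist Q Q' < \<delta> \<longrightarrow> hausdorff_dist (?f Q) (?f Q') < e"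
      by blast
  qed
  then have "continuous_map ?X (subtopology ?X ?E) ?f"
    using fE by (intro continuous_map_into_subtopology) (auto simp: topX)
  moreover have "continuous_map (subtopology ?X ?E) ?X id"
    by (intro continuous_map_from_subtopology continuous_map_id)
  moreover have "?f Q = Q" if Q: "Q \<in> ?E" for Q
  proof -
    obtain P where P: "tensorial_wrt l d P Q" using Q EB tensorial_bodies_iff by blast
    have "ellipsoid Q" using Q by (simp add: tensorial_ellipsoids_def)
    then show ?thesis
      using l_tensor_eq[OF card l d1 P] tensorial_ellipsoid_eq_Loewner[OF card l d1 P] by simp
  qed
  ultimately show "retraction_maps ?X (subtopology ?X ?E) ?f id"
    by (auto simp: retraction_maps_def topX)
  show "\<forall>T \<in> GL_tensor l d. \<forall>Q \<in> ?B. ?f (T ` Q) = T ` ?f Q"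
  proof (intro ballI)
    fix T :: "real ^ 'm \<Rightarrow> real ^ 'm" and Q assume T: "T \<in> GL_tensor l d" and Q: "Q \<in> ?B"
    obtain P where P: "tensorial_wrt l d P Q" using Q tensorial_bodies_iff by blast
    obtain P' where P': "tensorial_wrt l d P' (T ` Q)" "proj_tensor l d P' = T ` proj_tensor l d P"
      using GL_tensor_image_tensorial[OF card l d2 T P] by blast
    obtain A where A: "loewner_position (proj_tensor l d P) A"
      using ex_loewner_position[OF card l d1 P] by blast
    \<comment> \<open>In general \<open>T\<close> does not carry the sections of \<open>Q\<close> at
      \<open>e1\<close> to those of the image body, so the comparison goes through the witnessing
      factors.\<close>
    have "?f (T ` Q) = Loewner (T ` proj_tensor l d P)"
      using l_tensor_eq[OF card l d1 P'(1)] P'(2) by simp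
    also have "\<dots> = T ` Loewner (proj_tensor l d P)"
      using T by (intro Loewner_image[OF A]) (auto simp: GL_tensor_def)
    also have "\<dots> = T ` ?f Q" using l_tensor_eq[OF card l d1 P] by simp
    finally show "?f (T ` Q) = T ` ?f Q" .
  qed
qed

end
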